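(* Let $G$ be a finite group, $B$ a block of $\mathcal{O}G$, and $\chi\in\mathrm{Irr}_K(B)$. Suppose that $\chi$ has height zero. Then the $\mathcal{O}$-algebra $\mathcal{O}Ge(\chi)$ is symmetric if and only if $\chi$ lifts an irreducible Brauer character.
   Context: Let $p$ be a prime and $\mathcal{O}$ a complete discrete valuation ring with residue field $k$ of characteristic $p$ and quotient field $K$ of characteristic zero; $K$ and $k$ are assumed to be splitting fields for all finite groups under consideration. For a block algebra $B$ of $\mathcal{O}G$, $\mathrm{Irr}_K(B)$ is the set of irreducible $K$-characters of $G$ associated with $B$. For an irreducible $K$-character $\chi$ of $G$, $e(\chi)=\frac{\chi(1)}{|G|}\sum_{x\in G}\chi(x^{-1})x$ is the primitive idempotent of $Z(KG)$ corresponding to $\chi$, and $\mathcal{O}Ge(\chi)\subseteq KG$ is the image of $\mathcal{O}G$ under multiplication by $e(\chi)$, an $\mathcal{O}$-algebra with unit $e(\chi)$. We say that $\chi$ lifts an irreducible Brauer character $\varphi$ of $G$ if the restriction of $\chi$ to the $p'$-elements of $G$ equals $\varphi$. A character $\chi\in\mathrm{Irr}_K(B)$ has height zero if the $p$-part of $\chi(1)$ equals the $p$-part of $|G:P|$, where $P$ is a defect group of $B$. An $\mathcal{O}$-algebra $A$ is symmetric if $A$ is finitely generated projective as an $\mathcal{O}$-module and $A\cong\mathrm{Hom}_{\mathcal{O}}(A,\mathcal{O})$ as $A$-$A$-bimodules. *)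

theory Defs
  imports
    "Jordan_Normal_Form.VS_Connect"
    "Jordan_Normal_Form.Char_Poly"
    "HOL-Algebra.Ring_Divisibility"
    "HOL-Algebra.Left_Coset"
    "HOL-Algebra.Multiplicative_Group"
begin

hide_const (open) Multiset.mult Polynomial.smult

section \<open>The coefficient rings\<close>

locale discrete_valuation_ring = principal_domain R for R (structure) +
  assumes not_field: "\<not> field R"
    and local: "\<exists>!M. maximalideal M R"

text \<open>Completeness is with respect to the powers of the maximal ideal; if that ideal is generated
  by \<open>t\<close>, its \<open>n\<close>-th power is the principal ideal generated by the \<open>n\<close>-th power of \<open>t\<close>.\<close>

locale complete_discrete_valuation_ring = discrete_valuation_ring R for R (structure) +
  assumes complete:
    "\<lbrakk>t \<in> carrier R; maximalideal (PIdl t) R; \<And>i::nat. x i \<in> carrier R;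
      \<And>n::nat. \<exists>N. \<forall>i\<ge>N. \<forall>j\<ge>N. x i \<ominus> x j \<in> PIdl (t [^] n)\<rbrakk>
     \<Longrightarrow> \<exists>l \<in> carrier R. \<forall>n::nat. \<exists>N. \<forall>i\<ge>N. x i \<ominus> l \<in> PIdl (t [^] n)"

definition subring_of :: "'k::field set \<Rightarrow> 'k ring" where
  "subring_of R = class_ring\<lparr>carrier := R\<rparr>"

text \<open>The quotient field \<open>K\<close> and the residue field \<open>k\<close> are the types \<open>'k\<close> and \<open>'f\<close>; \<open>\<O>\<close> is a subring
  of \<open>K\<close>. The map \<open>red\<close> is the canonical surjection onto \<open>k\<close>: its kernel is a maximal ideal since \<open>'f\<close>
  is a field, hence it is the unique maximal ideal of \<open>\<O>\<close>. Values of \<open>red\<close> outside \<open>\<O>\<close> play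
  no role.\<close>

locale p_modular_system =
  fixes p :: nat and \<O> :: "'k::field_char_0 set" and red :: "'k \<Rightarrow> 'f::field"
  assumes prime_p: "Factorial_Ring.prime p"
    and complete_dvr: "complete_discrete_valuation_ring (subring_of \<O>)"
    and quotient_field: "\<And>x. \<exists>a\<in>\<O>. \<exists>b\<in>\<O>. b \<noteq> 0 \<and> x = a / b"
    and red_hom: "red \<in> Ring.ring_hom (subring_of \<O>) class_ring"
    and red_surj: "red ` \<O> = UNIV"
    and char_residue_field: "CHAR('f) = p"

section \<open>Representations and ordinary characters\<close>

definition GL :: "'a::field itself \<Rightarrow> nat \<Rightarrow> 'a mat monoid" where
  "GL ty n = units_of (ring_mat ty n ())"

definition irreducible_rep ::
  "('g, 'm) monoid_scheme \<Rightarrow> nat \<Rightarrow> ('g \<Rightarrow> 'a::field mat) \<Rightarrow> bool" where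
  "irreducible_rep G n \<rho> \<longleftrightarrow> 0 < n \<and> \<rho> \<in> hom G (GL TYPE('a) n) \<and>
     (\<forall>W. VectorSpace.subspace class_ring W (module_vec TYPE('a) n) \<and>
          (\<forall>g\<in>carrier G. \<forall>v\<in>W. \<rho> g *\<^sub>v v \<in> W)
        \<longrightarrow> W = {0\<^sub>v n} \<or> W = carrier_vec n)"

text \<open>A field is a splitting field if the endomorphism ring of every simple module consists of the
  scalars only.\<close>

definition splitting_field :: "'a::field itself \<Rightarrow> ('g, 'm) monoid_scheme \<Rightarrow> bool" where
  "splitting_field _ G \<longleftrightarrow>
     (\<forall>n (\<rho> :: 'g \<Rightarrow> 'a mat). irreducible_rep G n \<rho> \<longrightarrow>
        (\<forall>M\<in>carrier_mat n n. (\<forall>g\<in>carrier G. M * \<rho> g = \<rho> g * M) \<longrightarrow> (\<exists>c. M = c \<cdot>\<^sub>m 1\<^sub>m n)))"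

definition mat_trace :: "'a::comm_ring_1 mat \<Rightarrow> 'a" where
  "mat_trace A = (\<Sum>i<dim_row A. A $$ (i, i))"

definition character :: "('g, 'm) monoid_scheme \<Rightarrow> ('g \<Rightarrow> 'a::field mat) \<Rightarrow> 'g \<Rightarrow> 'a" where
  "character G \<rho> = (\<lambda>g\<in>carrier G. mat_trace (\<rho> g))"

section \<open>Group algebras and blocks\<close>

text \<open>Elements of \<open>RG\<close> are the coefficient functions vanishing outside \<open>G\<close>. The coefficient ring
  is given by its carrier \<open>R\<close> in a field, so that \<open>\<O>G\<close> is contained in \<open>KG\<close>, which
  is the case \<open>R = UNIV\<close>. The operations do not depend on \<open>R\<close>.\<close>

definition group_algebra ::
  "('g, 'm) monoid_scheme \<Rightarrow> 'k::field set \<Rightarrow> ('k, 'g \<Rightarrow> 'k) module" where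
  "group_algebra G R =
    \<lparr>carrier = {a. (\<forall>g\<in>carrier G. a g \<in> R) \<and> (\<forall>g. g \<notin> carrier G \<longrightarrow> a g = 0)},
     mult = (\<lambda>a b g. if g \<in> carrier G
               then \<Sum>h\<in>carrier G. a h * b (inv\<^bsub>G\<^esub> h \<otimes>\<^bsub>G\<^esub> g) else 0),
     one = (\<lambda>g. if g = \<one>\<^bsub>G\<^esub> then 1 else 0),
     zero = (\<lambda>g. 0),
     add = (\<lambda>a b g. a g + b g),
     smult = (\<lambda>c a g. c * a g)\<rparr>"

text \<open>The algebra \<open>RGe\<close> with unit \<open>e\<close>, for a central idempotent \<open>e\<close> of \<open>KG\<close> (possibly not in \<open>RG\<close>).\<close>

definition group_algebra_factor ::
  "('g, 'm) monoid_scheme \<Rightarrow> 'k::field set \<Rightarrow> ('g \<Rightarrow> 'k) \<Rightarrow> ('k, 'g \<Rightarrow> 'k) module" where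
  "group_algebra_factor G R e = (group_algebra G R)
     \<lparr>carrier := (\<lambda>a. a \<otimes>\<^bsub>group_algebra G R\<^esub> e) ` carrier (group_algebra G R), one := e\<rparr>"

definition ring_center :: "('a, 'm) ring_scheme \<Rightarrow> 'a set" where
  "ring_center A = {z \<in> carrier A. \<forall>x\<in>carrier A. z \<otimes>\<^bsub>A\<^esub> x = x \<otimes>\<^bsub>A\<^esub> z}"

definition idempotents :: "('a, 'm) ring_scheme \<Rightarrow> 'a set" where
  "idempotents A = {e \<in> carrier A. e \<otimes>\<^bsub>A\<^esub> e = e}"

definition primitive_idempotent :: "('a, 'm) ring_scheme \<Rightarrow> 'a \<Rightarrow> bool" where
  "primitive_idempotent A e \<longleftrightarrow> e \<in> idempotents A \<and> e \<noteq> \<zero>\<^bsub>A\<^esub> \<and>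
     (\<forall>e1\<in>idempotents A. \<forall>e2\<in>idempotents A.
        e1 \<otimes>\<^bsub>A\<^esub> e2 = \<zero>\<^bsub>A\<^esub> \<and> e2 \<otimes>\<^bsub>A\<^esub> e1 = \<zero>\<^bsub>A\<^esub> \<and> e = e1 \<oplus>\<^bsub>A\<^esub> e2
          \<longrightarrow> e1 = \<zero>\<^bsub>A\<^esub> \<or> e2 = \<zero>\<^bsub>A\<^esub>)"

definition block_algebras ::
  "('g, 'm) monoid_scheme \<Rightarrow> 'k::field set \<Rightarrow> ('k, 'g \<Rightarrow> 'k) module set" where
  "block_algebras G R = {group_algebra_factor G R b |b.
     primitive_idempotent ((group_algebra G R)\<lparr>carrier := ring_center (group_algebra G R)\<rparr>) b}"

definition rep_extend ::
  "('g, 'm) monoid_scheme \<Rightarrow> nat \<Rightarrow> ('g \<Rightarrow> 'a::field mat) \<Rightarrow> ('g \<Rightarrow> 'a) \<Rightarrow> 'a mat" where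
  "rep_extend G n \<rho> a = mat n n (\<lambda>(i, j). \<Sum>g\<in>carrier G. a g * \<rho> g $$ (i, j))"

text \<open>The characters associated with \<open>B\<close> are those of the simple \<open>KG\<close>-modules on which the unit of \<open>B\<close>
  acts as the identity.\<close>

definition Irr_block ::
  "('g, 'm) monoid_scheme \<Rightarrow> ('k::field, 'g \<Rightarrow> 'k) module \<Rightarrow> ('g \<Rightarrow> 'k) set" where
  "Irr_block G B = {character G \<rho> |n \<rho>. irreducible_rep G n \<rho> \<and> rep_extend G n \<rho> \<one>\<^bsub>B\<^esub> = 1\<^sub>m n}"

definition char_idempotent ::
  "('g, 'm) monoid_scheme \<Rightarrow> ('g \<Rightarrow> 'k::field) \<Rightarrow> 'g \<Rightarrow> 'k" where
  "char_idempotent G \<chi> = (\<lambda>x. if x \<in> carrier G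
     then \<chi> \<one>\<^bsub>G\<^esub> / of_nat (Coset.order G) * \<chi> (inv\<^bsub>G\<^esub> x) else 0)"

section \<open>Defect groups and height zero\<close>

text \<open>The element \<open>x a x\<^sup>-\<^sup>1\<close> of the group algebra.\<close>

definition conjugate_by ::
  "('g, 'm) monoid_scheme \<Rightarrow> 'g \<Rightarrow> ('g \<Rightarrow> 'k::field) \<Rightarrow> 'g \<Rightarrow> 'k" where
  "conjugate_by G x a = (\<lambda>g. if g \<in> carrier G then a (inv\<^bsub>G\<^esub> x \<otimes>\<^bsub>G\<^esub> g \<otimes>\<^bsub>G\<^esub> x) else 0)"

definition fixed_points ::
  "('g, 'm) monoid_scheme \<Rightarrow> ('k::field, 'g \<Rightarrow> 'k) module \<Rightarrow> 'g set \<Rightarrow> ('g \<Rightarrow> 'k) set" where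
  "fixed_points G B H = {a \<in> carrier B. \<forall>h\<in>H. conjugate_by G h a = a}"

text \<open>On elements fixed by \<open>H\<close> the relative trace does not depend on the chosen representatives of
  the left cosets.\<close>

definition relative_trace ::
  "('g, 'm) monoid_scheme \<Rightarrow> 'g set \<Rightarrow> ('g \<Rightarrow> 'k::field) \<Rightarrow> 'g \<Rightarrow> 'k" where
  "relative_trace G H a = (\<lambda>g. \<Sum>C\<in>lcosets\<^bsub>G\<^esub> H. conjugate_by G (SOME x. x \<in> C) a g)"

text \<open>Defect groups in the sense of Green: the minimal subgroups \<open>P\<close> such that the unit of \<open>B\<close> is a
  relative trace from \<open>P\<close>.\<close>

definition defect_group ::
  "('g, 'm) monoid_scheme \<Rightarrow> ('k::field, 'g \<Rightarrow> 'k) module \<Rightarrow> 'g set \<Rightarrow> bool" where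
  "defect_group G B P \<longleftrightarrow>
     subgroup P G \<and> \<one>\<^bsub>B\<^esub> \<in> relative_trace G P ` fixed_points G B P \<and>
     (\<forall>Q. subgroup Q G \<and> Q \<subseteq> P \<and> \<one>\<^bsub>B\<^esub> \<in> relative_trace G Q ` fixed_points G B Q \<longrightarrow> Q = P)"

definition p_part :: "nat \<Rightarrow> nat \<Rightarrow> nat" where
  "p_part p n = p ^ multiplicity p n"

definition height_zero ::
  "nat \<Rightarrow> ('g, 'm) monoid_scheme \<Rightarrow> ('k::field_char_0, 'g \<Rightarrow> 'k) module \<Rightarrow> ('g \<Rightarrow> 'k) \<Rightarrow> bool" where
  "height_zero p G B \<chi> \<longleftrightarrow> (\<exists>P d. defect_group G B P \<and> \<chi> \<one>\<^bsub>G\<^esub> = of_nat d \<and>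
     p_part p d = p_part p (card (lcosets\<^bsub>G\<^esub> P)))"

section \<open>Brauer characters\<close>

definition p_regular :: "nat \<Rightarrow> ('g, 'm) monoid_scheme \<Rightarrow> 'g set" where
  "p_regular p G = {g \<in> carrier G. coprime (group.ord G g) p}"

text \<open>The unique root of unity in \<open>\<O>\<close> of order prime to \<open>p\<close> that reduces to the given root of unity.\<close>

definition root_of_unity_lift ::
  "nat \<Rightarrow> 'k::field_char_0 set \<Rightarrow> ('k \<Rightarrow> 'f::field) \<Rightarrow> 'f \<Rightarrow> 'k" where
  "root_of_unity_lift p \<O> red c =
     (THE z. z \<in> \<O> \<and> (\<exists>m>0. coprime m p \<and> z ^ m = 1) \<and> red z = c)"

text \<open>The sum runs over the eigenvalues with their multiplicities; all of them lie in \<open>k\<close> if \<open>k\<close> is a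
  splitting field for the cyclic subgroups of \<open>G\<close>.\<close>

definition brauer_character ::
  "nat \<Rightarrow> 'k::field_char_0 set \<Rightarrow> ('k \<Rightarrow> 'f::field) \<Rightarrow> ('g, 'm) monoid_scheme
     \<Rightarrow> ('g \<Rightarrow> 'f mat) \<Rightarrow> 'g \<Rightarrow> 'k" where
  "brauer_character p \<O> red G \<sigma> =
     (\<lambda>g\<in>p_regular p G. \<Sum>c\<in>#proots (char_poly (\<sigma> g)). root_of_unity_lift p \<O> red c)"

definition IBr ::
  "nat \<Rightarrow> 'k::field_char_0 set \<Rightarrow> ('k \<Rightarrow> 'f::field) \<Rightarrow> ('g, 'm) monoid_scheme \<Rightarrow> ('g \<Rightarrow> 'k) set" where
  "IBr p \<O> red G = {brauer_character p \<O> red G \<sigma> |n \<sigma>. irreducible_rep G n \<sigma>}"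

definition lifts_brauer :: "nat \<Rightarrow> ('g, 'm) monoid_scheme \<Rightarrow> ('g \<Rightarrow> 'k) \<Rightarrow> ('g \<Rightarrow> 'k) \<Rightarrow> bool" where
  "lifts_brauer p G \<chi> \<phi> \<longleftrightarrow> restrict \<chi> (p_regular p G) = \<phi>"

section \<open>Symmetric algebras\<close>

definition regular_module :: "('a, 'm) ring_scheme \<Rightarrow> ('a, 'a) module" where
  "regular_module R = \<lparr>carrier = carrier R, mult = mult R, one = one R, zero = zero R, add = add R,
     smult = mult R\<rparr>"

text \<open>A module is finitely generated projective if it is a direct summand of a free module of finite
  rank; \<open>func_space {..<n}\<close> is the free module of rank \<open>n\<close>.\<close>

definition fg_projective :: "('a, 'm) ring_scheme \<Rightarrow> ('a, 'b, 'n) module_scheme \<Rightarrow> bool" where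
  "fg_projective R M \<longleftrightarrow>
     (\<exists>(n::nat) \<iota> \<pi>. \<iota> \<in> LinearCombinations.module_hom R M (ring.func_space R {..<n}) \<and>
        \<pi> \<in> LinearCombinations.module_hom R (ring.func_space R {..<n}) M \<and>
        (\<forall>x\<in>carrier M. \<pi> (\<iota> x) = x))"

definition dual_module :: "('a, 'm) ring_scheme \<Rightarrow> ('a, 'b, 'n) module_scheme \<Rightarrow> ('a, 'b \<Rightarrow> 'a) module" where
  "dual_module R M = (ring.func_space R (carrier M))
     \<lparr>carrier := LinearCombinations.module_hom R M (regular_module R) \<inter> extensional (carrier M)\<rparr>"

text \<open>The bimodule structure on the dual of \<open>A\<close> is \<open>(a f b)(y) = f (b y a)\<close>.\<close>

definition symmetric_algebra :: "('a, 'm) ring_scheme \<Rightarrow> ('a, 'b, 'n) module_scheme \<Rightarrow> bool" where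
  "symmetric_algebra R A \<longleftrightarrow> fg_projective R A \<and>
     (\<exists>\<Phi>. \<Phi> \<in> LinearCombinations.module_hom R A (dual_module R A) \<and>
        bij_betw \<Phi> (carrier A) (carrier (dual_module R A)) \<and>
        (\<forall>a\<in>carrier A. \<forall>x\<in>carrier A. \<forall>b\<in>carrier A.
           \<Phi> (a \<otimes>\<^bsub>A\<^esub> x \<otimes>\<^bsub>A\<^esub> b) = (\<lambda>y\<in>carrier A. \<Phi> x (b \<otimes>\<^bsub>A\<^esub> y \<otimes>\<^bsub>A\<^esub> a))))"

end

theory Submission
  imports Defs "HOL-Number_Theory.Cong"
begin

text \<open>
  Let \<open>\<rho>\<close> be a representation over \<open>K\<close> with character \<open>\<chi>\<close> and degree \<open>n\<close>. Schur orthogonality identifies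
  \<open>KGe(\<chi>)\<close> with the matrix algebra \<open>M_n(K)\<close>, and then \<open>\<O>Ge(\<chi>)\<close> becomes the order \<open>\<Lambda>\<close> spanned over \<open>\<O>\<close> by
  the matrices of the group elements. After a change of basis \<open>\<Lambda>\<close> is contained in \<open>M_n(\<O>)\<close>. Both sides of
  the claimed equivalence turn out to mean that \<open>\<Lambda> = M_n(\<O>)\<close>, which is the predicate
  \<open>spans_matrix_order\<close>; it suffices to look at matrix units.

  \<^bold>\<open>Symmetry\<close> (\<open>symmetric_if_spans_matrix_order\<close>, \<open>spans_matrix_order_if_symmetric\<close>,
  \<open>height_zero_unit_trace\<close>). A matrix algebra is symmetric with respect to the trace form. Conversely, a symmetrising
  form \<open>s\<close> of \<open>\<Lambda>\<close> is a class function on \<open>G\<close>, so it is the trace form of a matrix that commutes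
  with \<open>\<rho>(G)\<close>; hence \<open>s = \<mu> tr\<close> for a scalar \<open>\<mu>\<close>. If \<open>M\<close> is an integral matrix, the linear form
  \<open>Y \<mapsto> tr(M Y)\<close> on \<open>\<Lambda>\<close> has to be of the form \<open>Y \<mapsto> s(X Y)\<close> with \<open>X\<close> in \<open>\<Lambda>\<close>, whence \<open>M = \<mu> X\<close>. So it is
  enough that \<open>\<mu>\<close> is integral. This is where height zero enters: the unit of the block is a relative
  trace \<open>Tr_P^G(c)\<close> from a defect group \<open>P\<close>, so that \<open>\<chi>(1) = |G:P| \<chi>(c)\<close> and \<open>\<chi>(c)\<close> is a unit of \<open>\<O>\<close>, while
  \<open>\<mu> \<chi>(c) = s(c)\<close> is integral.

  \<^bold>\<open>Lifting\<close> (\<open>lifts_if_spans_matrix_order\<close>, \<open>spans_matrix_order_if_lifts\<close>). If \<open>\<Lambda> = M_n(\<O>)\<close>, then the reduction of \<open>\<rho>\<close> spans \<open>M_n(k)\<close>; hence it is irreducible, and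
  its Brauer character is the restriction of \<open>\<chi>\<close>. Conversely, let \<open>\<chi>\<close> lift the Brauer character of
  the irreducible representation \<open>\<sigma>\<close>. Then \<open>\<sigma>\<close> has degree \<open>n\<close> and the same traces as the reduction of
  \<open>\<rho>\<close>. By Burnside's theorem there are elements \<open>t_{kl}\<close> of \<open>kG\<close> that \<open>\<sigma>\<close> maps to the matrix
  units. The trace form is nondegenerate on these and can be computed in \<open>\<rho>\<close> as well, so that lifts of
  the \<open>t_{kl}\<close> to \<open>\<O>G\<close> are mapped by \<open>\<rho>\<close> to \<open>n^2\<close> matrices whose coordinates form an invertible
  matrix over \<open>\<O>\<close>; they span \<open>M_n(\<O>)\<close>.

  The comparison of traces rests on the fact that \<open>K\<close> and \<open>k\<close> contain the eigenvalues of the group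
  elements and that reduction is a bijection between the roots of unity of order prime to \<open>p\<close> that
  occur; both are obtained from the splitting field hypothesis on cyclic subgroups
  (\<open>exists_eigenvalue_list\<close>, \<open>exists_root_of_unity_lift\<close>, \<open>lifted_trace\<close>).
\<close>

section \<open>Matrix units, sums of matrices and traces\<close>

definition mat_unit :: "nat \<Rightarrow> nat \<Rightarrow> nat \<Rightarrow> 'a::comm_ring_1 mat" where
  "mat_unit n k l = mat n n (\<lambda>(i, j). if i = k \<and> j = l then 1 else 0)"

text \<open>The size is a parameter, so that the empty sum is a zero matrix of the right size.\<close>

definition mat_sum :: "nat \<Rightarrow> ('x \<Rightarrow> 'a::comm_ring_1 mat) \<Rightarrow> 'x set \<Rightarrow> 'a mat" where
  "mat_sum n F A = mat n n (\<lambda>(i, j). \<Sum>x\<in>A. F x $$ (i, j))"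

lemma pair_index_less:
  fixes i j n :: nat
  assumes "i < n" "j < n" shows "i * n + j < n * n"
proof -
  have "i * n + j < (i + 1) * n" using assms by simp
  also have "\<dots> \<le> n * n" using assms by (intro mult_right_mono) auto
  finally show ?thesis .
qed

lemma mat_unit_carrier [simp]: "mat_unit n k l \<in> carrier_mat n n"
  by (simp add: mat_unit_def)

lemma mat_sum_carrier [simp]: "mat_sum n F A \<in> carrier_mat n n"
  by (simp add: mat_sum_def)

lemma mat_sum_index:
  "i < n \<Longrightarrow> j < n \<Longrightarrow> mat_sum n F A $$ (i, j) = (\<Sum>x\<in>A. F x $$ (i, j))"
  by (simp add: mat_sum_def)

lemma mat_sum_cong:
  "(\<And>x. x \<in> A \<Longrightarrow> F x = F' x) \<Longrightarrow> mat_sum n F A = mat_sum n F' A"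
  by (simp add: mat_sum_def cong: sum.cong)

lemma mult_mat_index:
  assumes "A \<in> carrier_mat n m" "B \<in> carrier_mat m l" "i < n" "j < l"
  shows "(A * B) $$ (i, j) = (\<Sum>k<m. A $$ (i, k) * B $$ (k, j))"
  using assms by (simp add: scalar_prod_def atLeast0LessThan)

lemma square_mult_carrier [simp]:
  "A \<in> carrier_mat n n \<Longrightarrow> B \<in> carrier_mat n n \<Longrightarrow> A * B \<in> carrier_mat n n"
  by (rule mult_carrier_mat)

lemmas square_assoc =
  assoc_mult_mat[where n\<^sub>1=n and n\<^sub>2=n and n\<^sub>3=n and n\<^sub>4=n for n]

lemmas square_assoc_vec =
  assoc_mult_mat_vec[where n\<^sub>1=n and n\<^sub>2=n and n\<^sub>3=n for n]

lemmas square_mult_smult = mult_smult_distrib[where nr=n and n=n and nc=n for n]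

lemmas square_smult_mult = mult_smult_assoc_mat[where nr=n and n=n and nc=n for n]

lemmas square_mult_add = mult_add_distrib_mat[where nr=n and n=n and nc=n for n]

lemmas square_add_mult = add_mult_distrib_mat[where nr=n and n=n and nc=n for n]

lemma square_mult_vec_carrier [simp]:
  "A \<in> carrier_mat n n \<Longrightarrow> v \<in> carrier_vec n \<Longrightarrow> A *\<^sub>v v \<in> carrier_vec n"
  by (rule mult_mat_vec_carrier)

lemma smult_mat_mult_vec:
  assumes "A \<in> carrier_mat n n" "v \<in> carrier_vec n"
  shows "(c \<cdot>\<^sub>m A) *\<^sub>v v = c \<cdot>\<^sub>v (A *\<^sub>v v :: 'a::comm_ring_1 vec)"
  using assms by (intro eq_vecI) (auto simp: scalar_prod_def sum_distrib_left mult.assoc)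

lemma mult_unit_vec:
  assumes "A \<in> carrier_mat n n" "j < n"
  shows "A *\<^sub>v unit_vec n j = (col A j :: 'a::comm_ring_1 vec)"
  using assms by (intro eq_vecI) auto

lemma mult_mat_sum:
  assumes "B \<in> carrier_mat n n" "\<And>x. x \<in> A \<Longrightarrow> F x \<in> carrier_mat n n"
  shows "B * mat_sum n F A = mat_sum n (\<lambda>x. B * F x) A"
proof (rule eq_matI)
  fix i j assume "i < dim_row (mat_sum n (\<lambda>x. B * F x) A)" "j < dim_col (mat_sum n (\<lambda>x. B * F x) A)"
  hence ij: "i < n" "j < n" by (auto simp: mat_sum_def)
  have "(B * mat_sum n F A) $$ (i, j) = (\<Sum>k<n. B $$ (i, k) * (\<Sum>x\<in>A. F x $$ (k, j)))"
    using ij assms by (subst mult_mat_index[where m=n]) (auto simp: mat_sum_index)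
  also have "\<dots> = (\<Sum>x\<in>A. \<Sum>k<n. B $$ (i, k) * F x $$ (k, j))"
    unfolding sum_distrib_left by (rule sum.swap)
  also have "\<dots> = (\<Sum>x\<in>A. (B * F x) $$ (i, j))"
    by (rule sum.cong[OF refl], rule mult_mat_index[symmetric]) (use assms ij in auto)
  finally show "(B * mat_sum n F A) $$ (i, j) = mat_sum n (\<lambda>x. B * F x) A $$ (i, j)"
    using ij by (simp add: mat_sum_index)
qed (use assms in \<open>auto simp: mat_sum_def\<close>)

lemma mat_sum_mult:
  assumes "B \<in> carrier_mat n n" "\<And>x. x \<in> A \<Longrightarrow> F x \<in> carrier_mat n n"
  shows "mat_sum n F A * B = mat_sum n (\<lambda>x. F x * B) A"
proof (rule eq_matI)
  fix i j assume "i < dim_row (mat_sum n (\<lambda>x. F x * B) A)" "j < dim_col (mat_sum n (\<lambda>x. F x * B) A)"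
  hence ij: "i < n" "j < n" by (auto simp: mat_sum_def)
  have "(mat_sum n F A * B) $$ (i, j) = (\<Sum>k<n. (\<Sum>x\<in>A. F x $$ (i, k)) * B $$ (k, j))"
    using ij assms by (subst mult_mat_index[where m=n]) (auto simp: mat_sum_index)
  also have "\<dots> = (\<Sum>x\<in>A. \<Sum>k<n. F x $$ (i, k) * B $$ (k, j))"
    unfolding sum_distrib_right by (rule sum.swap)
  also have "\<dots> = (\<Sum>x\<in>A. (F x * B) $$ (i, j))"
    by (rule sum.cong[OF refl], rule mult_mat_index[symmetric]) (use assms ij in auto)
  finally show "(mat_sum n F A * B) $$ (i, j) = mat_sum n (\<lambda>x. F x * B) A $$ (i, j)"
    using ij by (simp add: mat_sum_index)
qed (use assms in \<open>auto simp: mat_sum_def\<close>)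

lemma mat_sum_reindex:
  assumes "bij_betw f A B"
  shows "mat_sum n (\<lambda>x. F (f x)) A = mat_sum n F B"
  unfolding mat_sum_def
  by (rule cong_mat) (simp_all add: sum.reindex_bij_betw[OF assms, of "\<lambda>x. F x $$ _"])

lemma mat_trace_carrier: "A \<in> carrier_mat n n \<Longrightarrow> mat_trace A = (\<Sum>i<n. A $$ (i, i))"
  by (simp add: mat_trace_def)

lemma mat_trace_mat_sum:
  assumes "\<And>x. x \<in> A \<Longrightarrow> F x \<in> carrier_mat n n"
  shows "mat_trace (mat_sum n F A) = (\<Sum>x\<in>A. mat_trace (F x))"
proof -
  have "mat_trace (mat_sum n F A) = (\<Sum>i<n. \<Sum>x\<in>A. F x $$ (i, i))"
    by (simp add: mat_trace_carrier[of _ n] mat_sum_index)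
  also have "\<dots> = (\<Sum>x\<in>A. \<Sum>i<n. F x $$ (i, i))" by (rule sum.swap)
  also have "\<dots> = (\<Sum>x\<in>A. mat_trace (F x))"
    by (rule sum.cong[OF refl], rule mat_trace_carrier[symmetric]) (rule assms)
  finally show ?thesis .
qed

lemma mat_trace_mult:
  assumes "A \<in> carrier_mat n m" "B \<in> carrier_mat m n"
  shows "mat_trace (A * B) = (\<Sum>i<n. \<Sum>j<m. A $$ (i, j) * B $$ (j, i))"
proof -
  have AB: "A * B \<in> carrier_mat n n" using assms by simp
  show ?thesis unfolding mat_trace_carrier[OF AB]
    by (rule sum.cong[OF refl], rule mult_mat_index[OF assms]) auto
qed

lemma mat_trace_comm:
  fixes A B :: "'a::comm_ring_1 mat"
  assumes "A \<in> carrier_mat n m" "B \<in> carrier_mat m n"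
  shows "mat_trace (A * B) = mat_trace (B * A)"
  unfolding mat_trace_mult[OF assms] mat_trace_mult[OF assms(2,1)]
  by (subst sum.swap) (simp add: mult.commute)

lemma mat_trace_smult [simp]:
  "A \<in> carrier_mat n n \<Longrightarrow> mat_trace (c \<cdot>\<^sub>m A) = c * mat_trace A"
  by (simp add: mat_trace_def sum_distrib_left)

lemma mat_trace_add:
  "A \<in> carrier_mat n n \<Longrightarrow> B \<in> carrier_mat n n \<Longrightarrow> mat_trace (A + B) = mat_trace A + mat_trace B"
  by (simp add: mat_trace_def sum.distrib)

lemma mat_trace_one [simp]: "mat_trace (1\<^sub>m n) = of_nat n"
  by (simp add: mat_trace_def)

lemma mat_trace_mult_unit:
  assumes "A \<in> carrier_mat n n" "k < n" "l < n"
  shows "mat_trace (A * mat_unit n k l) = A $$ (l, k)"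
proof -
  have "mat_trace (A * mat_unit n k l)
        = (\<Sum>i<n. \<Sum>j<n. if i = l then if j = k then A $$ (i, j) else 0 else 0)"
    unfolding mat_trace_mult[OF assms(1) mat_unit_carrier]
    by (intro sum.cong refl) (auto simp: mat_unit_def)
  also have "\<dots> = (\<Sum>i<n. if i = l then A $$ (i, k) else 0)"
    using assms by (intro sum.cong refl) (auto simp: sum.delta)
  also have "\<dots> = A $$ (l, k)" using assms by (simp add: sum.delta)
  finally show ?thesis .
qed

lemma trace_form_nondegenerate:
  assumes "A \<in> carrier_mat n n" "\<And>k l. k < n \<Longrightarrow> l < n \<Longrightarrow> mat_trace (A * mat_unit n k l) = 0"
  shows "A = 0\<^sub>m n n"
  using assms by (intro eq_matI) (auto simp: mat_trace_mult_unit)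

lemma mat_unit_mult_vec:
  assumes "v \<in> carrier_vec n" "k < n" "l < n"
  shows "mat_unit n k l *\<^sub>v v = v $ l \<cdot>\<^sub>v unit_vec n k"
proof (rule eq_vecI)
  fix i assume "i < dim_vec (v $ l \<cdot>\<^sub>v unit_vec n k)"
  hence i: "i < n" by simp
  have "(mat_unit n k l *\<^sub>v v) $ i
      = (\<Sum>j<n. (if i = k \<and> j = l then 1 else 0) * v $ j)"
    using i assms by (simp add: mat_unit_def scalar_prod_def atLeast0LessThan)
  also have "\<dots> = (\<Sum>j<n. if j = l then (if i = k then v $ j else 0) else 0)"
    by (rule sum.cong) auto
  finally have "(mat_unit n k l *\<^sub>v v) $ i = \<dots>" .
  thus "(mat_unit n k l *\<^sub>v v) $ i = (v $ l \<cdot>\<^sub>v unit_vec n k) $ i"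
    using i assms by (simp add: sum.delta unit_vec_def)
qed (auto simp: mat_unit_def)

section \<open>Matrix representations and their extension to the group algebra\<close>

locale matrix_rep = group G for G :: "('g, 'm) monoid_scheme" (structure) +
  fixes n :: nat and \<rho> :: "'g \<Rightarrow> 'a::field mat"
  assumes fin: "finite (carrier G)"
    and rep_carrier [simp]: "g \<in> carrier G \<Longrightarrow> \<rho> g \<in> carrier_mat n n"
    and rep_one: "\<rho> \<one> = 1\<^sub>m n"
    and rep_mult: "g \<in> carrier G \<Longrightarrow> h \<in> carrier G \<Longrightarrow> \<rho> (g \<otimes> h) = \<rho> g * \<rho> h"

lemma matrix_rep_iff_hom:
  fixes \<rho> :: "'g \<Rightarrow> 'a::field mat"
  assumes "group G" "finite (carrier G)"
  shows "matrix_rep G n \<rho> \<longleftrightarrow> \<rho> \<in> hom G (GL TYPE('a) n)"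
proof
  interpret group G by fact
  assume "matrix_rep G n \<rho>"
  then interpret matrix_rep G n \<rho> .
  show "\<rho> \<in> hom G (GL TYPE('a) n)"
    unfolding hom_def GL_def units_of_def Units_def
  proof (safe, goal_cases)
    case (1 g)
    have "\<rho> (inv\<^bsub>G\<^esub> g) * \<rho> g = 1\<^sub>m n" "\<rho> g * \<rho> (inv\<^bsub>G\<^esub> g) = 1\<^sub>m n"
      using 1 rep_mult[of "inv\<^bsub>G\<^esub> g" g] rep_mult[of g "inv\<^bsub>G\<^esub> g"] rep_one by auto
    thus ?case using 1 by (auto simp: ring_mat_simps intro!: bexI[of _ "\<rho> (inv\<^bsub>G\<^esub> g)"])
  next
    case (2 g h)
    thus ?case by (simp add: rep_mult ring_mat_simps)
  qed
next
  interpret group G by fact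
  assume hom: "\<rho> \<in> hom G (GL TYPE('a) n)"
  have car: "\<rho> g \<in> carrier_mat n n" if "g \<in> carrier G" for g
    using hom that by (auto simp: hom_def GL_def units_of_def Units_def ring_mat_simps Pi_def)
  have mult: "\<rho> (g \<otimes>\<^bsub>G\<^esub> h) = \<rho> g * \<rho> h" if "g \<in> carrier G" "h \<in> carrier G" for g h
    using hom that by (auto simp: hom_def GL_def units_of_def ring_mat_simps)
  have "\<rho> \<one>\<^bsub>G\<^esub> \<in> Units (ring_mat TYPE('a) n ())"
    using hom by (auto simp: hom_def GL_def units_of_def Pi_def)
  then obtain M where M: "M \<in> carrier_mat n n" "M * \<rho> \<one>\<^bsub>G\<^esub> = 1\<^sub>m n"
    by (auto simp: Units_def ring_mat_simps)
  have "\<rho> \<one>\<^bsub>G\<^esub> = (M * \<rho> \<one>\<^bsub>G\<^esub>) * \<rho> \<one>\<^bsub>G\<^esub>" using M car[of "\<one>\<^bsub>G\<^esub>"] by simp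
  also have "\<dots> = M * (\<rho> \<one>\<^bsub>G\<^esub> * \<rho> \<one>\<^bsub>G\<^esub>)"
    by (rule assoc_mult_mat) (use M car in auto)
  also have "\<dots> = 1\<^sub>m n" using mult[of "\<one>\<^bsub>G\<^esub>" "\<one>\<^bsub>G\<^esub>"] M by simp
  finally show "matrix_rep G n \<rho>"
    using assms car mult by unfold_locales auto
qed

context matrix_rep
begin

lemma rep_dim [simp]: "g \<in> carrier G \<Longrightarrow> dim_row (\<rho> g) = n" "g \<in> carrier G \<Longrightarrow> dim_col (\<rho> g) = n"
  using rep_carrier by blast+

lemma rep_inv:
  assumes "g \<in> carrier G"
  shows "\<rho> (inv g) * \<rho> g = 1\<^sub>m n" "\<rho> g * \<rho> (inv g) = 1\<^sub>m n"
  using assms rep_mult[of "inv g" g] rep_mult[of g "inv g"] rep_one by auto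

abbreviation ext where "ext \<equiv> rep_extend G n \<rho>"

lemma ext_carrier [simp]: "ext a \<in> carrier_mat n n"
  by (simp add: rep_extend_def)

lemma ext_dim [simp]: "dim_row (ext a) = n" "dim_col (ext a) = n"
  by (simp_all add: rep_extend_def)

lemma ext_index: "i < n \<Longrightarrow> j < n \<Longrightarrow> ext a $$ (i, j) = (\<Sum>g\<in>carrier G. a g * \<rho> g $$ (i, j))"
  by (simp add: rep_extend_def)

lemma ext_eq_mat_sum: "ext a = mat_sum n (\<lambda>g. a g \<cdot>\<^sub>m \<rho> g) (carrier G)"
  unfolding rep_extend_def mat_sum_def
  by (rule cong_mat) (auto intro!: sum.cong simp del: index_smult_mat simp add: index_smult_mat(1))

lemma ext_cong: "(\<And>g. g \<in> carrier G \<Longrightarrow> a g = b g) \<Longrightarrow> ext a = ext b"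
  by (simp add: rep_extend_def cong: sum.cong)

lemma ext_add: "ext (\<lambda>g. a g + b g) = ext a + ext b"
  by (rule eq_matI) (auto simp: rep_extend_def distrib_right sum.distrib)

lemma ext_smult: "ext (\<lambda>g. c * a g) = c \<cdot>\<^sub>m ext a"
  by (rule eq_matI) (auto simp: rep_extend_def sum_distrib_left mult.assoc)

lemma ext_lincomb_index:
  assumes "i < n" "j < n"
  shows "ext (\<lambda>g. \<Sum>y\<in>Y. c y * t y g) $$ (i, j) = (\<Sum>y\<in>Y. c y * ext (t y) $$ (i, j))"
  using assms
  by (simp add: ext_index sum_distrib_left sum_distrib_right mult.assoc) (rule sum.swap)

lemma ext_single:
  assumes "g \<in> carrier G" shows "ext (\<lambda>x. if x = g then 1 else 0) = \<rho> g"
proof (rule eq_matI)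
  fix i j assume "i < dim_row (\<rho> g)" "j < dim_col (\<rho> g)"
  hence ij: "i < n" "j < n" using assms by auto
  have "ext (\<lambda>x. if x = g then 1 else 0) $$ (i, j)
        = (\<Sum>x\<in>carrier G. if x = g then \<rho> x $$ (i, j) else 0)"
    unfolding ext_index[OF ij] by (intro sum.cong) auto
  thus "ext (\<lambda>x. if x = g then 1 else 0) $$ (i, j) = \<rho> g $$ (i, j)"
    using assms fin by (simp add: sum.delta)
qed (use assms in auto)

lemma mat_trace_ext_mult:
  assumes "M \<in> carrier_mat n n"
  shows "mat_trace (ext a * M) = (\<Sum>g\<in>carrier G. a g * mat_trace (\<rho> g * M))"
proof -
  have "ext a * M = mat_sum n (\<lambda>g. a g \<cdot>\<^sub>m \<rho> g * M) (carrier G)"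
    unfolding ext_eq_mat_sum by (rule mat_sum_mult) (use assms in auto)
  also have "mat_trace \<dots> = (\<Sum>g\<in>carrier G. mat_trace (a g \<cdot>\<^sub>m \<rho> g * M))"
    by (rule mat_trace_mat_sum) (use assms in auto)
  also have "\<dots> = (\<Sum>g\<in>carrier G. a g * mat_trace (\<rho> g * M))"
  proof (rule sum.cong[OF refl])
    fix g assume "g \<in> carrier G"
    hence "\<rho> g * M \<in> carrier_mat n n" "a g \<cdot>\<^sub>m \<rho> g * M = a g \<cdot>\<^sub>m (\<rho> g * M)"
      using assms by (auto intro: mult_carrier_mat mult_smult_assoc_mat)
    thus "mat_trace (a g \<cdot>\<^sub>m \<rho> g * M) = a g * mat_trace (\<rho> g * M)" by simp
  qed
  finally show ?thesis .
qed

lemma mat_trace_ext: "mat_trace (ext a) = (\<Sum>g\<in>carrier G. a g * mat_trace (\<rho> g))"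
  using mat_trace_ext_mult[of "1\<^sub>m n" a]
  by (simp add: right_mult_one_mat[OF ext_carrier] right_mult_one_mat[OF rep_carrier] cong: sum.cong)

lemma bij_mult_left: "h \<in> carrier G \<Longrightarrow> bij_betw (\<lambda>g. h \<otimes> g) (carrier G) (carrier G)"
  by (rule bij_betw_byWitness[where f' = "\<lambda>g. inv h \<otimes> g"]) (auto simp: m_assoc[symmetric])

lemma bij_mult_right: "h \<in> carrier G \<Longrightarrow> bij_betw (\<lambda>g. g \<otimes> h) (carrier G) (carrier G)"
  by (rule bij_betw_byWitness[where f' = "\<lambda>g. g \<otimes> inv h"]) (auto simp: m_assoc)

lemma ext_mult: "ext (a \<otimes>\<^bsub>group_algebra G R\<^esub> b) = ext a * ext b"
proof (rule eq_matI)
  fix i j assume "i < dim_row (ext a * ext b)" "j < dim_col (ext a * ext b)"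
  hence ij: "i < n" "j < n" by (auto simp: rep_extend_def)
  have "ext (a \<otimes>\<^bsub>group_algebra G R\<^esub> b) $$ (i, j)
      = (\<Sum>g\<in>carrier G. \<Sum>h\<in>carrier G. a h * b (inv h \<otimes> g) * \<rho> g $$ (i, j))"
    unfolding ext_index[OF ij] by (simp add: group_algebra_def sum_distrib_right)
  also have "\<dots> = (\<Sum>h\<in>carrier G. \<Sum>g\<in>carrier G. a h * b (inv h \<otimes> g) * \<rho> g $$ (i, j))"
    by (rule sum.swap)
  also have "\<dots> = (\<Sum>h\<in>carrier G. \<Sum>g\<in>carrier G. a h * b g * (\<rho> h * \<rho> g) $$ (i, j))"
  proof (rule sum.cong[OF refl])
    fix h assume h: "h \<in> carrier G"
    have "(\<Sum>g\<in>carrier G. a h * b (inv h \<otimes> g) * \<rho> g $$ (i, j))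
       = (\<Sum>g\<in>carrier G. a h * b (inv h \<otimes> (h \<otimes> g)) * \<rho> (h \<otimes> g) $$ (i, j))"
      by (rule sum.reindex_bij_betw[OF bij_mult_left[OF h], symmetric])
    also have "\<dots> = (\<Sum>g\<in>carrier G. a h * b g * (\<rho> h * \<rho> g) $$ (i, j))"
      by (rule sum.cong) (use h in \<open>auto simp: m_assoc[symmetric] rep_mult\<close>)
    finally show "(\<Sum>g\<in>carrier G. a h * b (inv h \<otimes> g) * \<rho> g $$ (i, j)) = \<dots>" .
  qed
  also have "\<dots> = (\<Sum>h\<in>carrier G. \<Sum>g\<in>carrier G. \<Sum>k<n. a h * \<rho> h $$ (i, k) * (b g * \<rho> g $$ (k, j)))"
    by (intro sum.cong refl, subst mult_mat_index[where m=n])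
      (use ij in \<open>auto simp: sum_distrib_left mult_ac\<close>)
  also have "\<dots> = (\<Sum>h\<in>carrier G. \<Sum>k<n. \<Sum>g\<in>carrier G. a h * \<rho> h $$ (i, k) * (b g * \<rho> g $$ (k, j)))"
    by (intro sum.cong refl, rule sum.swap)
  also have "\<dots> = (\<Sum>k<n. \<Sum>h\<in>carrier G. \<Sum>g\<in>carrier G. a h * \<rho> h $$ (i, k) * (b g * \<rho> g $$ (k, j)))"
    by (rule sum.swap)
  also have "\<dots> = (\<Sum>k<n. ext a $$ (i, k) * ext b $$ (k, j))"
    by (intro sum.cong refl) (use ij in \<open>simp add: ext_index sum_product\<close>)
  also have "\<dots> = (ext a * ext b) $$ (i, j)"
    by (rule mult_mat_index[symmetric, where m=n]) (use ij in auto)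
  finally show "ext (a \<otimes>\<^bsub>group_algebra G R\<^esub> b) $$ (i, j) = (ext a * ext b) $$ (i, j)" .
qed (auto simp: rep_extend_def)

end

section \<open>Schur orthogonality\<close>

text \<open>Irreducible representations over a splitting field have this property. Unlike irreducibility
  it passes to conjugate representations by a short calculation with matrices.\<close>

locale scalar_commutant_rep = matrix_rep G n \<rho>
  for G :: "('g, 'm) monoid_scheme" (structure) and n and \<rho> :: "'g \<Rightarrow> 'a::field mat" +
  assumes n_pos: "0 < n"
    and commutant_scalar:
      "\<lbrakk>M \<in> carrier_mat n n; \<And>g. g \<in> carrier G \<Longrightarrow> M * \<rho> g = \<rho> g * M\<rbrakk> \<Longrightarrow> \<exists>c. M = c \<cdot>\<^sub>m 1\<^sub>m n"

context scalar_commutant_rep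
begin

text \<open>The average over the group commutes with the representation, hence is a scalar; the scalar
  is found by taking traces. No division by \<open>n\<close> is made, since \<open>n\<close> may vanish in the field.\<close>

lemma average_scalar:
  assumes M: "M \<in> carrier_mat n n"
  obtains c where "mat_sum n (\<lambda>x. \<rho> x * M * \<rho> (inv x)) (carrier G) = c \<cdot>\<^sub>m 1\<^sub>m n"
    "c * of_nat n = of_nat (Coset.order G) * mat_trace M"
proof -
  let ?A = "mat_sum n (\<lambda>x. \<rho> x * M * \<rho> (inv x)) (carrier G)"
  have car: "\<rho> x * M * \<rho> (inv x) \<in> carrier_mat n n" if "x \<in> carrier G" for x
    using that M by (meson inv_closed mult_carrier_mat rep_carrier)
  have "?A * \<rho> g = \<rho> g * ?A" if g: "g \<in> carrier G" for g
  proof -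
    have "?A * \<rho> g = mat_sum n (\<lambda>x. \<rho> x * M * \<rho> (inv x) * \<rho> g) (carrier G)"
      by (rule mat_sum_mult) (use g car in auto)
    also have "\<dots> = mat_sum n (\<lambda>x. \<rho> (g \<otimes> x) * M * \<rho> (inv (g \<otimes> x)) * \<rho> g) (carrier G)"
      by (rule mat_sum_reindex[OF bij_mult_left[OF g], symmetric])
    also have "\<dots> = mat_sum n (\<lambda>x. \<rho> g * (\<rho> x * M * \<rho> (inv x))) (carrier G)"
    proof (rule mat_sum_cong)
      fix x assume x: "x \<in> carrier G"
      have c: "\<rho> g \<in> carrier_mat n n" "\<rho> x \<in> carrier_mat n n" "\<rho> (inv x) \<in> carrier_mat n n"
        "\<rho> (inv (g \<otimes> x)) \<in> carrier_mat n n"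
        using g x by auto
      have "\<rho> (inv (g \<otimes> x)) * \<rho> g = \<rho> (inv x)"
        using g x by (simp add: rep_mult[symmetric] inv_mult_group m_assoc)
      hence "\<rho> (g \<otimes> x) * M * \<rho> (inv (g \<otimes> x)) * \<rho> g = \<rho> g * \<rho> x * M * \<rho> (inv x)"
        using g x c M by (subst assoc_mult_mat[where n\<^sub>2=n and n\<^sub>3=n and n\<^sub>4=n])
          (auto simp: rep_mult)
      also have "\<dots> = \<rho> g * (\<rho> x * M * \<rho> (inv x))"
        using c M by (simp add: square_assoc[where n=n]
          mult_carrier_mat[where n=n])
      finally show "\<rho> (g \<otimes> x) * M * \<rho> (inv (g \<otimes> x)) * \<rho> g = \<rho> g * (\<rho> x * M * \<rho> (inv x))" .
    qed
    also have "\<dots> = \<rho> g * ?A"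
      by (rule mult_mat_sum[symmetric]) (use g car in auto)
    finally show ?thesis .
  qed
  with commutant_scalar[of ?A] obtain c where c: "?A = c \<cdot>\<^sub>m 1\<^sub>m n" by auto
  have "c * of_nat n = mat_trace ?A" unfolding c by (simp add: mat_trace_smult[of _ n])
  also have "\<dots> = (\<Sum>x\<in>carrier G. mat_trace (\<rho> x * M * \<rho> (inv x)))"
    by (rule mat_trace_mat_sum) (use car in auto)
  also have "\<dots> = (\<Sum>x\<in>carrier G. mat_trace M)"
  proof (rule sum.cong[OF refl])
    fix x assume x: "x \<in> carrier G"
    hence "mat_trace (\<rho> x * M * \<rho> (inv x)) = mat_trace (\<rho> (inv x) * (\<rho> x * M))"
      using M by (intro mat_trace_comm[where n=n and m=n]) auto
    also have "\<rho> (inv x) * (\<rho> x * M) = M"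
      using x M rep_inv[OF x] by (subst assoc_mult_mat[symmetric, where n\<^sub>2=n and n\<^sub>3=n]) auto
    finally show "mat_trace (\<rho> x * M * \<rho> (inv x)) = mat_trace M" .
  qed
  also have "\<dots> = of_nat (Coset.order G) * mat_trace M" by (simp add: Coset.order_def)
  finally show ?thesis using c that by blast
qed

end

text \<open>By Maschke's theorem these representations are absolutely irreducible.\<close>

locale abs_irr_rep = scalar_commutant_rep G n \<rho>
  for G :: "('g, 'm) monoid_scheme" (structure) and n and \<rho> :: "'g \<Rightarrow> 'a::field_char_0 mat"
begin

text \<open>The \<open>(i, j)\<close> entry of the average of the matrix unit with index \<open>(k, l)\<close>.\<close>

lemma entries_orthogonal:
  assumes "i < n" "j < n" "k < n" "l < n"
  shows "(\<Sum>x\<in>carrier G. \<rho> x $$ (i, k) * \<rho> (inv x) $$ (l, j))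
    = (if k = l \<and> i = j then of_nat (Coset.order G) / of_nat n else 0)"
proof -
  obtain c where c: "mat_sum n (\<lambda>x. \<rho> x * mat_unit n k l * \<rho> (inv x)) (carrier G) = c \<cdot>\<^sub>m 1\<^sub>m n"
    "c * of_nat n = of_nat (Coset.order G) * mat_trace (mat_unit n k l :: 'a mat)"
    using average_scalar[OF mat_unit_carrier] by metis
  have "mat_trace (mat_unit n k l :: 'a mat) = mat_trace (1\<^sub>m n * mat_unit n k l :: 'a mat)"
    by (simp add: left_mult_one_mat[OF mat_unit_carrier])
  also have "\<dots> = (if k = l then 1 else 0)" using assms by (subst mat_trace_mult_unit) auto
  finally have c': "c = (if k = l then of_nat (Coset.order G) / of_nat n else 0)"
    using c(2) n_pos by (auto simp: field_simps)
  have "(c \<cdot>\<^sub>m 1\<^sub>m n) $$ (i, j) = (\<Sum>x\<in>carrier G. (\<rho> x * mat_unit n k l * \<rho> (inv x)) $$ (i, j))"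
    unfolding c(1)[symmetric] using assms by (simp add: mat_sum_index)
  also have "\<dots> = (\<Sum>x\<in>carrier G. \<rho> x $$ (i, k) * \<rho> (inv x) $$ (l, j))"
  proof (rule sum.cong[OF refl])
    fix x assume x: "x \<in> carrier G"
    have "(\<rho> x * mat_unit n k l * \<rho> (inv x)) $$ (i, j)
       = (\<Sum>b<n. (\<rho> x * mat_unit n k l) $$ (i, b) * \<rho> (inv x) $$ (b, j))"
      using x assms by (intro mult_mat_index) auto
    also have "\<dots> = (\<Sum>b<n. if b = l then \<rho> x $$ (i, k) * \<rho> (inv x) $$ (b, j) else 0)"
    proof (rule sum.cong[OF refl])
      fix b assume "b \<in> {..<n}"
      hence "(\<rho> x * mat_unit n k l) $$ (i, b)
          = (\<Sum>a<n. \<rho> x $$ (i, a) * mat_unit n k l $$ (a, b))"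
        using x assms by (intro mult_mat_index) auto
      also have "\<dots> = (\<Sum>a<n. if a = k then (if b = l then \<rho> x $$ (i, a) else 0) else 0)"
        by (rule sum.cong[OF refl]) (use \<open>b \<in> {..<n}\<close> in \<open>auto simp: mat_unit_def\<close>)
      also have "\<dots> = (if b = l then \<rho> x $$ (i, k) else 0)" using assms by (simp add: sum.delta)
      finally show "(\<rho> x * mat_unit n k l) $$ (i, b) * \<rho> (inv x) $$ (b, j)
          = (if b = l then \<rho> x $$ (i, k) * \<rho> (inv x) $$ (b, j) else 0)" by auto
    qed
    also have "\<dots> = \<rho> x $$ (i, k) * \<rho> (inv x) $$ (l, j)" using assms by (simp add: sum.delta)
    finally show "(\<rho> x * mat_unit n k l * \<rho> (inv x)) $$ (i, j) = \<dots>" .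
  qed
  finally show ?thesis using c' assms by auto
qed

text \<open>The inverse of the isomorphism from \<open>KGe(\<chi>)\<close> to the matrix algebra. It is Fourier inversion with
  the other irreducible characters left out.\<close>

definition fourier_inverse :: "'a mat \<Rightarrow> 'g \<Rightarrow> 'a" where
  "fourier_inverse M = (\<lambda>x. if x \<in> carrier G
     then of_nat n / of_nat (Coset.order G) * mat_trace (\<rho> (inv x) * M) else 0)"

lemma order_nonzero: "(of_nat (Coset.order G) :: 'a) \<noteq> 0"
  using fin by (simp add: order_gt_0_iff_finite[symmetric])

lemma ext_fourier_inverse:
  assumes M: "M \<in> carrier_mat n n"
  shows "ext (fourier_inverse M) = M"
proof (rule eq_matI)
  fix i k assume "i < dim_row M" "k < dim_col M"
  hence ik: "i < n" "k < n" using M by auto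
  define c where "c = (of_nat n / of_nat (Coset.order G) :: 'a)"
  have "ext (fourier_inverse M) $$ (i, k)
      = (\<Sum>x\<in>carrier G. \<Sum>l<n. \<Sum>j<n. c * M $$ (j, l) * (\<rho> x $$ (i, k) * \<rho> (inv x) $$ (l, j)))"
    unfolding ext_index[OF ik]
    by (intro sum.cong refl, subst fourier_inverse_def, subst mat_trace_mult[where n=n and m=n])
      (use M in \<open>auto simp: c_def sum_distrib_left sum_distrib_right mult_ac\<close>)
  also have "\<dots> = (\<Sum>l<n. \<Sum>x\<in>carrier G. \<Sum>j<n. c * M $$ (j, l) * (\<rho> x $$ (i, k) * \<rho> (inv x) $$ (l, j)))"
    by (rule sum.swap)
  also have "\<dots> = (\<Sum>l<n. \<Sum>j<n. \<Sum>x\<in>carrier G. c * M $$ (j, l) * (\<rho> x $$ (i, k) * \<rho> (inv x) $$ (l, j)))"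
    by (intro sum.cong refl, rule sum.swap)
  also have "\<dots> = (\<Sum>l<n. \<Sum>j<n. if j = i then (if l = k then M $$ (j, l) else 0) else 0)"
    using ik n_pos order_nonzero
    by (intro sum.cong refl, subst sum_distrib_left[symmetric], subst entries_orthogonal)
      (auto simp: c_def)
  also have "\<dots> = M $$ (i, k)" using ik by (simp add: sum.delta)
  finally show "ext (fourier_inverse M) $$ (i, k) = M $$ (i, k)" .
qed (use M in auto)

text \<open>By Fourier inversion the matrices of the group elements span all matrices, and the trace form
  on matrices is nondegenerate.\<close>

lemma fourier_inverse_nondegenerate:
  assumes "M \<in> carrier_mat n n" "\<And>g. g \<in> carrier G \<Longrightarrow> mat_trace (\<rho> g * M) = 0"
  shows "M = 0\<^sub>m n n"
proof -
  have "fourier_inverse M = (\<lambda>x. 0)" using assms by (auto simp: fourier_inverse_def)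
  hence "M = ext (\<lambda>x. 0)" using ext_fourier_inverse[OF assms(1)] by simp
  thus ?thesis by (auto simp: rep_extend_def)
qed

text \<open>The coefficient of \<open>a e(\<chi>)\<close> at \<open>x\<close> depends only on the matrix of \<open>a\<close>. Multiplication by \<open>e(\<chi>)\<close>
  is therefore the passage from \<open>a\<close> to its matrix.\<close>

lemma mult_char_idempotent:
  assumes "\<chi> = character G \<rho>"
  shows "a \<otimes>\<^bsub>group_algebra G R\<^esub> char_idempotent G \<chi> = fourier_inverse (ext a)"
proof
  fix x
  show "(a \<otimes>\<^bsub>group_algebra G R\<^esub> char_idempotent G \<chi>) x = fourier_inverse (ext a) x"
  proof (cases "x \<in> carrier G")
    case x: True
    have chi1: "\<chi> \<one> = of_nat n" using assms by (simp add: character_def rep_one)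
    have "(a \<otimes>\<^bsub>group_algebra G R\<^esub> char_idempotent G \<chi>) x
      = (\<Sum>h\<in>carrier G. a h * (of_nat n / of_nat (Coset.order G) * mat_trace (\<rho> (inv x \<otimes> h))))"
      using x by (simp add: group_algebra_def char_idempotent_def chi1)
        (simp add: assms character_def inv_mult_group cong: sum.cong)
    also have "\<dots> = of_nat n / of_nat (Coset.order G) * (\<Sum>h\<in>carrier G. a h * mat_trace (\<rho> h * \<rho> (inv x)))"
      unfolding sum_distrib_left
    proof (rule sum.cong[OF refl])
      fix h assume h: "h \<in> carrier G"
      have "mat_trace (\<rho> (inv x \<otimes> h)) = mat_trace (\<rho> h * \<rho> (inv x))"
        using x h by (simp add: rep_mult) (rule mat_trace_comm[where n=n and m=n], auto)
      thus "a h * (of_nat n / of_nat (Coset.order G) * mat_trace (\<rho> (inv x \<otimes> h)))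
        = of_nat n / of_nat (Coset.order G) * (a h * mat_trace (\<rho> h * \<rho> (inv x)))" by simp
    qed
    also have "\<dots> = of_nat n / of_nat (Coset.order G) * mat_trace (ext a * \<rho> (inv x))"
      using x by (simp add: mat_trace_ext_mult)
    also have "\<dots> = fourier_inverse (ext a) x"
      using x by (simp add: fourier_inverse_def mat_trace_comm[of "ext a" n n "\<rho> (inv x)"])
    finally show ?thesis .
  next
    case False
    thus ?thesis by (simp add: group_algebra_def fourier_inverse_def)
  qed
qed

end

section \<open>Ring homomorphisms defined on a subring\<close>

text \<open>The reduction map is a homomorphism on the valuation ring only, not on the type of its
  quotient field. The same holds for the map that it induces on polynomials, which is needed for
  characteristic polynomials.\<close>

locale subring_hom =
  fixes S :: "'a::comm_ring_1 set" and h :: "'a \<Rightarrow> 'b::comm_ring_1"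
  assumes one_mem: "1 \<in> S"
    and add_mem: "x \<in> S \<Longrightarrow> y \<in> S \<Longrightarrow> x + y \<in> S"
    and mult_mem: "x \<in> S \<Longrightarrow> y \<in> S \<Longrightarrow> x * y \<in> S"
    and uminus_mem: "x \<in> S \<Longrightarrow> - x \<in> S"
    and hom_one: "h 1 = 1"
    and hom_add: "x \<in> S \<Longrightarrow> y \<in> S \<Longrightarrow> h (x + y) = h x + h y"
    and hom_mult: "x \<in> S \<Longrightarrow> y \<in> S \<Longrightarrow> h (x * y) = h x * h y"
begin

lemma zero_mem: "0 \<in> S"
  using add_mem[OF one_mem uminus_mem[OF one_mem]] by simp

lemma hom_zero: "h 0 = 0"
  using hom_add[OF zero_mem zero_mem] by simp

lemma hom_uminus: "x \<in> S \<Longrightarrow> h (- x) = - h x"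
  using hom_add[of x "- x"] uminus_mem hom_zero by (simp add: eq_neg_iff_add_eq_0 add.commute)

lemma diff_mem: "x \<in> S \<Longrightarrow> y \<in> S \<Longrightarrow> x - y \<in> S"
  using add_mem[of x "- y"] uminus_mem by simp

lemma hom_diff: "x \<in> S \<Longrightarrow> y \<in> S \<Longrightarrow> h (x - y) = h x - h y"
  using hom_add[of x "- y"] uminus_mem hom_uminus by simp

lemma sum_mem: "(\<And>i. i \<in> I \<Longrightarrow> f i \<in> S) \<Longrightarrow> sum f I \<in> S"
  by (induction I rule: infinite_finite_induct) (auto intro: zero_mem add_mem)

lemma hom_sum: "(\<And>i. i \<in> I \<Longrightarrow> f i \<in> S) \<Longrightarrow> h (sum f I) = (\<Sum>i\<in>I. h (f i))"
  by (induction I rule: infinite_finite_induct) (auto simp: hom_zero hom_add sum_mem)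

lemma prod_mem: "(\<And>i. i \<in> I \<Longrightarrow> f i \<in> S) \<Longrightarrow> prod f I \<in> S"
  by (induction I rule: infinite_finite_induct) (auto intro: one_mem mult_mem)

lemma hom_prod: "(\<And>i. i \<in> I \<Longrightarrow> f i \<in> S) \<Longrightarrow> h (prod f I) = (\<Prod>i\<in>I. h (f i))"
  by (induction I rule: infinite_finite_induct) (auto simp: hom_one hom_mult prod_mem)

lemma power_mem: "x \<in> S \<Longrightarrow> x ^ k \<in> S"
  by (induction k) (auto intro: one_mem mult_mem)

lemma hom_power: "x \<in> S \<Longrightarrow> h (x ^ k) = h x ^ k"
  by (induction k) (auto simp: hom_one hom_mult power_mem)

lemma of_nat_mem: "of_nat k \<in> S"
  by (induction k) (auto intro: zero_mem one_mem add_mem)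

lemma hom_of_nat: "h (of_nat k) = of_nat k"
  by (induction k) (auto simp: hom_zero hom_one hom_add of_nat_mem one_mem)

lemma hom_sum_list:
  "(\<And>x. x \<in> set xs \<Longrightarrow> f x \<in> S) \<Longrightarrow>
    (\<Sum>x\<leftarrow>xs. f x) \<in> S \<and> h (\<Sum>x\<leftarrow>xs. f x) = (\<Sum>x\<leftarrow>xs. h (f x))"
  by (induction xs) (auto simp: zero_mem hom_zero hom_add add_mem)

definition mats :: "nat \<Rightarrow> 'a mat set" where
  "mats n = {A \<in> carrier_mat n n. \<forall>i<n. \<forall>j<n. A $$ (i, j) \<in> S}"

lemma mats_carrier: "A \<in> mats n \<Longrightarrow> A \<in> carrier_mat n n"
  by (simp add: mats_def)

lemma mats_entry: "A \<in> mats n \<Longrightarrow> i < n \<Longrightarrow> j < n \<Longrightarrow> A $$ (i, j) \<in> S"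
  by (simp add: mats_def)

lemma matsI: "A \<in> carrier_mat n n \<Longrightarrow> (\<And>i j. i < n \<Longrightarrow> j < n \<Longrightarrow> A $$ (i, j) \<in> S) \<Longrightarrow> A \<in> mats n"
  by (simp add: mats_def)

lemma mats_mult: "A \<in> mats n \<Longrightarrow> B \<in> mats n \<Longrightarrow> A * B \<in> mats n"
  by (rule matsI, simp add: mats_carrier, subst mult_mat_index[where m=n and n=n and l=n])
    (auto simp: mats_carrier intro!: sum_mem mult_mem mats_entry)

lemma mats_smult: "c \<in> S \<Longrightarrow> A \<in> mats n \<Longrightarrow> c \<cdot>\<^sub>m A \<in> mats n"
  by (auto simp: mats_def intro!: mult_mem)

lemma mats_trace: "A \<in> mats n \<Longrightarrow> mat_trace A \<in> S"
  by (auto simp: mat_trace_def mats_def intro!: sum_mem)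

lemma mats_one: "1\<^sub>m n \<in> mats n"
  by (auto simp: mats_def one_mem zero_mem)

lemma mats_unit: "mat_unit n k l \<in> mats n"
  by (auto simp: mats_def mat_unit_def one_mem zero_mem)

lemma hom_mats_mult:
  assumes "A \<in> mats n" "B \<in> mats n"
  shows "map_mat h (A * B) = map_mat h A * map_mat h B"
proof (rule eq_matI)
  note c = mats_carrier[OF assms(1)] mats_carrier[OF assms(2)]
  fix i j assume "i < dim_row (map_mat h A * map_mat h B)" "j < dim_col (map_mat h A * map_mat h B)"
  hence ij: "i < n" "j < n" using c by auto
  have "(A * B) $$ (i, j) = (\<Sum>k<n. A $$ (i, k) * B $$ (k, j))"
    by (rule mult_mat_index) (use c ij in auto)
  hence "map_mat h (A * B) $$ (i, j) = h (\<Sum>k<n. A $$ (i, k) * B $$ (k, j))"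
    using c ij by simp
  also have "\<dots> = (\<Sum>k<n. h (A $$ (i, k) * B $$ (k, j)))"
    by (rule hom_sum) (use assms ij in \<open>auto intro!: mult_mem mats_entry\<close>)
  also have "\<dots> = (\<Sum>k<n. h (A $$ (i, k)) * h (B $$ (k, j)))"
    by (intro sum.cong refl hom_mult) (use assms ij in \<open>auto intro!: mats_entry\<close>)
  also have "\<dots> = (\<Sum>k<n. map_mat h A $$ (i, k) * map_mat h B $$ (k, j))"
    using c ij by (intro sum.cong) auto
  also have "\<dots> = (map_mat h A * map_mat h B) $$ (i, j)"
    by (rule mult_mat_index[symmetric]) (use c ij in auto)
  finally show "map_mat h (A * B) $$ (i, j) = (map_mat h A * map_mat h B) $$ (i, j)" .
qed (use assms in \<open>auto dest: mats_carrier\<close>)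

lemma hom_mats_one: "map_mat h (1\<^sub>m n) = 1\<^sub>m n"
  by (rule eq_matI) (auto simp: hom_one hom_zero)

lemma hom_mats_trace: "A \<in> mats n \<Longrightarrow> mat_trace (map_mat h A) = h (mat_trace A)"
  by (auto simp: mat_trace_def mats_def intro!: hom_sum[symmetric])

lemma hom_mats_unit: "map_mat h (mat_unit n k l) = mat_unit n k l"
  by (rule eq_matI) (auto simp: mat_unit_def hom_one hom_zero)

lemma signof_mem: "signof q \<in> S" and hom_signof: "h (signof q) = signof q"
  using one_mem uminus_mem hom_one hom_uminus by (auto simp: sign_def)

lemma det_mem: assumes "A \<in> mats n" shows "det A \<in> S"
  using assms unfolding det_def'[OF mats_carrier[OF assms]]
  by (intro sum_mem mult_mem signof_mem prod_mem mats_entry)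
    (auto dest!: permutes_in_image)

lemma hom_det: assumes "A \<in> mats n" shows "det (map_mat h A) = h (det A)"
proof -
  note c = mats_carrier[OF assms]
  have c': "map_mat h A \<in> carrier_mat n n" using c by simp
  have m: "A $$ (i, q i) \<in> S" if "q permutes {0..<n}" "i \<in> {0..<n}" for q i
    using that permutes_in_image[OF that(1), of i] by (intro mats_entry[OF assms]) auto
  have t: "h (signof q * (\<Prod>i=0..<n. A $$ (i, q i))) = signof q * (\<Prod>i=0..<n. h (A $$ (i, q i)))"
    and t': "signof q * (\<Prod>i=0..<n. A $$ (i, q i)) \<in> S"
    if "q permutes {0..<n}" for q
  proof -
    have P: "(\<Prod>i=0..<n. A $$ (i, q i)) \<in> S" by (rule prod_mem) (rule m[OF that])
    have "h (\<Prod>i=0..<n. A $$ (i, q i)) = (\<Prod>i=0..<n. h (A $$ (i, q i)))"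
      by (rule hom_prod) (rule m[OF that])
    thus "h (signof q * (\<Prod>i=0..<n. A $$ (i, q i))) = signof q * (\<Prod>i=0..<n. h (A $$ (i, q i)))"
      by (simp add: hom_mult[OF signof_mem P] hom_signof)
    show "signof q * (\<Prod>i=0..<n. A $$ (i, q i)) \<in> S" by (rule mult_mem[OF signof_mem P])
  qed
  have "h (det A) = (\<Sum>q\<in>{q. q permutes {0..<n}}. signof q * (\<Prod>i=0..<n. h (A $$ (i, q i))))"
    unfolding det_def'[OF c] using t t' by (subst hom_sum) (auto intro!: sum.cong)
  also have "\<dots> = det (map_mat h A)"
    unfolding det_def'[OF c']
  proof (intro sum.cong refl arg_cong2[where f = "(*)"] prod.cong)
    fix q i assume "q \<in> {q. q permutes {0..<n}}" "i \<in> {0..<n}"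
    hence "i < n" "q i < n" using permutes_in_image[of q "{0..<n}" i] by auto
    thus "h (A $$ (i, q i)) = map_mat h A $$ (i, q i)" using c by simp
  qed
  finally show ?thesis ..
qed

text \<open>With the adjugate, inverses of integral matrices reduce to inverses of determinants.\<close>

lemma adj_mat_mem: assumes A: "A \<in> mats n" shows "adj_mat A \<in> mats n"
proof (rule matsI)
  note c = mats_carrier[OF A]
  show "adj_mat A \<in> carrier_mat n n" using adj_mat(1)[OF c] .
  fix i j assume ij: "i < n" "j < n"
  have "mat_delete A j i \<in> mats (n - 1)"
  proof (rule matsI)
    fix a b assume "a < n - 1" "b < n - 1"
    thus "mat_delete A j i $$ (a, b) \<in> S" using c ij mats_entry[OF A]
      by (auto simp: mat_delete_def)
  qed (use c ij in \<open>auto simp: mat_delete_def\<close>)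
  hence "cofactor A j i \<in> S" unfolding cofactor_def
    by (intro mult_mem power_mem uminus_mem one_mem det_mem)
  thus "adj_mat A $$ (i, j) \<in> S" using c ij by (simp add: adj_mat_def)
qed

lemma poly_subring_hom: "subring_hom {q. \<forall>i. Polynomial.coeff q i \<in> S} (map_poly h)"
proof
  fix x y assume "x \<in> {q. \<forall>i. Polynomial.coeff q i \<in> S}" "y \<in> {q. \<forall>i. Polynomial.coeff q i \<in> S}"
  hence xy: "\<And>i. Polynomial.coeff x i \<in> S" "\<And>i. Polynomial.coeff y i \<in> S" by auto
  show "x + y \<in> {q. \<forall>i. Polynomial.coeff q i \<in> S}" "x * y \<in> {q. \<forall>i. Polynomial.coeff q i \<in> S}"
    "- x \<in> {q. \<forall>i. Polynomial.coeff q i \<in> S}"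
    using xy by (auto simp: coeff_mult intro!: add_mem sum_mem mult_mem uminus_mem)
  show "map_poly h (x + y) = map_poly h x + map_poly h y"
    "map_poly h (x * y) = map_poly h x * map_poly h y"
    using xy by (auto simp: poly_eq_iff coeff_map_poly hom_zero hom_add coeff_mult hom_sum hom_mult mult_mem)
qed (auto simp: one_mem zero_mem hom_one hom_zero map_poly_1' coeff_1)

lemma hom_char_poly:
  assumes A: "A \<in> mats n"
  shows "char_poly (map_mat h A) = map_poly h (char_poly A)"
proof -
  note c = mats_carrier[OF A]
  interpret P: subring_hom "{q. \<forall>i. Polynomial.coeff q i \<in> S}" "map_poly h" by (rule poly_subring_hom)
  have "char_poly_matrix A \<in> P.mats n"
    using A c by (intro P.matsI)
      (auto simp: char_poly_matrix_def coeff_pCons one_mem zero_mem mats_entry uminus_mem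
        intro!: add_mem split: nat.splits)
  hence "map_poly h (char_poly A) = det (map_mat (map_poly h) (char_poly_matrix A))"
    unfolding char_poly_def by (rule P.hom_det[symmetric])
  also have "map_mat (map_poly h) (char_poly_matrix A) = char_poly_matrix (map_mat h A)"
    using c mats_entry[OF A]
    by (intro eq_matI poly_eqI)
      (auto simp: char_poly_matrix_def coeff_map_poly hom_zero coeff_pCons hom_one hom_uminus
        hom_add one_mem zero_mem uminus_mem split: nat.splits)
  finally show ?thesis by (simp add: char_poly_def)
qed

lemma hom_prod_linear:
  assumes "set as \<subseteq> S"
  shows "map_poly h (\<Prod>a\<leftarrow>as. [:- a, 1:]) = (\<Prod>a\<leftarrow>as. [:- h a, 1:])"
proof -
  interpret P: subring_hom "{q. \<forall>i. Polynomial.coeff q i \<in> S}" "map_poly h" by (rule poly_subring_hom)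
  have lin: "[:- a, 1:] \<in> {q. \<forall>i. Polynomial.coeff q i \<in> S}" if "a \<in> S" for a
    using that by (auto simp: coeff_pCons zero_mem one_mem uminus_mem split: nat.splits)
  have "(\<Prod>a\<leftarrow>as. [:- a, 1:]) \<in> {q. \<forall>i. Polynomial.coeff q i \<in> S} \<and>
     map_poly h (\<Prod>a\<leftarrow>as. [:- a, 1:]) = (\<Prod>a\<leftarrow>as. [:- h a, 1:])"
    using assms
  proof (induction as)
    case Nil
    show ?case using P.one_mem P.hom_one by simp
  next
    case (Cons a as)
    hence a: "a \<in> S" and IH: "(\<Prod>a\<leftarrow>as. [:- a, 1:]) \<in> {q. \<forall>i. Polynomial.coeff q i \<in> S}"
      "map_poly h (\<Prod>a\<leftarrow>as. [:- a, 1:]) = (\<Prod>a\<leftarrow>as. [:- h a, 1:])" by auto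
    have "map_poly h [:- a, 1:] = [:- h a, 1:]"
      using a by (intro poly_eqI)
        (auto simp: coeff_map_poly hom_zero coeff_pCons hom_one hom_uminus split: nat.splits)
    thus ?case using P.mult_mem[OF lin[OF a] IH(1)] P.hom_mult[OF lin[OF a] IH(1)] IH(2) by simp
  qed
  thus ?thesis by simp
qed

end

section \<open>The valuation ring\<close>

context p_modular_system
begin

lemma carrier_subring_of [simp]: "carrier (subring_of \<O>) = \<O>"
  and mult_subring_of [simp]: "x \<otimes>\<^bsub>subring_of \<O>\<^esub> y = x * y"
  and add_subring_of [simp]: "x \<oplus>\<^bsub>subring_of \<O>\<^esub> y = x + y"
  and one_subring_of [simp]: "\<one>\<^bsub>subring_of \<O>\<^esub> = 1"
  and zero_subring_of [simp]: "\<zero>\<^bsub>subring_of \<O>\<^esub> = 0"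
  by (simp_all add: subring_of_def)

lemma principal_domain_O: "principal_domain (subring_of \<O>)"
  using complete_dvr
  by (simp add: complete_discrete_valuation_ring_def discrete_valuation_ring_def)

lemma unique_maximal_ideal: "\<exists>!M. maximalideal M (subring_of \<O>)"
  using complete_dvr
  by (simp add: complete_discrete_valuation_ring_def discrete_valuation_ring_def
      discrete_valuation_ring_axioms_def)

sublocale red: subring_hom \<O> red
proof -
  interpret O: principal_domain "subring_of \<O>" by (rule principal_domain_O)
  show "subring_hom \<O> red"
  proof
    show "1 \<in> \<O>" using O.one_closed by simp
    show "x + y \<in> \<O>" if "x \<in> \<O>" "y \<in> \<O>" for x y using O.a_closed[of x y] that by simp
    show "x * y \<in> \<O>" if "x \<in> \<O>" "y \<in> \<O>" for x y using O.m_closed[of x y] that by simp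
    show "- x \<in> \<O>" if "x \<in> \<O>" for x
    proof -
      have "x + (\<ominus>\<^bsub>subring_of \<O>\<^esub> x) = 0" using O.r_neg[of x] that by simp
      hence "- x = \<ominus>\<^bsub>subring_of \<O>\<^esub> x" by (rule minus_unique)
      thus ?thesis using O.a_inv_closed[of x] that by simp
    qed
    show "red 1 = 1" using ring_hom_one[OF red_hom] by simp
    show "red (x + y) = red x + red y" if "x \<in> \<O>" "y \<in> \<O>" for x y
      using ring_hom_add[OF red_hom, of x y] that by simp
    show "red (x * y) = red x * red y" if "x \<in> \<O>" "y \<in> \<O>" for x y
      using ring_hom_mult[OF red_hom, of x y] that by simp
  qed
qed

text \<open>The residue map is onto a field, so its kernel is the maximal ideal of \<open>\<O>\<close>.\<close>

lemma maximalideal_ker_red: "maximalideal {x \<in> \<O>. red x = 0} (subring_of \<O>)"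
proof (rule maximalidealI)
  interpret O: principal_domain "subring_of \<O>" by (rule principal_domain_O)
  show "ideal {x \<in> \<O>. red x = 0} (subring_of \<O>)"
  proof (rule idealI[OF O.ring_axioms])
    show "subgroup {x \<in> \<O>. red x = 0} (add_monoid (subring_of \<O>))"
    proof (rule O.add.subgroupI)
      have "0 \<in> {x \<in> \<O>. red x = 0}" using red.zero_mem red.hom_zero by simp
      thus "{x \<in> \<O>. red x = 0} \<noteq> {}" by auto
      fix x assume x: "x \<in> {x \<in> \<O>. red x = 0}"
      have "x + (\<ominus>\<^bsub>subring_of \<O>\<^esub> x) = 0" using O.r_neg[of x] x by simp
      hence "\<ominus>\<^bsub>subring_of \<O>\<^esub> x = - x" by (rule minus_unique[symmetric])
      thus "\<ominus>\<^bsub>subring_of \<O>\<^esub> x \<in> {x \<in> \<O>. red x = 0}"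
        using x by (simp add: red.uminus_mem red.hom_uminus)
    qed (auto simp: red.add_mem red.hom_add)
  qed (simp_all add: red.mult_mem red.hom_mult)
  show "carrier (subring_of \<O>) \<noteq> {x \<in> \<O>. red x = 0}"
  proof
    assume "carrier (subring_of \<O>) = {x \<in> \<O>. red x = 0}"
    hence "1 \<in> {x \<in> \<O>. red x = 0}" using red.one_mem by simp
    thus False using red.hom_one by simp
  qed
  fix J assume J: "ideal J (subring_of \<O>)" "{x \<in> \<O>. red x = 0} \<subseteq> J" "J \<subseteq> carrier (subring_of \<O>)"
  show "J = {x \<in> \<O>. red x = 0} \<or> J = carrier (subring_of \<O>)"
  proof (cases "J \<subseteq> {x \<in> \<O>. red x = 0}")
    case False
    then obtain x where x: "x \<in> J" "x \<in> \<O>" "red x \<noteq> 0" using J(3) by (auto simp: subset_iff)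
    interpret J: ideal J "subring_of \<O>" by fact
    have "inverse (red x) \<in> red ` \<O>" unfolding red_surj by simp
    then obtain y where y: "y \<in> \<O>" "red y = inverse (red x)" by auto
    have "1 - x * y \<in> {x \<in> \<O>. red x = 0}"
      using x y by (simp add: red.diff_mem red.one_mem red.mult_mem red.hom_diff red.hom_one red.hom_mult)
    hence "1 - x * y \<in> J" using J(2) by blast
    moreover have "x * y \<in> J" using J.I_r_closed[OF x(1), of y] y by simp
    ultimately have "1 \<in> J" using J.a_closed[of "1 - x * y" "x * y"] by simp
    thus ?thesis using J.one_imp_carrier by simp
  next
    case True
    thus ?thesis using J(2) by blast
  qed
qed

text \<open>A nonunit has an irreducible divisor, which generates a maximal ideal; the only one is the
  kernel of the residue map.\<close>

lemma inverse_mem: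
  assumes "x \<in> \<O>" "red x \<noteq> 0"
  shows "inverse x \<in> \<O>"
proof -
  interpret O: principal_domain "subring_of \<O>" by (rule principal_domain_O)
  have "x \<noteq> 0" using assms red.hom_zero by auto
  have "x \<in> Units (subring_of \<O>)"
  proof (rule ccontr)
    assume "x \<notin> Units (subring_of \<O>)"
    then obtain q where q: "q \<in> \<O>" "ring_irreducible\<^bsub>subring_of \<O>\<^esub> q" "q divides\<^bsub>subring_of \<O>\<^esub> x"
      using \<open>x \<noteq> 0\<close> assms(1) by (elim O.exists_irreducible_divisor[rotated]) auto
    have "maximalideal (PIdl\<^bsub>subring_of \<O>\<^esub> q) (subring_of \<O>)"
      using O.irreducible_imp_maximalideal q by simp
    hence eq: "PIdl\<^bsub>subring_of \<O>\<^esub> q = {x \<in> \<O>. red x = 0}"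
      by (rule Uniq_D[OF ex1_iff_ex_Uniq[THEN iffD1, OF unique_maximal_ideal, THEN conjunct2] _ maximalideal_ker_red])
    have "q \<in> PIdl\<^bsub>subring_of \<O>\<^esub> q" using O.cgenideal_self q by simp
    hence "red q = 0" using eq by simp
    moreover obtain c where "c \<in> \<O>" "x = q * c" using q(3) by (auto simp: factor_def)
    ultimately show False using assms q red.hom_mult[of q c] by simp
  qed
  then obtain y where "y \<in> \<O>" "y * x = 1" by (auto simp: Units_def)
  thus ?thesis using inverse_unique[of x y] by (simp add: mult.commute)
qed

text \<open>\<open>\<O>\<close> is a valuation ring: let \<open>x = a / b\<close>, and let \<open>d = r a + s b\<close> generate the ideal \<open>(a, b)\<close>,
  with \<open>a = a' d\<close> and \<open>b = b' d\<close>. Then \<open>r a' + s b' = 1\<close>, and in a local ring \<open>a'\<close> or \<open>b'\<close> must be a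
  unit.\<close>

lemma mem_or_inverse_mem: "x \<in> \<O> \<or> inverse x \<in> \<O>"
proof -
  interpret O: principal_domain "subring_of \<O>" by (rule principal_domain_O)
  obtain a b where ab: "a \<in> \<O>" "b \<in> \<O>" "b \<noteq> 0" "x = a / b" using quotient_field by blast
  show ?thesis
  proof (cases "a = 0")
    case True
    thus ?thesis using ab red.zero_mem by simp
  next
    case False
    have "ideal (PIdl\<^bsub>subring_of \<O>\<^esub> a <+>\<^bsub>subring_of \<O>\<^esub> PIdl\<^bsub>subring_of \<O>\<^esub> b) (subring_of \<O>)"
      using ab by (intro O.add_ideals O.cgenideal_ideal) auto
    then obtain d where d: "d \<in> \<O>"
      "PIdl\<^bsub>subring_of \<O>\<^esub> a <+>\<^bsub>subring_of \<O>\<^esub> PIdl\<^bsub>subring_of \<O>\<^esub> b = PIdl\<^bsub>subring_of \<O>\<^esub> d"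
      using O.exists_gen by auto
    have PIdl: "PIdl\<^bsub>subring_of \<O>\<^esub> c = {x * c |x. x \<in> \<O>}" for c
      by (simp add: cgenideal_def)
    have sum: "PIdl\<^bsub>subring_of \<O>\<^esub> a <+>\<^bsub>subring_of \<O>\<^esub> PIdl\<^bsub>subring_of \<O>\<^esub> b
       = {r * a + s * b |r s. r \<in> \<O> \<and> s \<in> \<O>}"
      unfolding PIdl set_add_def' by (simp, blast)
    have eq: "{r * a + s * b |r s. r \<in> \<O> \<and> s \<in> \<O>} = {x * d |x. x \<in> \<O>}"
      using d(2) unfolding sum PIdl[of d] .
    have "d \<in> {x * d |x. x \<in> \<O>}" using red.one_mem by force
    then obtain r s where rs: "r \<in> \<O>" "s \<in> \<O>" "d = r * a + s * b" using eq by blast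
    have "a \<in> {r * a + s * b |r s. r \<in> \<O> \<and> s \<in> \<O>}"
      using red.one_mem red.zero_mem by (intro CollectI exI[of _ 1] exI[of _ 0]) simp
    then obtain a' where a': "a' \<in> \<O>" "a = a' * d" unfolding eq by auto
    have "b \<in> {r * a + s * b |r s. r \<in> \<O> \<and> s \<in> \<O>}"
      using red.one_mem red.zero_mem by (intro CollectI exI[of _ 0] exI[of _ 1]) simp
    then obtain b' where b': "b' \<in> \<O>" "b = b' * d" unfolding eq by auto
    have "d \<noteq> 0" using a' False by auto
    have "d = r * (a' * d) + s * (b' * d)" using rs(3) a'(2) b'(2) by simp
    hence "(r * a' + s * b') * d = 1 * d" by (simp add: algebra_simps)
    hence "r * a' + s * b' = 1" using \<open>d \<noteq> 0\<close> by simp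
    moreover have "red (r * a' + s * b') = red r * red a' + red s * red b'"
      using rs a' b' by (simp add: red.hom_add red.hom_mult red.mult_mem)
    ultimately have "red r * red a' + red s * red b' = 1" using red.hom_one by simp
    hence "red a' \<noteq> 0 \<or> red b' \<noteq> 0" by auto
    hence "inverse a' \<in> \<O> \<or> inverse b' \<in> \<O>" using inverse_mem a' b' by blast
    moreover have "x = a' * inverse b'" "inverse x = inverse a' * b'"
      using ab(4) a'(2) b'(2) \<open>d \<noteq> 0\<close> by (auto simp: field_simps)
    ultimately show ?thesis using a' b' red.mult_mem by auto
  qed
qed

text \<open>If \<open>1 / z\<close> is in \<open>\<O>\<close>, so is its power \<open>z\<close>.\<close>

lemma root_of_unity_mem:
  assumes "z ^ m = 1" "0 < m"
  shows "z \<in> \<O>"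
  using mem_or_inverse_mem[of z]
proof
  assume inv: "inverse z \<in> \<O>"
  have "z \<noteq> 0" using assms by (auto simp: power_0_left)
  have "z * z ^ (m - 1) = 1" using assms by (cases m) auto
  hence "z = inverse z ^ (m - 1)" using \<open>z \<noteq> 0\<close>
    by (simp add: power_inverse field_simps)
  thus ?thesis using red.power_mem[OF inv, of "m - 1"] by simp
qed

text \<open>An element of least valuation.\<close>

lemma exists_dividing_all:
  assumes "finite A" "\<exists>a\<in>A. a \<noteq> 0"
  obtains a where "a \<in> A" "a \<noteq> 0" "\<And>b. b \<in> A \<Longrightarrow> b / a \<in> \<O>"
proof -
  have "\<exists>a\<in>A. a \<noteq> 0 \<and> (\<forall>b\<in>A. b / a \<in> \<O>)" using assms
  proof (induction A rule: finite_induct)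
    case (insert c A)
    show ?case
    proof (cases "\<exists>a\<in>A. a \<noteq> 0")
      case False
      hence "\<forall>a\<in>A. a = 0" "c \<noteq> 0" using insert by auto
      thus ?thesis using red.zero_mem red.one_mem by auto
    next
      case True
      then obtain a where a: "a \<in> A" "a \<noteq> 0" "\<forall>b\<in>A. b / a \<in> \<O>" using insert by blast
      show ?thesis
      proof (cases "c / a \<in> \<O>")
        case True
        thus ?thesis using a by auto
      next
        case False
        hence ca: "inverse (c / a) \<in> \<O>" "c \<noteq> 0"
          using mem_or_inverse_mem[of "c / a"] red.zero_mem by auto
        have "b / c \<in> \<O>" if "b \<in> A" for b
        proof -
          have "b / c = (b / a) * inverse (c / a)" using a ca by simp
          thus ?thesis using red.mult_mem[OF a(3)[rule_format, OF that] ca(1)] a(2) by simp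
        qed
        thus ?thesis using ca red.one_mem by auto
      qed
    qed
  qed auto
  thus ?thesis using that by blast
qed

lemma mats_inverse:
  assumes A: "A \<in> red.mats n" and det: "red (det A) \<noteq> 0"
  obtains B where "B \<in> red.mats n" "A * B = 1\<^sub>m n"
proof
  note c = red.mats_carrier[OF A]
  have "det A \<noteq> 0" using det red.hom_zero by auto
  let ?B = "inverse (det A) \<cdot>\<^sub>m adj_mat A"
  show "?B \<in> red.mats n"
    using A det by (intro red.mats_smult inverse_mem red.adj_mat_mem red.det_mem)
  have "A * ?B = inverse (det A) \<cdot>\<^sub>m (A * adj_mat A)"
    using c adj_mat(1)[OF c] by (rule mult_smult_distrib)
  also have "\<dots> = 1\<^sub>m n" unfolding adj_mat(2)[OF c]
    using \<open>det A \<noteq> 0\<close> by (intro eq_matI) auto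
  finally show "A * ?B = 1\<^sub>m n" .
qed

lemma red_of_nat_eq_0_iff: "red (of_nat m) = 0 \<longleftrightarrow> p dvd m"
  by (simp add: red.hom_of_nat of_nat_eq_0_iff_char_dvd char_residue_field)

end

section \<open>Invariant subspaces and block triangular form\<close>

definition vec_subspace :: "nat \<Rightarrow> 'a::field vec set \<Rightarrow> bool" where
  "vec_subspace n W \<longleftrightarrow> W \<subseteq> carrier_vec n \<and> 0\<^sub>v n \<in> W \<and>
     (\<forall>v\<in>W. \<forall>w\<in>W. v + w \<in> W) \<and> (\<forall>c. \<forall>v\<in>W. c \<cdot>\<^sub>v v \<in> W)"

lemma subspace_module_vec_iff:
  "VectorSpace.subspace class_ring W (module_vec TYPE('a::field) n) \<longleftrightarrow> vec_subspace n W"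
proof -
  interpret V: vec_space "TYPE('a)" n .
  have "vectorspace class_ring (module_vec TYPE('a) n)" by (rule V.vectorspace_axioms)
  moreover have "Module.module class_ring (module_vec TYPE('a) n)" by (rule V.module_axioms)
  ultimately show ?thesis
    by (auto simp: VectorSpace.subspace_def submodule_def vec_subspace_def module_vec_def)
qed

lemma mult_mat_vec_mem_subspace:
  assumes W: "vec_subspace n W" and A: "A \<in> carrier_mat n m" and x: "x \<in> carrier_vec m"
    and cols: "\<And>j. j < m \<Longrightarrow> col A j \<in> W"
  shows "A *\<^sub>v x \<in> W"
proof -
  have "vec n (\<lambda>i. \<Sum>j<k. A $$ (i, j) * x $ j) \<in> W" if "k \<le> m" for k using that
  proof (induction k)
    case 0
    have "vec n (\<lambda>i. \<Sum>j<0. A $$ (i, j) * x $ j) = 0\<^sub>v n" by (intro eq_vecI) auto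
    thus ?case using W by (simp add: vec_subspace_def)
  next
    case (Suc k)
    have "vec n (\<lambda>i. \<Sum>j<Suc k. A $$ (i, j) * x $ j)
        = vec n (\<lambda>i. \<Sum>j<k. A $$ (i, j) * x $ j) + x $ k \<cdot>\<^sub>v col A k"
      using A Suc.prems by (intro eq_vecI) (auto simp: mult.commute)
    moreover have "vec n (\<lambda>i. \<Sum>j<k. A $$ (i, j) * x $ j) \<in> W" "x $ k \<cdot>\<^sub>v col A k \<in> W"
      using Suc W cols[of k] by (auto simp: vec_subspace_def)
    ultimately show ?case using W by (simp add: vec_subspace_def)
  qed
  from this[of m] have "vec n (\<lambda>i. \<Sum>j<m. A $$ (i, j) * x $ j) \<in> W" by simp
  moreover have "A *\<^sub>v x = vec n (\<lambda>i. \<Sum>j<m. A $$ (i, j) * x $ j)"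
    using A x by (intro eq_vecI) (auto simp: scalar_prod_def atLeast0LessThan)
  ultimately show ?thesis by simp
qed

lemma det_nonzero_inverse:
  fixes A :: "'a::field mat"
  assumes "A \<in> carrier_mat n n" "det A \<noteq> 0"
  obtains B where "B \<in> carrier_mat n n" "A * B = 1\<^sub>m n" "B * A = 1\<^sub>m n"
proof -
  have "A \<in> Units (ring_mat TYPE('a) n ())" using assms by (rule det_non_zero_imp_unit)
  thus ?thesis using that by (auto simp: Units_def ring_mat_simps)
qed

text \<open>Choose an invertible matrix \<open>P\<close> with as many leading columns from \<open>W\<close> as possible. If some \<open>w\<close>
  in \<open>W\<close> had a nonzero coordinate at \<open>i \<ge> r\<close>, it could replace the column \<open>i\<close>, by Cramer's rule, and
  the exchange of the columns \<open>r\<close> and \<open>i\<close> would give a better matrix. The set \<open>W\<close> will be a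
  subspace or an orbit of vectors.\<close>

lemma maximal_partial_basis:
  fixes W :: "'a::field vec set"
  assumes W: "W \<subseteq> carrier_vec n"
  obtains r P Q where "r \<le> n" "P \<in> carrier_mat n n" "Q \<in> carrier_mat n n"
    "P * Q = 1\<^sub>m n" "Q * P = 1\<^sub>m n" "\<And>j. j < r \<Longrightarrow> col P j \<in> W"
    "\<And>w i. w \<in> W \<Longrightarrow> r \<le> i \<Longrightarrow> i < n \<Longrightarrow> (Q *\<^sub>v w) $ i = 0"
proof -
  define S where "S = {r. r \<le> n \<and> (\<exists>P :: 'a mat. P \<in> carrier_mat n n \<and> det P \<noteq> 0 \<and> (\<forall>j<r. col P j \<in> W))}"
  have S0: "0 \<in> S" unfolding S_def by (auto intro!: exI[of _ "1\<^sub>m n"])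
  have fS: "finite S" unfolding S_def by (rule finite_subset[of _ "{..n}"]) auto
  define r where "r = Max S"
  have "r \<in> S" using S0 fS unfolding r_def by (intro Max_in) auto
  then obtain P :: "'a mat" where r: "r \<le> n" and P: "P \<in> carrier_mat n n" "det P \<noteq> 0" "\<forall>j<r. col P j \<in> W"
    by (auto simp: S_def)
  obtain Q where Q: "Q \<in> carrier_mat n n" "P * Q = 1\<^sub>m n" "Q * P = 1\<^sub>m n"
    using det_nonzero_inverse[OF P(1,2)] by blast
  have van: "(Q *\<^sub>v w) $ i = 0" if w: "w \<in> W" and i: "r \<le> i" "i < n" for w i
  proof (rule ccontr)
    assume ne: "(Q *\<^sub>v w) $ i \<noteq> 0"
    have wc: "w \<in> carrier_vec n" using w W by auto
    have "w = P *\<^sub>v (Q *\<^sub>v w)" using P Q wc by (simp add: assoc_mult_mat_vec[symmetric])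
    hence det1: "det (replace_col P w i) = (Q *\<^sub>v w) $ i * det P"
      using cramer_lemma_mat[OF P(1), of "Q *\<^sub>v w" i] Q wc i by auto
    let ?P1 = "replace_col P w i"
    have P1: "?P1 \<in> carrier_mat n n" using P by (simp add: replace_col_def)
    define P2 where "P2 = (if i = r then ?P1 else swapcols r i ?P1)"
    have P2: "P2 \<in> carrier_mat n n" using P1 by (auto simp: P2_def)
    have "det P2 \<noteq> 0" using det1 ne P i r det_swapcols[of r n i ?P1] P1 by (auto simp: P2_def)
    moreover have "col P2 j \<in> W" if j: "j < Suc r" for j
    proof (cases "j = r")
      case True
      have "col P2 j = w" using True i P wc
        by (intro eq_vecI) (auto simp: P2_def replace_col_def)
      thus ?thesis using w by simp
    next
      case False
      hence "col P2 j = col P j" using j i P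
        by (intro eq_vecI) (auto simp: P2_def replace_col_def)
      thus ?thesis using P(3) False j by simp
    qed
    ultimately have "Suc r \<in> S" using P2 i by (auto simp: S_def)
    thus False using Max_ge[OF fS, of "Suc r"] by (simp add: r_def[symmetric])
  qed
  show ?thesis
    by (rule that[OF r P(1) Q]) (use P(3) van in auto)
qed

text \<open>A subspace is spanned by the leading columns that the previous lemma finds in it.\<close>

lemma adapted_basis:
  fixes W :: "'a::field vec set"
  assumes W: "vec_subspace n W" "W \<noteq> {0\<^sub>v n}" "W \<noteq> carrier_vec n"
  obtains r P Q where "0 < r" "r < n" "P \<in> carrier_mat n n" "Q \<in> carrier_mat n n"
    "P * Q = 1\<^sub>m n" "Q * P = 1\<^sub>m n" "\<And>j. j < r \<Longrightarrow> col P j \<in> W"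
    "\<And>w i. w \<in> W \<Longrightarrow> r \<le> i \<Longrightarrow> i < n \<Longrightarrow> (Q *\<^sub>v w) $ i = 0"
proof -
  have "W \<subseteq> carrier_vec n" using W(1) by (auto simp: vec_subspace_def)
  then obtain r P Q where r: "r \<le> n" and P1: "P \<in> carrier_mat n n"
    and Q: "Q \<in> carrier_mat n n" "P * Q = 1\<^sub>m n" "Q * P = 1\<^sub>m n"
    and P2: "\<And>j. j < r \<Longrightarrow> col P j \<in> W"
    and van: "\<And>w i. w \<in> W \<Longrightarrow> r \<le> i \<Longrightarrow> i < n \<Longrightarrow> (Q *\<^sub>v w) $ i = 0"
    by (rule maximal_partial_basis) (rule that)
  note P = P1 P2
  have "0 < r"
  proof (rule ccontr)
    assume "\<not> 0 < r"
    hence "Q *\<^sub>v w = 0\<^sub>v n" if "w \<in> W" for w using van[OF that] Q by (intro eq_vecI) auto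
    hence "w = 0\<^sub>v n" if "w \<in> W" for w
    proof -
      have wc: "w \<in> carrier_vec n" using that W by (auto simp: vec_subspace_def)
      have "w = P *\<^sub>v (Q *\<^sub>v w)" using P Q wc by (simp add: assoc_mult_mat_vec[symmetric])
      thus ?thesis using \<open>\<And>w. w \<in> W \<Longrightarrow> Q *\<^sub>v w = 0\<^sub>v n\<close>[OF that] P by auto
    qed
    thus False using W by (auto simp: vec_subspace_def)
  qed
  moreover have "r < n"
  proof (rule ccontr)
    assume "\<not> r < n"
    hence "r = n" using r by simp
    have "v \<in> W" if v: "v \<in> carrier_vec n" for v
    proof -
      have "v = P *\<^sub>v (Q *\<^sub>v v)" using P Q v by (simp add: assoc_mult_mat_vec[symmetric])
      moreover have "P *\<^sub>v (Q *\<^sub>v v) \<in> W"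
        using P Q v \<open>r = n\<close> by (intro mult_mat_vec_mem_subspace[OF W(1)]) auto
      ultimately show ?thesis by simp
    qed
    thus False using W by (auto simp: vec_subspace_def)
  qed
  ultimately show ?thesis
    by (rule that[OF _ _ P1 Q]) (use P2 van in auto)
qed

lemma (in matrix_rep) conjugate_rep:
  assumes PQ: "P \<in> carrier_mat n n" "Q \<in> carrier_mat n n" "P * Q = 1\<^sub>m n" "Q * P = 1\<^sub>m n"
  shows "matrix_rep G n (\<lambda>g. Q * \<rho> g * P)"
proof
  fix g h assume gh: "g \<in> carrier G" "h \<in> carrier G"
  have "Q * \<rho> g * P * (Q * \<rho> h * P) = Q * \<rho> g * (P * Q) * \<rho> h * P"
    using PQ(1,2) gh by (simp add: square_assoc[where n=n])
  also have "\<dots> = Q * \<rho> (g \<otimes> h) * P" using PQ gh by (simp add: square_assoc[where n=n] rep_mult)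
  finally show "Q * \<rho> (g \<otimes> h) * P = Q * \<rho> g * P * (Q * \<rho> h * P)" ..
qed (use PQ fin in \<open>auto simp: rep_one\<close>)

lemma mat_trace_conjugate:
  fixes A :: "'a::comm_ring_1 mat"
  assumes "P \<in> carrier_mat n n" "Q \<in> carrier_mat n n" "P * Q = 1\<^sub>m n" "A \<in> carrier_mat n n"
  shows "mat_trace (Q * A * P) = mat_trace A"
proof -
  have "mat_trace (Q * A * P) = mat_trace (P * (Q * A))"
    using assms by (intro mat_trace_comm[where n=n and m=n]) auto
  also have "P * (Q * A) = A" using assms by (simp add: square_assoc[symmetric, where n=n])
  finally show ?thesis .
qed

lemma char_poly_block_triangular:
  fixes A :: "'a::idom mat"
  assumes A: "A \<in> carrier_mat n n" and "r \<le> n"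
    and zero: "\<And>i j. r \<le> i \<Longrightarrow> i < n \<Longrightarrow> j < r \<Longrightarrow> A $$ (i, j) = 0"
  shows "char_poly A = char_poly (mat r r (\<lambda>(i, j). A $$ (i, j)))
    * char_poly (mat (n - r) (n - r) (\<lambda>(i, j). A $$ (i + r, j + r)))"
proof -
  let ?A1 = "mat r r (\<lambda>(i, j). A $$ (i, j))"
  let ?A4 = "mat (n - r) (n - r) (\<lambda>(i, j). A $$ (i + r, j + r))"
  let ?B = "mat r (n - r) (\<lambda>(i, j). [:- A $$ (i, j + r):])"
  have "char_poly_matrix A = four_block_mat (char_poly_matrix ?A1) ?B (0\<^sub>m (n - r) r) (char_poly_matrix ?A4)"
    using assms by (intro eq_matI) (auto simp: char_poly_matrix_def)
  thus ?thesis unfolding char_poly_def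
    by (simp add: det_four_block_mat_lower_left_zero[where n=r and m="n - r"])
qed

context matrix_rep
begin

lemma blocks_rep:
  assumes r: "r \<le> n" and zero: "\<And>g i j. g \<in> carrier G \<Longrightarrow> r \<le> i \<Longrightarrow> i < n \<Longrightarrow> j < r \<Longrightarrow> \<rho> g $$ (i, j) = 0"
  shows "matrix_rep G r (\<lambda>g. mat r r (\<lambda>(i, j). \<rho> g $$ (i, j)))"
    and "matrix_rep G (n - r) (\<lambda>g. mat (n - r) (n - r) (\<lambda>(i, j). \<rho> g $$ (i + r, j + r)))"
proof -
  have split: "\<rho> (g \<otimes> h) $$ (i, j) = (\<Sum>k<r. \<rho> g $$ (i, k) * \<rho> h $$ (k, j))
      + (\<Sum>k<n - r. \<rho> g $$ (i, k + r) * \<rho> h $$ (k + r, j))"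
    if "g \<in> carrier G" "h \<in> carrier G" "i < n" "j < n" for g h i j
  proof -
    have "\<rho> (g \<otimes> h) $$ (i, j) = (\<Sum>k<n. \<rho> g $$ (i, k) * \<rho> h $$ (k, j))"
      unfolding rep_mult[OF that(1,2)] by (rule mult_mat_index) (use that in auto)
    also have "{..<n} = {..<r} \<union> {r..<n}" using r by auto
    also have "(\<Sum>k\<in>{..<r} \<union> {r..<n}. \<rho> g $$ (i, k) * \<rho> h $$ (k, j))
      = (\<Sum>k<r. \<rho> g $$ (i, k) * \<rho> h $$ (k, j)) + (\<Sum>k\<in>{r..<n}. \<rho> g $$ (i, k) * \<rho> h $$ (k, j))"
      by (rule sum.union_disjoint) auto
    also have "(\<Sum>k\<in>{r..<n}. \<rho> g $$ (i, k) * \<rho> h $$ (k, j))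
      = (\<Sum>k<n - r. \<rho> g $$ (i, k + r) * \<rho> h $$ (k + r, j))"
      by (rule sum.reindex_bij_witness[of _ "\<lambda>k. k + r" "\<lambda>k. k - r"]) auto
    finally show ?thesis .
  qed
  show "matrix_rep G r (\<lambda>g. mat r r (\<lambda>(i, j). \<rho> g $$ (i, j)))"
  proof
    fix g h assume gh: "g \<in> carrier G" "h \<in> carrier G"
    show "mat r r (\<lambda>(i, j). \<rho> (g \<otimes> h) $$ (i, j))
      = mat r r (\<lambda>(i, j). \<rho> g $$ (i, j)) * mat r r (\<lambda>(i, j). \<rho> h $$ (i, j))"
    proof (rule eq_matI, goal_cases)
      case (1 i j)
      hence ij: "i < r" "j < r" by auto
      have "\<rho> (g \<otimes> h) $$ (i, j) = (\<Sum>k<r. \<rho> g $$ (i, k) * \<rho> h $$ (k, j))"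
        using ij r gh zero by (subst split) auto
      thus ?case using ij by (simp add: scalar_prod_def atLeast0LessThan)
    qed auto
  qed (use fin r in \<open>auto simp: rep_one\<close>)
  show "matrix_rep G (n - r) (\<lambda>g. mat (n - r) (n - r) (\<lambda>(i, j). \<rho> g $$ (i + r, j + r)))"
  proof
    fix g h assume gh: "g \<in> carrier G" "h \<in> carrier G"
    show "mat (n - r) (n - r) (\<lambda>(i, j). \<rho> (g \<otimes> h) $$ (i + r, j + r))
      = mat (n - r) (n - r) (\<lambda>(i, j). \<rho> g $$ (i + r, j + r))
        * mat (n - r) (n - r) (\<lambda>(i, j). \<rho> h $$ (i + r, j + r))"
    proof (rule eq_matI, goal_cases)
      case (1 i j)
      hence ij: "i < n - r" "j < n - r" by auto
      have "\<rho> (g \<otimes> h) $$ (i + r, j + r) = (\<Sum>k<n - r. \<rho> g $$ (i + r, k + r) * \<rho> h $$ (k + r, j + r))"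
        using ij r gh zero by (subst split) auto
      thus ?case using ij by (simp add: scalar_prod_def atLeast0LessThan)
    qed auto
  qed (use fin r in \<open>auto simp: rep_one\<close>)
qed

lemma trace_blocks:
  assumes "r \<le> n" "g \<in> carrier G"
  shows "mat_trace (\<rho> g) = mat_trace (mat r r (\<lambda>(i, j). \<rho> g $$ (i, j)))
    + mat_trace (mat (n - r) (n - r) (\<lambda>(i, j). \<rho> g $$ (i + r, j + r)))"
proof -
  have "mat_trace (\<rho> g) = (\<Sum>i\<in>{..<r} \<union> {r..<n}. \<rho> g $$ (i, i))"
    using assms by (subst mat_trace_carrier[of _ n]) (auto intro!: sum.cong)
  also have "\<dots> = (\<Sum>i<r. \<rho> g $$ (i, i)) + (\<Sum>i\<in>{r..<n}. \<rho> g $$ (i, i))"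
    by (rule sum.union_disjoint) auto
  also have "(\<Sum>i\<in>{r..<n}. \<rho> g $$ (i, i)) = (\<Sum>i<n - r. \<rho> g $$ (i + r, i + r))"
    by (rule sum.reindex_bij_witness[of _ "\<lambda>k. k + r" "\<lambda>k. k - r"]) auto
  finally show ?thesis by (simp add: mat_trace_def)
qed

end

section \<open>Eigenvalues of representations of abelian groups over splitting fields\<close>

text \<open>The list \<open>as\<close> consists of the eigenvalues of \<open>g\<close> with multiplicities. The traces of the powers of
  \<open>g\<close> are recorded with it, because the same block triangularisation gives all of this at once.\<close>

definition eigenvalue_list ::
  "('g, 'm) monoid_scheme \<Rightarrow> nat \<Rightarrow> ('g \<Rightarrow> 'a::field mat) \<Rightarrow> 'g \<Rightarrow> 'a list \<Rightarrow> bool" where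
  "eigenvalue_list G n \<rho> g as \<longleftrightarrow> length as = n \<and> char_poly (\<rho> g) = (\<Prod>a\<leftarrow>as. [:- a, 1:]) \<and>
     (\<forall>i::nat. mat_trace (\<rho> (g [^]\<^bsub>G\<^esub> i)) = (\<Sum>a\<leftarrow>as. a ^ i)) \<and>
     (\<forall>N::nat. g [^]\<^bsub>G\<^esub> N = \<one>\<^bsub>G\<^esub> \<longrightarrow> (\<forall>a\<in>set as. a ^ N = 1))"

lemma eigenvalue_list_trace:
  "eigenvalue_list G n \<rho> g as \<Longrightarrow> mat_trace (\<rho> (g [^]\<^bsub>G\<^esub> (i::nat))) = (\<Sum>a\<leftarrow>as. a ^ i)"
  by (simp add: eigenvalue_list_def)

lemma eigenvalue_list_root:
  "eigenvalue_list G n \<rho> g as \<Longrightarrow> a \<in> set as \<Longrightarrow> g [^]\<^bsub>G\<^esub> (N::nat) = \<one>\<^bsub>G\<^esub> \<Longrightarrow> a ^ N = 1"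
  by (simp add: eigenvalue_list_def)

lemma proots_prod_linear: "proots (\<Prod>a\<leftarrow>as. [:- a, 1:]) = mset (as :: 'a::idom list)"
proof (induction as)
  case (Cons a as)
  have "(\<Prod>a\<leftarrow>as. [:- a, 1:]) \<noteq> 0" by (auto simp: prod_list_zero_iff)
  hence "proots ([:- a, 1:] * (\<Prod>a\<leftarrow>as. [:- a, 1:])) = proots [:- a, 1:] + proots (\<Prod>a\<leftarrow>as. [:- a, 1:])"
    by (intro proots_mult) simp_all
  thus ?case using Cons by (simp del: mult_pCons_left)
qed simp

text \<open>An irreducible representation of an abelian group over a splitting field consists of scalar
  matrices, since the matrices of the group commute with each other. Otherwise an invariant subspace
  gives block triangular matrices, and the two diagonal blocks are representations of smaller degree.\<close>

lemma exists_eigenvalue_list: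
  fixes H :: "('g, 'm) monoid_scheme" and \<rho> :: "'g \<Rightarrow> 'a::field mat"
  assumes comm: "\<And>x y. x \<in> carrier H \<Longrightarrow> y \<in> carrier H \<Longrightarrow> x \<otimes>\<^bsub>H\<^esub> y = y \<otimes>\<^bsub>H\<^esub> x"
    and split: "splitting_field TYPE('a) H"
    and rep: "matrix_rep H n \<rho>" and g: "g \<in> carrier H"
  shows "\<exists>as. eigenvalue_list H n \<rho> g as"
  using rep
proof (induction n arbitrary: \<rho> rule: less_induct)
  case (less n)
  interpret matrix_rep H n \<rho> by fact
  have pow_closed: "g [^]\<^bsub>H\<^esub> i \<in> carrier H" for i :: nat using g by simp
  consider "n = 0" | "0 < n" "irreducible_rep H n \<rho>" | "0 < n" "\<not> irreducible_rep H n \<rho>" by auto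
  thus ?case
  proof cases
    case 1
    have "char_poly (\<rho> g) = 1" unfolding char_poly_def using rep_carrier[OF g] 1
      by (intro det_dim_zero char_poly_matrix_closed) simp
    moreover have "mat_trace (\<rho> (g [^]\<^bsub>H\<^esub> i)) = 0" for i :: nat
      using 1 pow_closed by (simp add: mat_trace_def)
    ultimately show ?thesis using 1 by (intro exI[of _ "[]"]) (simp add: eigenvalue_list_def)
  next
    case 2
    have "\<rho> g * \<rho> h = \<rho> h * \<rho> g" if "h \<in> carrier H" for h
      using comm[OF g that] g that by (simp add: rep_mult[symmetric])
    then obtain c where c: "\<rho> g = c \<cdot>\<^sub>m 1\<^sub>m n"
      using split 2 g unfolding splitting_field_def by (meson rep_carrier)
    have pow: "\<rho> (g [^]\<^bsub>H\<^esub> i) = c ^ i \<cdot>\<^sub>m 1\<^sub>m n" for i :: nat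
    proof (induction i)
      case 0
      show ?case by (simp add: rep_one) (intro eq_matI, auto)
    next
      case (Suc i)
      have "\<rho> (g [^]\<^bsub>H\<^esub> Suc i) = \<rho> (g [^]\<^bsub>H\<^esub> i) * \<rho> g" using g by (simp add: rep_mult)
      also have "\<dots> = c ^ Suc i \<cdot>\<^sub>m 1\<^sub>m n" unfolding Suc c
        by (subst square_mult_smult[where n=n]) (auto intro!: eq_matI)
      finally show ?case .
    qed
    have "char_poly (\<rho> g) = (\<Prod>a\<leftarrow>diag_mat (\<rho> g). [:- a, 1:])"
      by (rule char_poly_upper_triangular[of _ n]) (auto simp: c)
    also have "diag_mat (\<rho> g) = replicate n c"
      unfolding diag_mat_def c by (rule nth_equalityI) auto
    finally have "char_poly (\<rho> g) = (\<Prod>a\<leftarrow>replicate n c. [:- a, 1:])" .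
    moreover have "mat_trace (\<rho> (g [^]\<^bsub>H\<^esub> i)) = (\<Sum>a\<leftarrow>replicate n c. a ^ i)" for i :: nat
      unfolding pow by (simp add: mat_trace_smult[of _ n] sum_list_replicate)
    moreover have "c ^ N = 1" if "g [^]\<^bsub>H\<^esub> N = \<one>\<^bsub>H\<^esub>" for N :: nat
    proof -
      have "(c ^ N \<cdot>\<^sub>m 1\<^sub>m n) $$ (0, 0) = (1\<^sub>m n :: 'a mat) $$ (0, 0)"
        using pow[of N] that rep_one by simp
      thus ?thesis using 2 by simp
    qed
    ultimately show ?thesis by (intro exI[of _ "replicate n c"]) (simp add: eigenvalue_list_def)
  next
    case 3
    have "\<rho> \<in> hom H (GL TYPE('a) n)"
      using matrix_rep_iff_hom[OF group_axioms fin] less.prems by blast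
    then obtain W where W: "vec_subspace n W" "\<And>h v. h \<in> carrier H \<Longrightarrow> v \<in> W \<Longrightarrow> \<rho> h *\<^sub>v v \<in> W"
      "W \<noteq> {0\<^sub>v n}" "W \<noteq> carrier_vec n"
      using 3 unfolding irreducible_rep_def subspace_module_vec_iff by auto
    obtain r P Q where PQ: "0 < r" "r < n" "P \<in> carrier_mat n n" "Q \<in> carrier_mat n n"
      "P * Q = 1\<^sub>m n" "Q * P = 1\<^sub>m n" "\<And>j. j < r \<Longrightarrow> col P j \<in> W"
      "\<And>w i. w \<in> W \<Longrightarrow> r \<le> i \<Longrightarrow> i < n \<Longrightarrow> (Q *\<^sub>v w) $ i = 0"
      by (rule adapted_basis[OF W(1,3,4)]) (rule that)
    define \<tau> where "\<tau> h = Q * \<rho> h * P" for h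
    interpret T: matrix_rep H n \<tau>
      unfolding \<tau>_def using PQ by (intro conjugate_rep) auto
    have zero: "\<tau> h $$ (i, j) = 0" if "h \<in> carrier H" "r \<le> i" "i < n" "j < r" for h i j
    proof -
      have \<tau>h: "\<tau> h = Q * (\<rho> h * P)"
        unfolding \<tau>_def using that PQ by (intro square_assoc[where n=n]) auto
      have "\<tau> h $$ (i, j) = col (\<tau> h) j $ i" using that PQ by simp
      also have "col (\<tau> h) j = Q *\<^sub>v col (\<rho> h * P) j"
        unfolding \<tau>h using that PQ by (intro col_mult2[where nr=n and n=n and nc=n]) auto
      also have "col (\<rho> h * P) j = \<rho> h *\<^sub>v col P j"
        using that PQ by (intro col_mult2[where nr=n and n=n and nc=n]) auto
      also have "(Q *\<^sub>v (\<rho> h *\<^sub>v col P j)) $ i = 0"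
        using that PQ(7,8) W(2) by simp
      finally show ?thesis .
    qed
    let ?A = "\<lambda>h. mat r r (\<lambda>(i, j). \<tau> h $$ (i, j))"
    let ?D = "\<lambda>h. mat (n - r) (n - r) (\<lambda>(i, j). \<tau> h $$ (i + r, j + r))"
    have reps: "matrix_rep H r ?A" "matrix_rep H (n - r) ?D"
      using T.blocks_rep[of r] zero PQ by auto
    obtain as where as: "eigenvalue_list H r ?A g as" using less.IH[OF _ reps(1)] PQ by auto
    obtain bs where bs: "eigenvalue_list H (n - r) ?D g bs" using less.IH[OF _ reps(2)] PQ by auto
    have "similar_mat (\<tau> g) (\<rho> g)"
      unfolding \<tau>_def using PQ g by (intro similar_matI[of _ _ Q P n]) auto
    hence "char_poly (\<rho> g) = char_poly (\<tau> g)" by (simp add: char_poly_similar)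
    also have "\<dots> = char_poly (?A g) * char_poly (?D g)"
      using PQ g zero by (intro char_poly_block_triangular) auto
    finally have "char_poly (\<rho> g) = (\<Prod>a\<leftarrow>as @ bs. [:- a, 1:])"
      using as bs by (simp add: eigenvalue_list_def)
    moreover have "mat_trace (\<rho> (g [^]\<^bsub>H\<^esub> i)) = (\<Sum>a\<leftarrow>as @ bs. a ^ i)" for i :: nat
    proof -
      have "mat_trace (\<rho> (g [^]\<^bsub>H\<^esub> i)) = mat_trace (\<tau> (g [^]\<^bsub>H\<^esub> i))"
        unfolding \<tau>_def using PQ pow_closed by (intro mat_trace_conjugate[symmetric]) auto
      also have "\<dots> = mat_trace (?A (g [^]\<^bsub>H\<^esub> i)) + mat_trace (?D (g [^]\<^bsub>H\<^esub> i))"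
        using PQ pow_closed by (intro T.trace_blocks) auto
      also have "\<dots> = (\<Sum>a\<leftarrow>as @ bs. a ^ i)" using as bs by (simp add: eigenvalue_list_def)
      finally show ?thesis .
    qed
    ultimately have "eigenvalue_list H n \<rho> g (as @ bs)"
      using as bs PQ by (auto simp: eigenvalue_list_def)
    thus ?thesis ..
  qed
qed

section \<open>Integral representations\<close>

context p_modular_system
begin

text \<open>Take the vectors \<open>\<rho>(g) v\<close> of one orbit. Among the \<open>n\<close>-tuples of such vectors
  choose one whose determinant is nonzero and divides all the others; by Cramer's rule every vector of the
  orbit is an integral combination of this tuple, which is therefore a basis of an invariant lattice.\<close>

lemma exists_integral_form:
  fixes G :: "('g, 'm) monoid_scheme" and \<rho> :: "'g \<Rightarrow> 'k mat"
  assumes "abs_irr_rep G n \<rho>"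
  obtains \<tau> where "abs_irr_rep G n \<tau>" "character G \<tau> = character G \<rho>"
    "\<And>g. g \<in> carrier G \<Longrightarrow> \<tau> g \<in> red.mats n"
    "\<And>a. rep_extend G n \<rho> a = 1\<^sub>m n \<Longrightarrow> rep_extend G n \<tau> a = 1\<^sub>m n"
proof -
  interpret abs_irr_rep G n \<rho> by fact
  define v :: "'k vec" where "v = unit_vec n 0"
  define W where "W = (\<lambda>g. \<rho> g *\<^sub>v v) ` carrier G"
  have v: "v \<in> carrier_vec n" by (simp add: v_def)
  have Wc: "W \<subseteq> carrier_vec n"
    using v by (auto simp: W_def)
  have "finite W" using fin by (simp add: W_def)
  define F where "F = {P \<in> carrier_mat n n. \<forall>j<n. col P j \<in> W}"
  have "F \<subseteq> (\<lambda>f. mat n n (\<lambda>(i, j). f j $ i)) ` (PiE {..<n} (\<lambda>_. W))"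
  proof
    fix P assume P: "P \<in> F"
    have "P = mat n n (\<lambda>(i, j). (\<lambda>j\<in>{..<n}. col P j) j $ i)"
      using P by (intro eq_matI) (auto simp: F_def)
    moreover have "(\<lambda>j\<in>{..<n}. col P j) \<in> PiE {..<n} (\<lambda>_. W)"
      using P by (auto simp: F_def)
    ultimately show "P \<in> (\<lambda>f. mat n n (\<lambda>(i, j). f j $ i)) ` (PiE {..<n} (\<lambda>_. W))" by blast
  qed
  hence "finite F" by (rule finite_subset) (auto intro!: finite_PiE \<open>finite W\<close>)
  have "\<exists>P\<in>F. det P \<noteq> 0"
  proof -
    obtain r P Q where r: "r \<le> n" and P1: "P \<in> carrier_mat n n"
      and Q: "Q \<in> carrier_mat n n" "P * Q = 1\<^sub>m n" "Q * P = 1\<^sub>m n"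
      and P2: "\<And>j. j < r \<Longrightarrow> col P j \<in> W"
      and van: "\<And>w i. w \<in> W \<Longrightarrow> r \<le> i \<Longrightarrow> i < n \<Longrightarrow> (Q *\<^sub>v w) $ i = 0"
      by (rule maximal_partial_basis[OF Wc]) (rule that)
    note P = P1 P2
    have "r = n"
    proof (rule ccontr)
      assume "r \<noteq> n"
      hence r: "r < n" using r by simp
      \<comment> \<open>\<open>M\<close> maps \<open>v\<close> to the column \<open>r\<close> of \<open>P\<close>, and it is a combination of the matrices of
        the group elements. So its coordinate \<open>r\<close> with respect to \<open>P\<close>, which is \<open>1\<close>, would have to vanish.\<close>
      define M where "M = P * mat_unit n r 0"
      have M: "M \<in> carrier_mat n n" using P by (simp add: M_def)
      have "(Q * M) $$ (r, 0) = (Q * ext (fourier_inverse M)) $$ (r, 0)"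
        using ext_fourier_inverse[OF M] by simp
      also have "\<dots> = mat_sum n (\<lambda>g. Q * (fourier_inverse M g \<cdot>\<^sub>m \<rho> g)) (carrier G) $$ (r, 0)"
        unfolding ext_eq_mat_sum using Q by (subst mult_mat_sum) auto
      also have "\<dots> = (\<Sum>g\<in>carrier G. (Q * (fourier_inverse M g \<cdot>\<^sub>m \<rho> g)) $$ (r, 0))"
        using r n_pos by (simp add: mat_sum_index)
      also have "\<dots> = 0"
      proof (rule sum.neutral, rule ballI)
        fix g assume g: "g \<in> carrier G"
        have "\<rho> g *\<^sub>v v = col (\<rho> g) 0" using g n_pos by (simp add: v_def mult_unit_vec)
        moreover have "\<rho> g *\<^sub>v v \<in> W" using g by (auto simp: W_def)
        ultimately have "(Q *\<^sub>v col (\<rho> g) 0) $ r = 0" using van[of "\<rho> g *\<^sub>v v" r] r by simp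
        moreover have "(Q * (fourier_inverse M g \<cdot>\<^sub>m \<rho> g)) $$ (r, 0) = fourier_inverse M g * (Q *\<^sub>v col (\<rho> g) 0) $ r"
          using g r n_pos Q mult_smult_distrib[OF Q(1) rep_carrier[OF g], of "fourier_inverse M g"] by simp
        ultimately show "(Q * (fourier_inverse M g \<cdot>\<^sub>m \<rho> g)) $$ (r, 0) = 0" by simp
      qed
      also have "Q * M = mat_unit n r 0"
        unfolding M_def using P Q by (simp add: square_assoc[symmetric, where n=n] left_mult_one_mat[where nr=n and nc=n])
      finally show False using r n_pos by (simp add: mat_unit_def)
    qed
    moreover have "det P \<noteq> 0"
      using det_mult[OF P(1) Q(1)] Q by auto
    ultimately show ?thesis using P by (auto simp: F_def)
  qed
  then obtain d where d: "d \<in> det ` F" "d \<noteq> 0" "\<And>b. b \<in> det ` F \<Longrightarrow> b / d \<in> \<O>"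
    using \<open>finite F\<close> by (elim exists_dividing_all[of "det ` F", rotated 2]) auto
  then obtain P where P: "P \<in> F" "det P \<noteq> 0" "\<And>P'. P' \<in> F \<Longrightarrow> det P' / det P \<in> \<O>" by auto
  hence Pc: "P \<in> carrier_mat n n" and cols: "\<And>j. j < n \<Longrightarrow> col P j \<in> W" by (auto simp: F_def)
  obtain Q where Q: "Q \<in> carrier_mat n n" "P * Q = 1\<^sub>m n" "Q * P = 1\<^sub>m n"
    using det_nonzero_inverse[OF Pc P(2)] by blast
  have integral: "(Q *\<^sub>v w) $ i \<in> \<O>" if w: "w \<in> W" and i: "i < n" for w i
  proof -
    have wc: "w \<in> carrier_vec n" using w Wc by auto
    have "w = P *\<^sub>v (Q *\<^sub>v w)" using Pc Q wc by (simp add: assoc_mult_mat_vec[symmetric])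
    hence "det (replace_col P w i) = (Q *\<^sub>v w) $ i * det P"
      using cramer_lemma_mat[OF Pc, of "Q *\<^sub>v w" i] Q wc i by auto
    moreover have "replace_col P w i \<in> F"
      unfolding F_def
    proof (safe)
      show "replace_col P w i \<in> carrier_mat n n" using Pc by (simp add: replace_col_def)
      fix j assume j: "j < n"
      have "col (replace_col P w i) j = (if j = i then w else col P j)"
        using j Pc wc by (intro eq_vecI) (auto simp: replace_col_def)
      thus "col (replace_col P w i) j \<in> W" using w cols j by simp
    qed
    ultimately show ?thesis using P(2) P(3)[of "replace_col P w i"] by simp
  qed
  define \<tau> where "\<tau> g = Q * \<rho> g * P" for g
  interpret T: matrix_rep G n \<tau> unfolding \<tau>_def using Pc Q by (intro conjugate_rep) auto
  have "abs_irr_rep G n \<tau>"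
  proof
    fix M assume M: "M \<in> carrier_mat n n" "\<And>g. g \<in> carrier G \<Longrightarrow> M * \<tau> g = \<tau> g * M"
    have "(P * M * Q) * \<rho> g = \<rho> g * (P * M * Q)" if g: "g \<in> carrier G" for g
    proof -
      have "P * M * Q * \<rho> g = P * (M * (Q * \<rho> g * P)) * Q" using M Pc Q g by (simp add: square_assoc[where n=n])
      also have "\<dots> = P * (Q * \<rho> g * P * M) * Q" using M(2)[OF g] by (simp add: \<tau>_def)
      also have "\<dots> = (P * Q) * (\<rho> g * (P * (M * Q)))" using M(1) Pc Q(1) g by (simp add: square_assoc[where n=n])
      also have "\<dots> = \<rho> g * (P * M * Q)" unfolding Q(2) using M(1) Pc Q(1) g by (simp add: square_assoc[where n=n])
      finally show ?thesis .
    qed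
    then obtain c where c: "P * M * Q = c \<cdot>\<^sub>m 1\<^sub>m n"
      using commutant_scalar[of "P * M * Q"] M(1) Pc Q by auto
    have "M = (Q * P) * M * (Q * P)" using M(1) Q by simp
    also have "\<dots> = Q * (P * M * Q) * P" using M(1) Pc Q(1) by (simp add: square_assoc[where n=n])
    also have "\<dots> = c \<cdot>\<^sub>m (Q * P)" unfolding c
      using Pc Q(1) by (simp add: square_mult_smult[where n=n] square_smult_mult[where n=n])
    finally show "\<exists>c. M = c \<cdot>\<^sub>m 1\<^sub>m n" using Q by auto
  qed (rule n_pos)
  moreover have "character G \<tau> = character G \<rho>"
    unfolding character_def \<tau>_def
    using Pc Q by (intro restrict_ext mat_trace_conjugate) auto
  moreover have "\<tau> g \<in> red.mats n" if g: "g \<in> carrier G" for g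
  proof (rule red.matsI)
    fix i j assume ij: "i < n" "j < n"
    obtain h where h: "h \<in> carrier G" "col P j = \<rho> h *\<^sub>v v" using cols[OF ij(2)] by (auto simp: W_def)
    have "\<tau> g = Q * (\<rho> g * P)" using Pc Q g by (simp add: \<tau>_def square_assoc[where n=n])
    hence "\<tau> g $$ (i, j) = (Q *\<^sub>v col (\<rho> g * P) j) $ i" using Pc Q g ij by simp
    also have "col (\<rho> g * P) j = \<rho> g *\<^sub>v (\<rho> h *\<^sub>v v)"
      using Pc g ij h by (subst col_mult2[where nr=n and n=n and nc=n]) auto
    also have "\<dots> = \<rho> (g \<otimes>\<^bsub>G\<^esub> h) *\<^sub>v v"
      using g h v by (simp add: rep_mult square_assoc_vec[where n=n])
    finally show "\<tau> g $$ (i, j) \<in> \<O>" using integral[of "\<rho> (g \<otimes>\<^bsub>G\<^esub> h) *\<^sub>v v" i] g h ij by (simp add: W_def)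
  qed (use g in simp)
  moreover have "rep_extend G n \<tau> a = 1\<^sub>m n" if "ext a = 1\<^sub>m n" for a
  proof -
    have "T.ext a = mat_sum n (\<lambda>g. Q * (a g \<cdot>\<^sub>m \<rho> g) * P) (carrier G)"
      unfolding T.ext_eq_mat_sum \<tau>_def using Pc Q(1)
      by (intro mat_sum_cong) (simp add: square_mult_smult[where n=n] square_smult_mult[where n=n])
    also have "\<dots> = Q * ext a * P"
      unfolding ext_eq_mat_sum using Pc Q(1) by (subst mult_mat_sum, auto, subst mat_sum_mult, auto)
    also have "\<dots> = 1\<^sub>m n" using that Pc Q by simp
    finally show ?thesis .
  qed
  ultimately show ?thesis using that by blast
qed

end

section \<open>Burnside's theorem on matrix algebras\<close>

text \<open>Induction on the family. If some \<open>m0\<close> is orthogonal to the vectors with index in \<open>A\<close> but not to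
  \<open>F h\<close>, then the right multiple of \<open>F h\<close> is subtracted from \<open>t\<close>; if there is none, \<open>h\<close> can be dropped.\<close>

lemma in_span_if_annihilated:
  fixes F :: "'g \<Rightarrow> 'i \<Rightarrow> 'a::field"
  assumes "finite A" "finite I"
    and "\<And>m. (\<And>g. g \<in> A \<Longrightarrow> (\<Sum>i\<in>I. F g i * m i) = 0) \<Longrightarrow> (\<Sum>i\<in>I. t i * m i) = 0"
  shows "\<exists>a. \<forall>i\<in>I. t i = (\<Sum>g\<in>A. a g * F g i)"
  using assms(1,3)
proof (induction A arbitrary: t rule: finite_induct)
  case empty
  have "t i = 0" if "i \<in> I" for i
  proof -
    have "(\<Sum>j\<in>I. t j * (if j = i then 1 else 0)) = (\<Sum>j\<in>I. if j = i then t j else 0)"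
      by (rule sum.cong) auto
    thus ?thesis using empty.prems[of "\<lambda>j. if j = i then 1 else 0"] that assms(2)
      by (simp add: sum.delta)
  qed
  thus ?case by simp
next
  case (insert h A)
  show ?case
  proof (cases "\<exists>m. (\<forall>g\<in>A. (\<Sum>i\<in>I. F g i * m i) = 0) \<and> (\<Sum>i\<in>I. F h i * m i) \<noteq> 0")
    case False
    have "\<exists>a. \<forall>i\<in>I. t i = (\<Sum>g\<in>A. a g * F g i)"
    proof (rule insert.IH, rule insert.prems)
      fix m g assume m: "\<And>g. g \<in> A \<Longrightarrow> (\<Sum>i\<in>I. F g i * m i) = 0" and g: "g \<in> insert h A"
      have "(\<Sum>i\<in>I. F h i * m i) = 0" using False m by blast
      thus "(\<Sum>i\<in>I. F g i * m i) = 0" using m g by auto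
    qed
    then obtain a where a: "\<forall>i\<in>I. t i = (\<Sum>g\<in>A. a g * F g i)" ..
    have "(\<Sum>g\<in>insert h A. (a(h := 0)) g * F g i) = (\<Sum>g\<in>A. a g * F g i)" for i
      using insert.hyps by (simp, intro sum.cong) auto
    hence "\<forall>i\<in>I. t i = (\<Sum>g\<in>insert h A. (a(h := 0)) g * F g i)" using a by simp
    thus ?thesis by blast
  next
    case True
    then obtain m0 where m0: "\<forall>g\<in>A. (\<Sum>i\<in>I. F g i * m0 i) = 0" "(\<Sum>i\<in>I. F h i * m0 i) \<noteq> 0" by blast
    \<comment> \<open>Subtract from \<open>t\<close> the multiple of \<open>F h\<close> that makes it vanish at \<open>m0\<close>.\<close>
    define s where "s = (\<Sum>i\<in>I. F h i * m0 i)"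
    define \<alpha> where "\<alpha> = (\<Sum>i\<in>I. t i * m0 i) / s"
    have "(\<Sum>i\<in>I. (t i - \<alpha> * F h i) * m i) = 0"
      if m: "\<And>g. g \<in> A \<Longrightarrow> (\<Sum>i\<in>I. F g i * m i) = 0" for m
    proof -
      define \<beta> where "\<beta> = (\<Sum>i\<in>I. F h i * m i) / s"
      have lin: "(\<Sum>i\<in>I. f i * (m i - \<beta> * m0 i)) = (\<Sum>i\<in>I. f i * m i) - \<beta> * (\<Sum>i\<in>I. f i * m0 i)" for f
        by (simp add: algebra_simps sum_subtractf sum_distrib_left)
      have "(\<Sum>i\<in>I. t i * (m i - \<beta> * m0 i)) = 0"
      proof (rule insert.prems)
        fix g assume "g \<in> insert h A"
        hence "(\<Sum>i\<in>I. F g i * m i) = \<beta> * (\<Sum>i\<in>I. F g i * m0 i)"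
          using m m0 by (auto simp: \<beta>_def s_def)
        thus "(\<Sum>i\<in>I. F g i * (m i - \<beta> * m0 i)) = 0" by (simp add: lin)
      qed
      hence "(\<Sum>i\<in>I. t i * m i) = \<beta> * (\<Sum>i\<in>I. t i * m0 i)" by (simp add: lin)
      also have "\<dots> = \<alpha> * (\<Sum>i\<in>I. F h i * m i)" by (simp add: \<alpha>_def \<beta>_def)
      finally show ?thesis by (simp add: algebra_simps sum_subtractf sum_distrib_left)
    qed
    then obtain a where a: "\<forall>i\<in>I. t i - \<alpha> * F h i = (\<Sum>g\<in>A. a g * F g i)"
      using insert.IH[of "\<lambda>i. t i - \<alpha> * F h i"] by blast
    have "(\<Sum>g\<in>insert h A. (a(h := \<alpha>)) g * F g i) = \<alpha> * F h i + (\<Sum>g\<in>A. a g * F g i)" for i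
      using insert.hyps by (simp, intro sum.cong) auto
    hence "\<forall>i\<in>I. t i = (\<Sum>g\<in>insert h A. (a(h := \<alpha>)) g * F g i)"
      using a by (simp add: diff_eq_eq add.commute)
    thus ?thesis by blast
  qed
qed

lemma mat_eq_if_mult_vec_eq:
  fixes A B :: "'a::field mat"
  assumes "A \<in> carrier_mat n n" "B \<in> carrier_mat n n"
    "\<And>v. v \<in> carrier_vec n \<Longrightarrow> A *\<^sub>v v = B *\<^sub>v v"
  shows "A = B"
proof (rule eq_matI)
  fix i j assume "i < dim_row B" "j < dim_col B"
  hence ij: "i < n" "j < n" using assms by auto
  have "col A j = col B j"
    using assms(3)[of "unit_vec n j"] mult_unit_vec[OF assms(1) ij(2)] mult_unit_vec[OF assms(2) ij(2)]
    by simp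
  hence "col A j $ i = col B j $ i" by simp
  thus "A $$ (i, j) = B $$ (i, j)" using assms(1,2) ij by simp
qed (use assms in auto)

locale irreducible_scalar_rep = scalar_commutant_rep +
  assumes irred: "irreducible_rep G n \<rho>"
begin

lemma rep_mult_ext:
  assumes "g \<in> carrier G"
  shows "\<rho> g * ext a = ext ((\<lambda>x. if x = g then 1 else 0) \<otimes>\<^bsub>group_algebra G UNIV\<^esub> a)"
  using assms by (simp add: ext_mult ext_single)

text \<open>The vectors \<open>a v\<close> form a nonzero invariant subspace.\<close>

lemma orbit_spans:
  assumes v: "v \<in> carrier_vec n" "v \<noteq> 0\<^sub>v n" and w: "w \<in> carrier_vec n"
  obtains a where "ext a *\<^sub>v v = w"
proof -
  define W where "W = {ext a *\<^sub>v v |a. True}"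
  have one: "ext (\<lambda>x. if x = \<one> then 1 else 0) = 1\<^sub>m n" by (simp add: ext_single rep_one)
  have "vec_subspace n W"
    unfolding vec_subspace_def
  proof (intro conjI ballI allI)
    show "W \<subseteq> carrier_vec n" using v by (auto simp: W_def)
    have "ext (\<lambda>_. 0) *\<^sub>v v = 0\<^sub>v n" using v by (intro eq_vecI) (auto simp: rep_extend_def scalar_prod_def)
    hence "0\<^sub>v n = ext (\<lambda>_. 0) *\<^sub>v v" ..
    thus "0\<^sub>v n \<in> W" unfolding W_def by blast
    fix x y assume "x \<in> W" "y \<in> W"
    then obtain a b where "x = ext a *\<^sub>v v" "y = ext b *\<^sub>v v" by (auto simp: W_def)
    hence "x + y = ext (\<lambda>g. a g + b g) *\<^sub>v v"
      using v by (simp add: ext_add add_mult_distrib_mat_vec[where nr=n and nc=n])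
    thus "x + y \<in> W" by (auto simp: W_def)
  next
    fix c x assume "x \<in> W"
    then obtain a where "x = ext a *\<^sub>v v" by (auto simp: W_def)
    hence "c \<cdot>\<^sub>v x = ext (\<lambda>g. c * a g) *\<^sub>v v"
      using v by (simp add: ext_smult smult_mat_mult_vec[where n=n])
    thus "c \<cdot>\<^sub>v x \<in> W" by (auto simp: W_def)
  qed
  moreover have "\<rho> g *\<^sub>v x \<in> W" if g: "g \<in> carrier G" and x: "x \<in> W" for g x
  proof -
    obtain a where "x = ext a *\<^sub>v v" using x by (auto simp: W_def)
    hence "\<rho> g *\<^sub>v x = (\<rho> g * ext a) *\<^sub>v v"
      using v g by (simp add: square_assoc_vec[where n=n])
    thus ?thesis using rep_mult_ext[OF g] by (auto simp: W_def)
  qed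
  ultimately have "W = {0\<^sub>v n} \<or> W = carrier_vec n"
    using irred unfolding irreducible_rep_def subspace_module_vec_iff by simp
  moreover have "v = ext (\<lambda>x. if x = \<one> then 1 else 0) *\<^sub>v v" using one v by simp
  hence "v \<in> W" unfolding W_def by blast
  ultimately have "w \<in> W" using v w by auto
  thus ?thesis using that by (auto simp: W_def)
qed

lemma ext_lincomb_mult_vec:
  assumes y: "y \<in> carrier_vec n" and i: "i < n"
  shows "(ext (\<lambda>g. \<Sum>l<n. c l * a l g) *\<^sub>v y) $ i = (\<Sum>l<n. c l * (ext (a l) *\<^sub>v y) $ i)"
proof -
  have "(ext (\<lambda>g. \<Sum>l<n. c l * a l g) *\<^sub>v y) $ i = (\<Sum>j<n. (\<Sum>l<n. c l * ext (a l) $$ (i, j)) * y $ j)"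
    using y i by (simp add: scalar_prod_def atLeast0LessThan ext_lincomb_index)
  also have "\<dots> = (\<Sum>j<n. \<Sum>l<n. c l * (ext (a l) $$ (i, j) * y $ j))"
    by (simp add: sum_distrib_right mult.assoc)
  also have "\<dots> = (\<Sum>l<n. \<Sum>j<n. c l * (ext (a l) $$ (i, j) * y $ j))" by (rule sum.swap)
  also have "\<dots> = (\<Sum>l<n. c l * (ext (a l) *\<^sub>v y) $ i)"
    using y i by (simp add: scalar_prod_def atLeast0LessThan sum_distrib_left)
  finally show ?thesis .
qed

text \<open>If every element of the algebra that kills \<open>x\<close> also kills \<open>y\<close>, then \<open>a x \<mapsto> a y\<close> is a
  well-defined endomorphism, hence a scalar.\<close>

lemma multiple_if_annihilated:
  assumes x: "x \<in> carrier_vec n" "x \<noteq> 0\<^sub>v n" and y: "y \<in> carrier_vec n"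
    and ann: "\<And>a. ext a *\<^sub>v x = 0\<^sub>v n \<Longrightarrow> ext a *\<^sub>v y = 0\<^sub>v n"
  obtains c where "y = c \<cdot>\<^sub>v x"
proof -
  have "\<exists>a. ext a *\<^sub>v x = unit_vec n l" for l by (rule orbit_spans[OF x unit_vec_carrier]) blast
  then obtain a where a: "\<And>l. ext (a l) *\<^sub>v x = unit_vec n l" by metis
  \<comment> \<open>The matrix of the endomorphism \<open>b x \<mapsto> b y\<close>.\<close>
  define T where "T = mat n n (\<lambda>(i, l). (ext (a l) *\<^sub>v y) $ i)"
  have T: "T \<in> carrier_mat n n" by (simp add: T_def)
  have wd: "T *\<^sub>v (ext b *\<^sub>v x) = ext b *\<^sub>v y" for b
  proof -
    define w where "w = ext b *\<^sub>v x"
    have w: "w \<in> carrier_vec n" using x by (auto simp: w_def)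
    define b' where "b' = (\<lambda>g. \<Sum>l<n. w $ l * a l g)"
    have "ext b' *\<^sub>v x = w"
    proof (rule eq_vecI)
      fix i assume "i < dim_vec w"
      hence i: "i < n" using w by simp
      have "(\<Sum>l<n. w $ l * unit_vec n l $ i) = (\<Sum>l<n. if l = i then w $ l else 0)"
        using i by (intro sum.cong) (auto simp: unit_vec_def)
      thus "(ext b' *\<^sub>v x) $ i = w $ i"
        unfolding b'_def ext_lincomb_mult_vec[OF x(1) i] a using i by (simp add: sum.delta)
    qed (use w in auto)
    moreover have "ext b' *\<^sub>v y = T *\<^sub>v w"
    proof (rule eq_vecI)
      fix i assume "i < dim_vec (T *\<^sub>v w)"
      hence i: "i < n" using T by simp
      thus "(ext b' *\<^sub>v y) $ i = (T *\<^sub>v w) $ i"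
        unfolding b'_def ext_lincomb_mult_vec[OF y i] using w
        by (simp add: T_def scalar_prod_def atLeast0LessThan mult.commute)
    qed (simp add: T_def)
    moreover have "ext (\<lambda>g. b' g + (- 1) * b g) *\<^sub>v z = ext b' *\<^sub>v z + (- 1) \<cdot>\<^sub>v (ext b *\<^sub>v z)"
      if "z \<in> carrier_vec n" for z
      unfolding ext_add ext_smult[of "- 1"] using that
      by (simp add: add_mult_distrib_mat_vec[where nr=n and nc=n] smult_mat_mult_vec[where n=n])
    moreover have "w + (- 1) \<cdot>\<^sub>v w = 0\<^sub>v n" using w by (intro eq_vecI) auto
    ultimately have "T *\<^sub>v w + (- 1) \<cdot>\<^sub>v (ext b *\<^sub>v y) = 0\<^sub>v n"
      using ann[of "\<lambda>g. b' g + (- 1) * b g"] x(1) y by (simp add: w_def)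
    hence "(T *\<^sub>v w + (- 1) \<cdot>\<^sub>v (ext b *\<^sub>v y)) $ i = 0" if "i < n" for i using that by simp
    thus ?thesis unfolding w_def[symmetric] using T y w
      by (intro eq_vecI) auto
  qed
  have "T * \<rho> g = \<rho> g * T" if g: "g \<in> carrier G" for g
  proof (rule mat_eq_if_mult_vec_eq)
    fix v :: "'c vec" assume v: "v \<in> carrier_vec n"
    obtain b where b: "ext b *\<^sub>v x = v" using orbit_spans[OF x v] .
    let ?gb = "(\<lambda>x. if x = g then 1 else 0) \<otimes>\<^bsub>group_algebra G UNIV\<^esub> b"
    have "(T * \<rho> g) *\<^sub>v v = T *\<^sub>v ((\<rho> g * ext b) *\<^sub>v x)"
      using T g x unfolding b[symmetric]
      by (simp add: square_assoc_vec[where n=n])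
    also have "\<dots> = (\<rho> g * ext b) *\<^sub>v y" unfolding rep_mult_ext[OF g] by (rule wd)
    also have "\<dots> = \<rho> g *\<^sub>v (ext b *\<^sub>v y)" using g y
      by (simp add: square_assoc_vec[where n=n])
    also have "\<dots> = (\<rho> g * T) *\<^sub>v v" using g T v
      by (simp add: square_assoc_vec[where n=n] wd[symmetric] b)
    finally show "(T * \<rho> g) *\<^sub>v v = (\<rho> g * T) *\<^sub>v v" .
  qed (use T g in auto)
  then obtain c where c: "T = c \<cdot>\<^sub>m 1\<^sub>m n" using commutant_scalar[OF T] by blast
  have "ext (\<lambda>x. if x = \<one> then 1 else 0) = 1\<^sub>m n" by (simp add: ext_single rep_one)
  hence "y = T *\<^sub>v x" using wd[of "\<lambda>x. if x = \<one> then 1 else 0"] x y by simp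
  hence "y = c \<cdot>\<^sub>v x" using x by (simp add: c smult_mat_mult_vec[where n=n])
  thus ?thesis using that by blast
qed

text \<open>The matrices orthogonal to the algebra under the trace form are a left module over it. A nonzero
  member \<open>X\<close> with the least number of nonzero columns has proportional columns: an algebra element
  that kills one nonzero column of \<open>X\<close> kills \<open>X\<close>, by minimality. So \<open>X = x c\<^sup>T\<close>, where \<open>x\<close> is the
  nonzero column with index \<open>i\<close> and \<open>c i = 1\<close>. If \<open>a x\<close> is the unit vector with index \<open>i\<close>, then
  \<open>a X\<close> has trace \<open>c i = 1\<close>, contrary to the choice of \<open>X\<close>.\<close>

lemma trace_annihilator_trivial:
  assumes M: "M \<in> carrier_mat n n" "\<And>g. g \<in> carrier G \<Longrightarrow> mat_trace (\<rho> g * M) = 0"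
  shows "M = 0\<^sub>m n n"
proof (rule ccontr)
  assume "M \<noteq> 0\<^sub>m n n"
  define U where "U = {X \<in> carrier_mat n n. X \<noteq> 0\<^sub>m n n \<and> (\<forall>a. mat_trace (ext a * X) = 0)}"
  define nz where "nz X = {j. j < n \<and> col X j \<noteq> 0\<^sub>v n}" for X :: "'c mat"
  have "M \<in> U" using M \<open>M \<noteq> _\<close> by (auto simp: U_def mat_trace_ext_mult)
  define X where "X = arg_min (\<lambda>X. card (nz X)) (\<lambda>X. X \<in> U)"
  have XU: "X \<in> U" unfolding X_def by (rule arg_min_natI[where P = "\<lambda>X. X \<in> U"], rule \<open>M \<in> U\<close>)
  have min: "card (nz X) \<le> card (nz Y)" if "Y \<in> U" for Y
    unfolding X_def by (rule arg_min_nat_le[where P = "\<lambda>X. X \<in> U"], rule that)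
  have X: "X \<in> carrier_mat n n" "X \<noteq> 0\<^sub>m n n" and tr: "\<And>a. mat_trace (ext a * X) = 0"
    using XU by (auto simp: U_def)
  have "\<exists>i<n. col X i \<noteq> 0\<^sub>v n"
  proof (rule ccontr)
    assume "\<not> (\<exists>i<n. col X i \<noteq> 0\<^sub>v n)"
    hence "X = 0\<^sub>m n n" using X by (intro mat_col_eqI) auto
    thus False using X by simp
  qed
  then obtain i where i: "i < n" "col X i \<noteq> 0\<^sub>v n" by blast
  have xi: "col X i \<in> carrier_vec n" using X by auto
  have colm: "col (ext a * X) j = ext a *\<^sub>v col X j" if "j < n" for a j
    using X that by (intro col_mult2[where nr=n and n=n and nc=n]) auto
  have "\<exists>c. col X j = c \<cdot>\<^sub>v col X i" if j: "j < n" for j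
  proof -
    have "ext a *\<^sub>v col X j = 0\<^sub>v n" if a: "ext a *\<^sub>v col X i = 0\<^sub>v n" for a
    proof (rule ccontr)
      assume ne: "ext a *\<^sub>v col X j \<noteq> 0\<^sub>v n"
      have "ext a * X \<noteq> 0\<^sub>m n n"
      proof
        assume "ext a * X = 0\<^sub>m n n"
        hence "col (0\<^sub>m n n) j = ext a *\<^sub>v col X j" using colm[OF j, of a] by simp
        thus False using ne j by simp
      qed
      moreover have "mat_trace (ext b * (ext a * X)) = 0" for b
        using tr[of "b \<otimes>\<^bsub>group_algebra G UNIV\<^esub> a"] X
        by (simp add: ext_mult square_assoc[where n=n])
      ultimately have "ext a * X \<in> U" using X by (auto simp: U_def)
      hence "card (nz X) \<le> card (nz (ext a * X))" by (rule min)
      moreover have "nz (ext a * X) \<subset> nz X"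
      proof
        have "ext a *\<^sub>v 0\<^sub>v n = 0\<^sub>v n" by (intro eq_vecI) (auto simp: scalar_prod_def)
        thus "nz (ext a * X) \<subseteq> nz X" by (auto simp: nz_def colm)
        show "nz (ext a * X) \<noteq> nz X" using i a colm[OF i(1), of a] by (auto simp: nz_def)
      qed
      ultimately show False using psubset_card_mono[of "nz X" "nz (ext a * X)"] by (simp add: nz_def)
    qed
    moreover have "col X j \<in> carrier_vec n" using X by auto
    ultimately obtain c where "col X j = c \<cdot>\<^sub>v col X i"
      using multiple_if_annihilated[OF xi i(2)] by blast
    thus ?thesis by blast
  qed
  then obtain c where c: "\<And>j. j < n \<Longrightarrow> col X j = c j \<cdot>\<^sub>v col X i" by metis
  obtain a where a: "ext a *\<^sub>v col X i = unit_vec n i" by (rule orbit_spans[OF xi i(2) unit_vec_carrier])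
  have "mat_trace (ext a * X) = (\<Sum>j<n. col (ext a * X) j $ j)"
    using X by (subst mat_trace_carrier[of _ n]) (auto intro!: sum.cong)
  also have "\<dots> = (\<Sum>j<n. if j = i then c j else 0)"
  proof (rule sum.cong[OF refl])
    fix j assume "j \<in> {..<n}"
    hence "col (ext a * X) j = c j \<cdot>\<^sub>v (ext a *\<^sub>v col X i)"
      using colm[of j a] c[of j] mult_mat_vec[OF ext_carrier xi] by simp
    thus "col (ext a * X) j $ j = (if j = i then c j else 0)"
      using \<open>j \<in> _\<close> i unfolding a by (auto simp: unit_vec_def)
  qed
  also have "\<dots> = c i" using i by (simp add: sum.delta)
  finally have "c i = 0" using tr by simp
  hence "col X i = 0 \<cdot>\<^sub>v col X i" using c[OF i(1)] by simp
  also have "\<dots> = 0\<^sub>v n" using X i by (intro eq_vecI) auto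
  finally show False using i by simp
qed

text \<open>Burnside's theorem: the span of the group is the full matrix algebra, since its orthogonal space
  is zero.\<close>

theorem burnside_mat_unit:
  assumes "k < n" "l < n"
  obtains a where "ext a = mat_unit n k l"
proof -
  have "\<exists>a. \<forall>x\<in>{..<n} \<times> {..<n}. mat_unit n k l $$ x = (\<Sum>g\<in>carrier G. a g * \<rho> g $$ x)"
  proof (rule in_span_if_annihilated)
    fix m assume m: "\<And>g. g \<in> carrier G \<Longrightarrow> (\<Sum>x\<in>{..<n} \<times> {..<n}. \<rho> g $$ x * m x) = 0"
    define M where "M = mat n n (\<lambda>(j, i). m (i, j))"
    have "mat_trace (\<rho> g * M) = 0" if "g \<in> carrier G" for g
    proof -
      have "mat_trace (\<rho> g * M) = (\<Sum>i<n. \<Sum>j<n. \<rho> g $$ (i, j) * M $$ (j, i))"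
        using that by (intro mat_trace_mult) (auto simp: M_def)
      also have "\<dots> = (\<Sum>x\<in>{..<n} \<times> {..<n}. \<rho> g $$ x * m x)"
        by (subst sum.cartesian_product) (auto simp: M_def intro!: sum.cong)
      finally show ?thesis using m that by simp
    qed
    hence M0: "M = 0\<^sub>m n n" by (intro trace_annihilator_trivial) (auto simp: M_def)
    have "m (i, j) = 0" if "i < n" "j < n" for i j
    proof -
      have "m (i, j) = M $$ (j, i)" using that by (simp add: M_def)
      thus ?thesis using M0 that by simp
    qed
    thus "(\<Sum>x\<in>{..<n} \<times> {..<n}. mat_unit n k l $$ x * m x) = 0" by (intro sum.neutral) auto
  qed (use fin in auto)
  then obtain a where a: "\<forall>x\<in>{..<n} \<times> {..<n}. mat_unit n k l $$ x = (\<Sum>g\<in>carrier G. a g * \<rho> g $$ x)" ..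
  have "ext a = mat_unit n k l"
    using a by (intro eq_matI) (auto simp: ext_index mat_unit_def)
  thus ?thesis by (rule that)
qed

end

section \<open>Eigenvalues in modular systems\<close>

lemma (in matrix_rep) restrict_rep:
  assumes "subgroup H G"
  shows "matrix_rep (G\<lparr>carrier := H\<rparr>) n \<rho>"
proof -
  interpret H: group "G\<lparr>carrier := H\<rparr>" by (rule subgroup.subgroup_is_group[OF assms group_axioms])
  have "H \<subseteq> carrier G" using assms by (rule subgroup.subset)
  thus ?thesis using fin rep_mult rep_one
    by unfold_locales (auto intro: finite_subset)
qed

lemma (in group) cyclic_subgroup:
  assumes fin: "finite (carrier G)" and g: "g \<in> carrier G"
  shows "generate G {g} = {g [^] k |k. k \<in> (UNIV :: nat set)}"
    and "\<And>x y. x \<in> generate G {g} \<Longrightarrow> y \<in> generate G {g} \<Longrightarrow> x \<otimes> y = y \<otimes> x"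
proof -
  show eq: "generate G {g} = {g [^] k |k. k \<in> (UNIV :: nat set)}"
    using generate_pow_on_finite_carrier[OF fin g] .
  show "x \<otimes> y = y \<otimes> x" if "x \<in> generate G {g}" "y \<in> generate G {g}" for x y
    using that g unfolding eq by (auto simp: nat_pow_mult add.commute)
qed

lemma (in matrix_rep) exists_eigenvalue_list_element:
  assumes split: "\<And>H. subgroup H G \<Longrightarrow> splitting_field TYPE('a) (G\<lparr>carrier := H\<rparr>)"
    and g: "g \<in> carrier G"
  obtains as where "eigenvalue_list G n \<rho> g as"
proof -
  let ?H = "generate G {g}"
  have H: "subgroup ?H G" using g by (intro generate_is_subgroup) auto
  have gH: "g \<in> ?H" by (rule generate.incl) simp
  have "\<exists>as. eigenvalue_list (G\<lparr>carrier := ?H\<rparr>) n \<rho> g as"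
  proof (rule exists_eigenvalue_list)
    show "matrix_rep (G\<lparr>carrier := ?H\<rparr>) n \<rho>" by (rule restrict_rep[OF H])
  qed (use split[OF H] gH cyclic_subgroup(2)[OF fin g] in auto)
  thus ?thesis using that by (auto simp: eigenvalue_list_def nat_pow_consistent[symmetric])
qed

text \<open>Left multiplication on the group, whose elements \<open>e\<close> enumerates as indices of rows and columns.\<close>

definition regular_rep ::
  "('g, 'm) monoid_scheme \<Rightarrow> (nat \<Rightarrow> 'g) \<Rightarrow> 'g \<Rightarrow> 'a::field mat" where
  "regular_rep G e g = mat (Coset.order G) (Coset.order G) (\<lambda>(i, j). if e i = g \<otimes>\<^bsub>G\<^esub> e j then 1 else 0)"

lemma (in group) regular_rep:
  assumes fin: "finite (carrier G)" and e: "bij_betw e {..<Coset.order G} (carrier G)"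
  shows "matrix_rep G (Coset.order G) (regular_rep G e :: 'a \<Rightarrow> 'f::field mat)"
    and "g \<in> carrier G \<Longrightarrow>
      mat_trace (regular_rep G e g :: 'f mat) = (if g = \<one> then of_nat (Coset.order G) else 0)"
proof -
  have ec: "e i \<in> carrier G" if "i < Coset.order G" for i using e that by (auto dest: bij_betwE)
  have inj: "e i = e j \<longleftrightarrow> i = j" if "i < Coset.order G" "j < Coset.order G" for i j
    using e that by (auto simp: bij_betw_def inj_on_def)
  show "matrix_rep G (Coset.order G) (regular_rep G e :: 'a \<Rightarrow> 'f mat)"
  proof
    fix g h assume gh: "g \<in> carrier G" "h \<in> carrier G"
    show "(regular_rep G e (g \<otimes> h) :: 'f mat) = regular_rep G e g * regular_rep G e h"
    proof (rule eq_matI, goal_cases)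
      case (1 i k)
      hence ik: "i < Coset.order G" "k < Coset.order G" by (auto simp: regular_rep_def)
      obtain j where j: "j < Coset.order G" "e j = h \<otimes> e k"
        using e gh ec[OF ik(2)] by (metis bij_betw_iff_bijections lessThan_iff m_closed)
      have "(regular_rep G e g * regular_rep G e h :: 'f mat) $$ (i, k)
        = (\<Sum>l<Coset.order G. (if e i = g \<otimes> e l then 1 else 0) * (if e l = h \<otimes> e k then 1 else 0))"
        using ik by (simp add: regular_rep_def scalar_prod_def atLeast0LessThan)
      also have "\<dots> = (\<Sum>l<Coset.order G. if l = j then if e i = g \<otimes> (h \<otimes> e k) then 1 else 0 else 0)"
        using j inj by (intro sum.cong refl) (auto simp: inj[of _ j] j(2)[symmetric])
      also have "\<dots> = (regular_rep G e (g \<otimes> h) :: 'f mat) $$ (i, k)"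
        using ik j gh ec[OF ik(2)] by (simp add: sum.delta regular_rep_def m_assoc)
      finally show ?case ..
    qed (auto simp: regular_rep_def)
  qed (use fin ec inj in \<open>auto simp: regular_rep_def intro!: eq_matI\<close>)
  show "mat_trace (regular_rep G e g :: 'f mat) = (if g = \<one> then of_nat (Coset.order G) else 0)"
    if g: "g \<in> carrier G"
  proof -
    have "e i = g \<otimes> e i \<longleftrightarrow> g = \<one>" if "i < Coset.order G" for i
      using ec[OF that] g by (metis l_one r_cancel_one' )
    thus ?thesis by (simp add: mat_trace_def regular_rep_def)
  qed
qed

lemma sum_powers_root_of_unity:
  fixes x :: "'x::field"
  assumes "x ^ m = 1" "x \<noteq> 1"
  shows "(\<Sum>i<m. x ^ i) = 0"
  using assms by (simp add: sum_gp_strict)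

context p_modular_system
begin

lemma prime_char: "Factorial_Ring.prime CHAR('f)"
  using prime_p char_residue_field by simp

text \<open>In characteristic \<open>p\<close> taking \<open>p\<close>-th powers is additive, hence injective.\<close>

lemma residue_p_power_root:
  fixes x :: 'f
  assumes "x ^ (p ^ a) = 1" shows "x = 1"
proof -
  have "(1 + (x - 1)) ^ (p ^ a) = 1 ^ (p ^ a) + (x - 1) ^ (p ^ a)"
    by (rule freshmans_dream'[OF prime_char]) (simp add: char_residue_field)
  hence "(x - 1) ^ (p ^ a) = 0" using assms by simp
  thus ?thesis by (simp add: power_eq_0_iff split: if_splits)
qed

text \<open>If two such roots \<open>y\<close> and \<open>z\<close> have the same reduction, the quotient \<open>w = y / z\<close> reduces to \<open>1\<close> and is a
  root of unity of exponent \<open>M\<close> prime to \<open>p\<close>. If \<open>w \<noteq> 1\<close>, then \<open>1 + w + \<dots> + w\<^bsup>M-1\<^esup> = 0\<close> reduces to \<open>M = 0\<close>, a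
  contradiction.\<close>

lemma root_of_unity_lift_eq:
  assumes z: "z ^ m = 1" "0 < m" "coprime m p"
  shows "root_of_unity_lift p \<O> red (red z) = z"
  unfolding root_of_unity_lift_def
proof (rule the_equality)
  show "z \<in> \<O> \<and> (\<exists>m>0. coprime m p \<and> z ^ m = 1) \<and> red z = red z"
    using z root_of_unity_mem by blast
  fix y assume y: "y \<in> \<O> \<and> (\<exists>m>0. coprime m p \<and> y ^ m = 1) \<and> red y = red z"
  then obtain l where l: "0 < l" "coprime l p" "y ^ l = 1" by blast
  have zO: "z \<in> \<O>" using z root_of_unity_mem by blast
  define M where "M = m * l"
  \<comment> \<open>This is \<open>y / z\<close>.\<close>
  define w where "w = y * z ^ (M - 1)"
  have "0 < M" "coprime M p" using z l by (auto simp: M_def)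
  have "z ^ M = (z ^ m) ^ l" "y ^ M = (y ^ l) ^ m"
    by (simp_all add: M_def power_mult[symmetric] mult.commute)
  hence zM: "z ^ M = 1" "y ^ M = 1" using z l by simp_all
  have zz: "z * z ^ (M - 1) = 1" using zM \<open>0 < M\<close> by (cases M) auto
  have wO: "w \<in> \<O>" using y zO by (simp add: w_def red.mult_mem red.power_mem)
  have "(z ^ (M - 1)) ^ M = (z ^ M) ^ (M - 1)" by (simp add: power_mult[symmetric] mult.commute)
  hence "w ^ M = 1" using zM by (simp add: w_def power_mult_distrib)
  have "red w = red z * red (z ^ (M - 1))" using y zO by (simp add: w_def red.hom_mult red.power_mem)
  also have "\<dots> = 1" using zz zO red.hom_mult[of z "z ^ (M - 1)"] red.power_mem red.hom_one by simp
  finally have "red w = 1" .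
  have "w = 1"
  proof (rule ccontr)
    assume "w \<noteq> 1"
    hence "(\<Sum>i<M. w ^ i) = 0" using \<open>w ^ M = 1\<close> by (intro sum_powers_root_of_unity)
    hence "red (\<Sum>i<M. w ^ i) = 0" by (simp add: red.hom_zero)
    hence "(\<Sum>i<M. red w ^ i) = 0" using wO by (simp add: red.hom_sum red.power_mem red.hom_power)
    hence "red (of_nat M) = 0" using \<open>red w = 1\<close> by (simp add: red.hom_of_nat)
    hence "p dvd M" by (simp add: red_of_nat_eq_0_iff)
    thus False using \<open>coprime M p\<close> prime_p by (meson coprime_common_divisor dvd_refl not_prime_unit)
  qed
  have "y = y * (z * z ^ (M - 1))" using zz by simp
  also have "\<dots> = w * z" by (simp add: w_def mult_ac)
  finally show "y = z" using \<open>w = 1\<close> by simp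
qed

text \<open>Let \<open>as\<close> be the eigenvalues of \<open>g\<close>, of order \<open>m\<close>, in the regular representation of the group
  generated by \<open>g\<close>. The power sums of \<open>as\<close> are the traces \<open>0\<close>, except for exponent zero, where the
  trace is \<open>m\<close>. Hence the sum over \<open>i < m\<close> of \<open>c\<^bsup>-i\<^esup>\<close> times the \<open>i\<close>-th power sum reduces to \<open>m\<close>,
  which is nonzero in the residue field. On the other hand, it is a sum of geometric sums in
  \<open>red a / c\<close>, all of which would vanish if no \<open>a\<close> reduced to \<open>c\<close>.\<close>

lemma exists_root_of_unity_lift:
  fixes G :: "('g, 'm) monoid_scheme"
  assumes G: "group G" "finite (carrier G)"
    and split: "\<And>H. subgroup H G \<Longrightarrow> splitting_field TYPE('k) (G\<lparr>carrier := H\<rparr>)"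
    and g: "g \<in> p_regular p G" and c: "c ^ group.ord G g = 1"
  obtains z where "z ^ group.ord G g = 1" "red z = c"
proof -
  interpret group G by fact
  let ?H = "generate G {g}"
  let ?GH = "G\<lparr>carrier := ?H\<rparr>"
  define m where "m = group.ord G g"
  have gc: "g \<in> carrier G" and cop: "coprime m p" using g by (auto simp: p_regular_def m_def)
  have mpos: "0 < m" using ord_ge_1[OF G(2) gc] by (simp add: m_def)
  have H: "subgroup ?H G" using gc by (intro generate_is_subgroup) auto
  have gH: "g \<in> ?H" by (rule generate.incl) simp
  interpret H: group ?GH by (rule subgroup.subgroup_is_group[OF H group_axioms])
  have finH: "finite (carrier ?GH)" using H G(2) by (auto intro: finite_subset dest: subgroup.subset)
  have ordH: "Coset.order ?GH = m"
    using generate_pow_card[OF gc] by (simp add: m_def Coset.order_def)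
  obtain e where e: "bij_betw e {..<Coset.order ?GH} (carrier ?GH)"
    using ex_bij_betw_nat_finite[OF finH] by (auto simp: Coset.order_def atLeast0LessThan)
  interpret R: matrix_rep ?GH m "regular_rep ?GH e :: 'g \<Rightarrow> 'k mat"
    using H.regular_rep(1)[OF finH e] by (simp add: ordH)
  have "\<exists>as. eigenvalue_list ?GH m (regular_rep ?GH e :: 'g \<Rightarrow> 'k mat) g as"
    using split[OF H] gH cyclic_subgroup(2)[OF G(2) gc] R.matrix_rep_axioms
    by (intro exists_eigenvalue_list) auto
  then obtain as where as: "eigenvalue_list ?GH m (regular_rep ?GH e :: 'g \<Rightarrow> 'k mat) g as" ..
  have pow: "g [^]\<^bsub>?GH\<^esub> i = g [^]\<^bsub>G\<^esub> i" for i :: nat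
    by (rule nat_pow_consistent[symmetric])
  have tr: "(\<Sum>a\<leftarrow>as. a ^ i) = (if i = 0 then of_nat m else 0)" if "i < m" for i
  proof -
    have "g [^]\<^bsub>G\<^esub> i = \<one>\<^bsub>G\<^esub> \<longleftrightarrow> i = 0" using that pow_eq_id[OF gc] by (auto simp: m_def dest: dvd_imp_le)
    moreover have "(\<Sum>a\<leftarrow>as. a ^ i) = mat_trace (regular_rep ?GH e (g [^]\<^bsub>?GH\<^esub> i) :: 'k mat)"
      using as by (simp add: eigenvalue_list_def)
    moreover have "g [^]\<^bsub>?GH\<^esub> i \<in> carrier ?GH" using gH by (intro H.nat_pow_closed) simp
    hence "mat_trace (regular_rep ?GH e (g [^]\<^bsub>?GH\<^esub> i) :: 'k mat)
        = (if g [^]\<^bsub>G\<^esub> i = \<one>\<^bsub>G\<^esub> then of_nat m else 0)"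
      using H.regular_rep(2)[OF finH e, of "g [^]\<^bsub>?GH\<^esub> i"] unfolding ordH pow by simp
    ultimately show ?thesis by simp
  qed
  have root: "a ^ m = 1" if "a \<in> set as" for a
    using as that gc pow[of m] by (auto simp: eigenvalue_list_def m_def)
  have asO: "set as \<subseteq> \<O>" using root root_of_unity_mem mpos by blast
  have cm: "c ^ m = 1" using c by (simp add: m_def)
  hence "c \<noteq> 0" using mpos by (auto simp: power_0_left)
  have "\<exists>a\<in>set as. red a = c"
  proof (rule ccontr)
    assume none: "\<not> (\<exists>a\<in>set as. red a = c)"
    have sumred: "red (\<Sum>a\<leftarrow>as. a ^ i) = (\<Sum>a\<leftarrow>as. red a ^ i)" for i :: nat
    proof -
      have "red (\<Sum>a\<leftarrow>as. a ^ i) = (\<Sum>a\<leftarrow>as. red (a ^ i))"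
        using red.hom_sum_list[of as "\<lambda>a. a ^ i"] asO red.power_mem by blast
      also have "\<dots> = (\<Sum>a\<leftarrow>as. red a ^ i)"
        using asO by (intro arg_cong[of _ _ sum_list] map_cong refl) (auto simp: red.hom_power)
      finally show ?thesis .
    qed
    have swap: "(\<Sum>i<m. inverse c ^ i * (\<Sum>a\<leftarrow>xs. red a ^ i)) = (\<Sum>a\<leftarrow>xs. \<Sum>i<m. (inverse c * red a) ^ i)" for xs
      by (induction xs) (simp_all add: distrib_left sum.distrib power_mult_distrib)
    have "(\<Sum>i<m. inverse c ^ i * red (\<Sum>a\<leftarrow>as. a ^ i)) = (\<Sum>i<m. if i = 0 then red (of_nat m) else 0)"
      by (rule sum.cong) (auto simp: tr red.hom_zero)
    also have "\<dots> = red (of_nat m)" using mpos by (simp add: sum.delta)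
    finally have "red (of_nat m) = (\<Sum>i<m. inverse c ^ i * (\<Sum>a\<leftarrow>as. red a ^ i))"
      using sumred by simp
    also have "\<dots> = (\<Sum>a\<leftarrow>as. \<Sum>i<m. (inverse c * red a) ^ i)" by (rule swap)
    also have "\<dots> = (\<Sum>a\<leftarrow>as. 0)"
    proof (rule arg_cong[of _ _ sum_list], rule map_cong[OF refl])
      fix a assume a: "a \<in> set as"
      have "red a ^ m = 1" using root[OF a] red.hom_power[of a m] asO a red.hom_one by auto
      hence "(inverse c * red a) ^ m = 1" using cm by (simp add: power_mult_distrib power_inverse)
      moreover have "inverse c * red a \<noteq> 1" using none a \<open>c \<noteq> 0\<close> by (auto simp: field_simps)
      ultimately show "(\<Sum>i<m. (inverse c * red a) ^ i) = 0" by (rule sum_powers_root_of_unity)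
    qed
    also have "\<dots> = 0" by simp
    finally have "p dvd m" by (simp add: red_of_nat_eq_0_iff)
    thus False using cop prime_p by (meson coprime_common_divisor dvd_refl not_prime_unit)
  qed
  thus ?thesis using root that by (auto simp: m_def)
qed

end

section \<open>Liftable characters and maximal orders\<close>

lemma (in matrix_rep) ext_mem_invariant:
  assumes W: "vec_subspace n W" and inv: "\<And>g v. g \<in> carrier G \<Longrightarrow> v \<in> W \<Longrightarrow> \<rho> g *\<^sub>v v \<in> W"
    and v: "v \<in> W"
  shows "ext a *\<^sub>v v \<in> W"
proof -
  have vc: "v \<in> carrier_vec n" using W v by (auto simp: vec_subspace_def)
  have "vec n (\<lambda>i. \<Sum>g\<in>A. a g * (\<rho> g *\<^sub>v v) $ i) \<in> W" if "A \<subseteq> carrier G" for A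
    using finite_subset[OF that fin] that
  proof (induction A rule: finite_induct)
    case empty
    have "vec n (\<lambda>i. \<Sum>g\<in>{}. a g * (\<rho> g *\<^sub>v v) $ i) = 0\<^sub>v n" by (intro eq_vecI) auto
    thus ?case using W by (simp add: vec_subspace_def)
  next
    case (insert h A)
    have h: "\<rho> h *\<^sub>v v \<in> W" using insert inv v by auto
    have "vec n (\<lambda>i. \<Sum>g\<in>insert h A. a g * (\<rho> g *\<^sub>v v) $ i)
      = a h \<cdot>\<^sub>v (\<rho> h *\<^sub>v v) + vec n (\<lambda>i. \<Sum>g\<in>A. a g * (\<rho> g *\<^sub>v v) $ i)"
      using insert by (intro eq_vecI) auto
    thus ?case using insert h W by (auto simp: vec_subspace_def)
  qed
  from this[OF subset_refl] have "vec n (\<lambda>i. \<Sum>g\<in>carrier G. a g * (\<rho> g *\<^sub>v v) $ i) \<in> W" .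
  moreover have "ext a *\<^sub>v v = vec n (\<lambda>i. \<Sum>g\<in>carrier G. a g * (\<rho> g *\<^sub>v v) $ i)"
  proof (rule eq_vecI)
    fix i assume "i < dim_vec (vec n (\<lambda>i. \<Sum>g\<in>carrier G. a g * (\<rho> g *\<^sub>v v) $ i))"
    hence i: "i < n" by simp
    have "(ext a *\<^sub>v v) $ i = (\<Sum>j<n. (\<Sum>g\<in>carrier G. a g * \<rho> g $$ (i, j)) * v $ j)"
      using i vc by (simp add: scalar_prod_def atLeast0LessThan ext_index)
    also have "\<dots> = (\<Sum>j<n. \<Sum>g\<in>carrier G. a g * (\<rho> g $$ (i, j) * v $ j))"
      by (simp add: sum_distrib_right mult.assoc)
    also have "\<dots> = (\<Sum>g\<in>carrier G. \<Sum>j<n. a g * (\<rho> g $$ (i, j) * v $ j))" by (rule sum.swap)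
    also have "\<dots> = (\<Sum>g\<in>carrier G. a g * (\<rho> g *\<^sub>v v) $ i)"
      using i vc by (intro sum.cong refl) (auto simp: scalar_prod_def atLeast0LessThan sum_distrib_left)
    finally show "(ext a *\<^sub>v v) $ i = vec n (\<lambda>i. \<Sum>g\<in>carrier G. a g * (\<rho> g *\<^sub>v v) $ i) $ i"
      using i by simp
  qed simp
  ultimately show ?thesis by simp
qed

text \<open>With the matrix units, any nonzero vector of an invariant subspace can be moved to all the unit
  vectors.\<close>

lemma (in matrix_rep) irreducible_if_spans_mat_units:
  assumes n: "0 < n" and span: "\<And>k l. k < n \<Longrightarrow> l < n \<Longrightarrow> \<exists>a. ext a = mat_unit n k l"
  shows "irreducible_rep G n \<rho>"
  unfolding irreducible_rep_def subspace_module_vec_iff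
proof (intro conjI allI impI n)
  show "\<rho> \<in> hom G (GL TYPE('a) n)"
    using matrix_rep_iff_hom[OF group_axioms fin] matrix_rep_axioms by blast
  fix W assume "vec_subspace n W \<and> (\<forall>g\<in>carrier G. \<forall>v\<in>W. \<rho> g *\<^sub>v v \<in> W)"
  hence W: "vec_subspace n W" and inv: "\<And>g v. g \<in> carrier G \<Longrightarrow> v \<in> W \<Longrightarrow> \<rho> g *\<^sub>v v \<in> W" by auto
  have Wc: "W \<subseteq> carrier_vec n" using W by (simp add: vec_subspace_def)
  show "W = {0\<^sub>v n} \<or> W = carrier_vec n"
  proof (cases "W \<subseteq> {0\<^sub>v n}")
    case True
    thus ?thesis using W by (auto simp: vec_subspace_def)
  next
    case False
    then obtain v where v: "v \<in> W" "v \<noteq> 0\<^sub>v n" by auto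
    have vc: "v \<in> carrier_vec n" using v Wc by auto
    have "\<exists>l<n. v $ l \<noteq> 0"
    proof (rule ccontr)
      assume "\<not> (\<exists>l<n. v $ l \<noteq> 0)"
      hence "v = 0\<^sub>v n" using vc by (intro eq_vecI) auto
      thus False using v by simp
    qed
    then obtain l where l: "l < n" "v $ l \<noteq> 0" by blast
    have unit: "unit_vec n k \<in> W" if k: "k < n" for k
    proof -
      obtain a where "ext a = mat_unit n k l" using span[OF k l(1)] ..
      hence "v $ l \<cdot>\<^sub>v unit_vec n k \<in> W"
        using ext_mem_invariant[OF W inv v(1), of a] mat_unit_mult_vec[OF vc k l(1)] by simp
      hence "inverse (v $ l) \<cdot>\<^sub>v (v $ l \<cdot>\<^sub>v unit_vec n k) \<in> W" using W by (simp add: vec_subspace_def)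
      thus ?thesis using l by (simp add: smult_smult_assoc)
    qed
    have "x \<in> W" if "x \<in> carrier_vec n" for x
    proof -
      have "1\<^sub>m n *\<^sub>v x \<in> W" using that unit
        by (intro mult_mat_vec_mem_subspace[OF W]) auto
      thus ?thesis using that by simp
    qed
    thus ?thesis using Wc by auto
  qed
qed

context p_modular_system
begin

definition integral_rep :: "('g, 'm) monoid_scheme \<Rightarrow> nat \<Rightarrow> ('g \<Rightarrow> 'k mat) \<Rightarrow> bool" where
  "integral_rep G n \<tau> \<longleftrightarrow> matrix_rep G n \<tau> \<and> (\<forall>g\<in>carrier G. \<tau> g \<in> red.mats n)"

text \<open>The order spanned by \<open>\<tau>(G)\<close> over \<open>\<O>\<close> is the full matrix ring over \<open>\<O>\<close>.\<close>

definition spans_matrix_order :: "('g, 'm) monoid_scheme \<Rightarrow> nat \<Rightarrow> ('g \<Rightarrow> 'k mat) \<Rightarrow> bool" where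
  "spans_matrix_order G n \<tau> \<longleftrightarrow>
     (\<forall>k<n. \<forall>l<n. \<exists>a. (\<forall>g\<in>carrier G. a g \<in> \<O>) \<and> rep_extend G n \<tau> a = mat_unit n k l)"

lemma reduced_rep:
  assumes "integral_rep G n \<tau>"
  shows "matrix_rep G n (\<lambda>g. map_mat red (\<tau> g))"
proof -
  interpret matrix_rep G n \<tau> using assms by (simp add: integral_rep_def)
  have m: "\<tau> g \<in> red.mats n" if "g \<in> carrier G" for g using assms that by (simp add: integral_rep_def)
  show ?thesis
    by unfold_locales
      (use fin in \<open>auto simp: rep_one red.hom_mats_one rep_mult red.hom_mats_mult[OF m m]\<close>)
qed

lemma integral_ext:
  assumes "integral_rep G n \<tau>" "\<And>g. g \<in> carrier G \<Longrightarrow> a g \<in> \<O>"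
  shows "rep_extend G n \<tau> a \<in> red.mats n"
    and "map_mat red (rep_extend G n \<tau> a) = rep_extend G n (\<lambda>g. map_mat red (\<tau> g)) (\<lambda>g. red (a g))"
proof -
  interpret matrix_rep G n \<tau> using assms by (simp add: integral_rep_def)
  have m: "\<tau> g $$ (i, j) \<in> \<O>" if "g \<in> carrier G" "i < n" "j < n" for g i j
    using assms that by (auto simp: integral_rep_def intro: red.mats_entry)
  show "ext a \<in> red.mats n"
    using assms(2) m by (intro red.matsI) (auto simp: ext_index intro!: red.sum_mem red.mult_mem)
  show "map_mat red (ext a) = rep_extend G n (\<lambda>g. map_mat red (\<tau> g)) (\<lambda>g. red (a g))"
  proof (rule eq_matI, goal_cases)
    case (1 i j)
    hence ij: "i < n" "j < n" by (auto simp: rep_extend_def)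
    have "red (\<Sum>g\<in>carrier G. a g * \<tau> g $$ (i, j)) = (\<Sum>g\<in>carrier G. red (a g * \<tau> g $$ (i, j)))"
      using assms(2) m ij by (intro red.hom_sum red.mult_mem) auto
    also have "\<dots> = (\<Sum>g\<in>carrier G. red (a g) * map_mat red (\<tau> g) $$ (i, j))"
      using assms(2) m ij by (intro sum.cong refl) (simp add: red.hom_mult)
    finally show ?case using ij by (simp add: rep_extend_def)
  qed (auto simp: rep_extend_def)
qed

text \<open>The eigenvalues of \<open>g\<close> are roots of unity, and their reductions are the eigenvalues of the
  reduction of \<open>g\<close>.\<close>

lemma brauer_character_reduction:
  assumes int: "integral_rep G n \<tau>"
    and split: "\<And>H. subgroup H G \<Longrightarrow> splitting_field TYPE('k) (G\<lparr>carrier := H\<rparr>)"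
  shows "brauer_character p \<O> red G (\<lambda>g. map_mat red (\<tau> g)) = restrict (character G \<tau>) (p_regular p G)"
proof
  fix g
  interpret matrix_rep G n \<tau> using int by (simp add: integral_rep_def)
  show "brauer_character p \<O> red G (\<lambda>g. map_mat red (\<tau> g)) g
      = restrict (character G \<tau>) (p_regular p G) g"
  proof (cases "g \<in> p_regular p G")
    case True
    hence g: "g \<in> carrier G" and cop: "coprime (group.ord G g) p" by (auto simp: p_regular_def)
    have pos: "0 < group.ord G g" using ord_ge_1[OF fin g] by simp
    obtain as where as: "eigenvalue_list G n \<tau> g as"
      using exists_eigenvalue_list_element[OF split g] by blast
    have root: "a ^ group.ord G g = 1" if "a \<in> set as" for a
      by (rule eigenvalue_list_root[OF as that pow_ord_eq_1[OF g]])
    have asO: "set as \<subseteq> \<O>" using root root_of_unity_mem pos by blast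
    have "char_poly (map_mat red (\<tau> g)) = map_poly red (\<Prod>a\<leftarrow>as. [:- a, 1:])"
      using red.hom_char_poly[of "\<tau> g" n] int g as by (simp add: integral_rep_def eigenvalue_list_def)
    also have "\<dots> = (\<Prod>c\<leftarrow>map red as. [:- c, 1:])"
      using red.hom_prod_linear[OF asO] by (simp add: comp_def)
    finally have roots: "proots (char_poly (map_mat red (\<tau> g))) = mset (map red as)"
      by (simp only: proots_prod_linear)
    have "(\<Sum>c\<in>#proots (char_poly (map_mat red (\<tau> g))). root_of_unity_lift p \<O> red c)
        = sum_list (map (\<lambda>a. root_of_unity_lift p \<O> red (red a)) as)"
      unfolding roots by (simp add: sum_mset_sum_list[symmetric] multiset.map_comp comp_def flip: mset_map)
    also have "\<dots> = sum_list (map (\<lambda>a. a ^ 1) as)"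
      using root_of_unity_lift_eq[OF root pos cop] by (intro arg_cong[of _ _ sum_list] map_cong refl) simp
    also have "\<dots> = mat_trace (\<tau> (g [^]\<^bsub>G\<^esub> (1::nat)))" by (rule eigenvalue_list_trace[OF as, symmetric])
    also have "\<dots> = mat_trace (\<tau> g)" using g by simp
    finally show ?thesis using True g by (simp add: brauer_character_def character_def)
  qed (simp add: brauer_character_def)
qed

text \<open>Reduction of the coefficients shows that the reduced representation spans the matrix algebra over
  the residue field as well; hence it is irreducible.\<close>

theorem lifts_if_spans_matrix_order:
  assumes int: "integral_rep G n \<tau>" and n: "0 < n" and spans: "spans_matrix_order G n \<tau>"
    and split: "\<And>H. subgroup H G \<Longrightarrow> splitting_field TYPE('k) (G\<lparr>carrier := H\<rparr>)"
  shows "\<exists>\<phi>\<in>IBr p \<O> red G. lifts_brauer p G (character G \<tau>) \<phi>"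
proof -
  let ?\<sigma> = "\<lambda>g. map_mat red (\<tau> g)"
  interpret S: matrix_rep G n ?\<sigma> by (rule reduced_rep[OF int])
  have "irreducible_rep G n ?\<sigma>"
  proof (rule S.irreducible_if_spans_mat_units[OF n])
    fix k l assume "k < n" "l < n"
    then obtain a where a: "\<forall>g\<in>carrier G. a g \<in> \<O>" "rep_extend G n \<tau> a = mat_unit n k l"
      using spans unfolding spans_matrix_order_def by blast
    have "S.ext (\<lambda>g. red (a g)) = map_mat red (rep_extend G n \<tau> a)"
      using integral_ext(2)[OF int] a(1) by simp
    also have "\<dots> = mat_unit n k l" using a(2) red.hom_mats_unit by simp
    finally show "\<exists>a. S.ext a = mat_unit n k l" by blast
  qed
  hence "brauer_character p \<O> red G ?\<sigma> \<in> IBr p \<O> red G" unfolding IBr_def by blast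
  moreover have "lifts_brauer p G (character G \<tau>) (brauer_character p \<O> red G ?\<sigma>)"
    unfolding lifts_brauer_def by (rule brauer_character_reduction[OF int split, symmetric])
  ultimately show ?thesis by (intro bexI)
qed

text \<open>If \<open>g\<close> has order \<open>p\<^sup>a m\<close> with \<open>m\<close> prime to \<open>p\<close>, take \<open>q\<close> divisible by \<open>p\<^sup>a\<close> and congruent to \<open>1\<close>
  modulo \<open>m\<close>; then \<open>g\<^sup>q\<close> is the \<open>p\<close>-regular part of \<open>g\<close>. In the residue field the eigenvalues of \<open>g\<close>
  are \<open>m\<close>-th roots of unity, so they are fixed by taking \<open>q\<close>-th powers.\<close>

lemma exists_regular_power:
  fixes G :: "('g, 'm) monoid_scheme"
  assumes G: "group G" "finite (carrier G)" and g: "g \<in> carrier G"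
  obtains q :: nat where "g [^]\<^bsub>G\<^esub> q \<in> p_regular p G"
    "\<And>c :: 'f. c ^ group.ord G g = 1 \<Longrightarrow> c ^ q = c"
proof -
  interpret group G by fact
  define N where "N = group.ord G g"
  have Npos: "0 < N" using ord_ge_1[OF G(2) g] by (simp add: N_def)
  define a where "a = multiplicity p N"
  obtain m where m: "N = p ^ a * m" "\<not> p dvd m"
    by (rule multiplicity_decompose'[of N p]) (use Npos prime_p a_def in auto)
  have cop: "coprime m p" using prime_imp_coprime[OF prime_p m(2)] by (simp add: coprime_commute)
  have "coprime (p ^ a) m" using cop by (simp add: coprime_commute)
  then obtain q where q: "[q = 0] (mod p ^ a)" "[q = 1] (mod m)"
    using binary_chinese_remainder_nat[of "p ^ a" m 0 1] by auto
  have "p ^ a dvd q" using q(1) by (simp add: cong_0_iff)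
  have mpos: "0 < m" using m(1) Npos by (cases m) auto
  have "(g [^]\<^bsub>G\<^esub> q) [^]\<^bsub>G\<^esub> m = g [^]\<^bsub>G\<^esub> (q * m)" using g by (simp add: nat_pow_pow)
  also have "\<dots> = \<one>\<^bsub>G\<^esub>"
    using \<open>p ^ a dvd q\<close> pow_eq_id[OF g, of "q * m"] mult_dvd_mono[of "p ^ a" q m m] unfolding N_def[symmetric] m(1)
    by simp
  finally have "group.ord G (g [^]\<^bsub>G\<^esub> q) dvd m" using g pow_eq_id[of "g [^]\<^bsub>G\<^esub> q" m] by simp
  hence "coprime (group.ord G (g [^]\<^bsub>G\<^esub> q)) p" by (rule coprime_divisors[OF _ dvd_refl cop])
  hence reg: "g [^]\<^bsub>G\<^esub> q \<in> p_regular p G" using g by (simp add: p_regular_def)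
  have "c ^ q = c" if c: "c ^ group.ord G g = 1" for c :: 'f
  proof -
    have "(c ^ m) ^ (p ^ a) = 1" using c m(1) by (simp add: N_def power_mult[symmetric] mult.commute)
    hence cm: "c ^ m = 1" by (rule residue_p_power_root)
    have "c ^ q = c ^ (q mod m)"
      using cm power_add[of c "m * (q div m)" "q mod m"] by (simp add: power_mult)
    also have "q mod m = 1 mod m" using q(2) by (simp add: cong_def)
    also have "c ^ (1 mod m) = c"
    proof (cases "m = 1")
      case False
      thus ?thesis using mpos by simp
    qed (use cm in simp)
    finally show ?thesis .
  qed
  thus ?thesis by (rule that[OF reg])
qed

lemma power_eq_residue:
  assumes "a ^ N = 1" "0 < N" "\<And>c :: 'f. c ^ N = 1 \<Longrightarrow> c ^ q = c"
  shows "red (a ^ q) = red a"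
proof -
  have a: "a \<in> \<O>" using assms root_of_unity_mem by blast
  have "red a ^ N = 1" using a assms(1) red.hom_power[of a N] red.hom_one by simp
  thus ?thesis using assms(3) a by (simp add: red.hom_power)
qed

text \<open>Brauer characters determine the traces on all elements, since an element and its
  \<open>p\<close>-regular part have the same eigenvalues in characteristic \<open>p\<close>.\<close>

lemma lifted_trace:
  assumes int: "integral_rep G n \<tau>" and \<sigma>: "matrix_rep G n \<sigma>"
    and splitK: "\<And>H. subgroup H G \<Longrightarrow> splitting_field TYPE('k) (G\<lparr>carrier := H\<rparr>)"
    and splitk: "\<And>H. subgroup H G \<Longrightarrow> splitting_field TYPE('f) (G\<lparr>carrier := H\<rparr>)"
    and lift: "restrict (character G \<tau>) (p_regular p G) = brauer_character p \<O> red G \<sigma>"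
    and g: "g \<in> carrier G"
  shows "mat_trace (\<sigma> g) = red (mat_trace (\<tau> g))"
proof -
  interpret T: matrix_rep G n \<tau> using int by (simp add: integral_rep_def)
  interpret S: matrix_rep G n \<sigma> by fact
  obtain q :: nat where q: "g [^]\<^bsub>G\<^esub> q \<in> p_regular p G" "\<And>c :: 'f. c ^ group.ord G g = 1 \<Longrightarrow> c ^ q = c"
    by (rule exists_regular_power[OF T.group_axioms T.fin g]) (rule that)
  let ?h = "g [^]\<^bsub>G\<^esub> q"
  have pos: "0 < group.ord G g" using T.ord_ge_1[OF T.fin g] by simp
  have "mat_trace (\<sigma> g) = mat_trace (\<sigma> ?h)"
  proof -
    obtain cs where cs: "eigenvalue_list G n \<sigma> g cs" by (rule S.exists_eigenvalue_list_element[OF splitk g])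
    have root: "c ^ group.ord G g = 1" if "c \<in> set cs" for c
      by (rule eigenvalue_list_root[OF cs that T.pow_ord_eq_1[OF g]])
    have "mat_trace (\<sigma> ?h) = (\<Sum>c\<leftarrow>cs. c ^ q)" using cs by (simp add: eigenvalue_list_def)
    also have "\<dots> = (\<Sum>c\<leftarrow>cs. c ^ 1)" using root q(2) by (intro arg_cong[of _ _ sum_list] map_cong refl) simp
    also have "\<dots> = mat_trace (\<sigma> (g [^]\<^bsub>G\<^esub> (1::nat)))" by (rule eigenvalue_list_trace[OF cs, symmetric])
    finally show ?thesis using g by simp
  qed
  also have "mat_trace (\<sigma> ?h) = red (mat_trace (\<tau> ?h))"
  proof -
    have h: "?h \<in> carrier G" and cop: "coprime (group.ord G ?h) p" using q(1) by (auto simp: p_regular_def)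
    have hpos: "0 < group.ord G ?h" using T.ord_ge_1[OF T.fin h] by simp
    obtain cs where cs: "eigenvalue_list G n \<sigma> ?h cs" by (rule S.exists_eigenvalue_list_element[OF splitk h])
    have root: "c ^ group.ord G ?h = 1" if "c \<in> set cs" for c
      by (rule eigenvalue_list_root[OF cs that T.pow_ord_eq_1[OF h]])
    have lifts: "root_of_unity_lift p \<O> red c \<in> \<O> \<and> red (root_of_unity_lift p \<O> red c) = c" if "c \<in> set cs" for c
    proof -
      note rc = root[OF that]
      obtain z where z: "z ^ group.ord G ?h = 1" "red z = c"
        by (rule exists_root_of_unity_lift[OF T.group_axioms T.fin splitK q(1) rc])
      have "root_of_unity_lift p \<O> red c = z" using root_of_unity_lift_eq[OF z(1) hpos cop] z(2) by simp
      thus ?thesis using z root_of_unity_mem hpos by blast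
    qed
    have roots: "proots (char_poly (\<sigma> ?h)) = mset cs"
      using cs by (simp add: eigenvalue_list_def proots_prod_linear)
    have "mat_trace (\<tau> ?h) = restrict (character G \<tau>) (p_regular p G) ?h"
      using q(1) h by (simp add: character_def)
    also have "\<dots> = (\<Sum>c\<in>#mset cs. root_of_unity_lift p \<O> red c)"
      unfolding lift using q(1) by (simp add: brauer_character_def roots)
    also have "\<dots> = (\<Sum>c\<leftarrow>cs. root_of_unity_lift p \<O> red c)"
      by (simp add: sum_mset_sum_list[symmetric])
    finally have "red (mat_trace (\<tau> ?h)) = (\<Sum>c\<leftarrow>cs. red (root_of_unity_lift p \<O> red c))"
      using red.hom_sum_list[of cs "root_of_unity_lift p \<O> red"] lifts by simp
    also have "\<dots> = (\<Sum>c\<leftarrow>cs. c ^ 1)" using lifts by (intro arg_cong[of _ _ sum_list] map_cong refl) simp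
    also have "\<dots> = mat_trace (\<sigma> (?h [^]\<^bsub>G\<^esub> (1::nat)))" by (rule eigenvalue_list_trace[OF cs, symmetric])
    finally show ?thesis using h by simp
  qed
  also have "red (mat_trace (\<tau> ?h)) = red (mat_trace (\<tau> g))"
  proof -
    obtain as where as: "eigenvalue_list G n \<tau> g as" by (rule T.exists_eigenvalue_list_element[OF splitK g])
    have root: "a ^ group.ord G g = 1" if "a \<in> set as" for a
      by (rule eigenvalue_list_root[OF as that T.pow_ord_eq_1[OF g]])
    have asO: "a \<in> \<O>" if "a \<in> set as" for a using root[OF that] root_of_unity_mem pos by blast
    have "mat_trace (\<tau> ?h) = (\<Sum>a\<leftarrow>as. a ^ q)" using as by (simp add: eigenvalue_list_def)
    hence "red (mat_trace (\<tau> ?h)) = (\<Sum>a\<leftarrow>as. red (a ^ q))"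
      using red.hom_sum_list[of as "\<lambda>a. a ^ q"] asO by (simp add: red.power_mem)
    also have "\<dots> = (\<Sum>a\<leftarrow>as. red (a ^ 1))"
      using power_eq_residue[OF root pos q(2)] by (intro arg_cong[of _ _ sum_list] map_cong refl) simp
    also have "\<dots> = red (\<Sum>a\<leftarrow>as. a ^ 1)" using red.hom_sum_list[of as "\<lambda>a. a ^ 1"] asO by simp
    also have "(\<Sum>a\<leftarrow>as. a ^ 1) = mat_trace (\<tau> (g [^]\<^bsub>G\<^esub> (1::nat)))" by (rule eigenvalue_list_trace[OF as, symmetric])
    finally show ?thesis using g by simp
  qed
  finally show ?thesis .
qed

text \<open>The traces of \<open>\<sigma>\<close> and of the reduction of \<open>\<tau>\<close> agree on the group algebra over the residue field, and
  \<open>\<sigma>\<close> is onto the matrix algebra. Therefore an element that the reduction of \<open>\<tau>\<close> kills is orthogonal to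
  everything under the trace form of \<open>\<sigma>\<close>, so that \<open>\<sigma>\<close> kills it as well. This makes the \<open>n\<^sup>2\<close> matrices
  \<open>\<tau>(u')\<close> linearly independent after reduction. Pairs of indices below \<open>n\<close> are encoded as numbers
  below \<open>N = n\<^sup>2\<close>, so that the coordinates of these matrices form the square matrix \<open>M\<close>.\<close>

theorem spans_matrix_order_if_lifts:
  assumes int: "integral_rep G n \<tau>"
    and splitK: "\<And>H. subgroup H G \<Longrightarrow> splitting_field TYPE('k) (G\<lparr>carrier := H\<rparr>)"
    and splitk: "\<And>H. subgroup H G \<Longrightarrow> splitting_field TYPE('f) (G\<lparr>carrier := H\<rparr>)"
    and \<sigma>: "irreducible_rep G d \<sigma>"
    and lift: "restrict (character G \<tau>) (p_regular p G) = brauer_character p \<O> red G \<sigma>"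
  shows "spans_matrix_order G n \<tau>"
proof -
  interpret T: matrix_rep G n \<tau> using int by (simp add: integral_rep_def)
  have "\<sigma> \<in> hom G (GL TYPE('f) d)" and dpos: "0 < d" using \<sigma> by (simp_all add: irreducible_rep_def)
  hence \<sigma>rep: "matrix_rep G d \<sigma>" using matrix_rep_iff_hom[OF T.group_axioms T.fin] by blast
  interpret S0: matrix_rep G d \<sigma> by (rule \<sigma>rep)
  \<comment> \<open>The degrees are the values of the two characters at the identity element.\<close>
  have "d = n"
  proof -
    have one: "\<one>\<^bsub>G\<^esub> \<in> p_regular p G" by (simp add: p_regular_def)
    obtain cs where cs: "eigenvalue_list G d \<sigma> \<one>\<^bsub>G\<^esub> cs"
      by (rule S0.exists_eigenvalue_list_element[OF splitk T.one_closed])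
    have c1: "c = 1" if "c \<in> set cs" for c
      using eigenvalue_list_root[OF cs that, of 1] by simp
    have lift1: "root_of_unity_lift p \<O> red 1 = 1"
      using root_of_unity_lift_eq[of 1 1] by (simp add: red.hom_one)
    have "of_nat n = restrict (character G \<tau>) (p_regular p G) \<one>\<^bsub>G\<^esub>"
      using one by (simp add: character_def T.rep_one)
    also have "\<dots> = (\<Sum>c\<in>#mset cs. root_of_unity_lift p \<O> red c)"
      unfolding lift using one cs by (simp add: brauer_character_def eigenvalue_list_def proots_prod_linear)
    also have "\<dots> = (\<Sum>c\<leftarrow>cs. root_of_unity_lift p \<O> red c)" by (simp add: sum_mset_sum_list[symmetric])
    also have "\<dots> = (\<Sum>c\<leftarrow>cs. 1)"
    proof (rule arg_cong[of _ _ sum_list], rule map_cong[OF refl])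
      fix c assume "c \<in> set cs"
      from c1[OF this] show "root_of_unity_lift p \<O> red c = 1" using lift1 by simp
    qed
    also have "\<dots> = of_nat d" using cs by (simp add: eigenvalue_list_def sum_list_triv)
    finally show ?thesis by (simp only: of_nat_eq_iff)
  qed
  note \<sigma> = \<sigma>[unfolded \<open>d = n\<close>] note dpos = dpos[unfolded \<open>d = n\<close>]
  interpret S: matrix_rep G n \<sigma> using \<sigma>rep by (simp add: \<open>d = n\<close>)
  interpret S: irreducible_scalar_rep G n \<sigma>
  proof
    fix M :: "'f mat" assume "M \<in> carrier_mat n n" "\<And>g. g \<in> carrier G \<Longrightarrow> M * \<sigma> g = \<sigma> g * M"
    moreover have "splitting_field TYPE('f) G" using splitk[OF T.subgroup_self] by simp
    ultimately show "\<exists>c. M = c \<cdot>\<^sub>m 1\<^sub>m n" using \<sigma> unfolding splitting_field_def by blast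
  qed (use \<sigma> dpos in auto)
  let ?\<tau>' = "\<lambda>g. map_mat red (\<tau> g)"
  interpret R: matrix_rep G n ?\<tau>' by (rule reduced_rep[OF int])
  have \<tau>O: "\<tau> g \<in> red.mats n" if "g \<in> carrier G" for g using int that by (simp add: integral_rep_def)
  have tr: "mat_trace (\<sigma> g) = mat_trace (?\<tau>' g)" if "g \<in> carrier G" for g
    using lifted_trace[OF int S.matrix_rep_axioms splitK splitk lift that] red.hom_mats_trace[OF \<tau>O[OF that]]
    by simp
  have tr_ext: "mat_trace (S.ext a) = mat_trace (R.ext a)" for a
    unfolding S.mat_trace_ext R.mat_trace_ext by (intro sum.cong refl) (simp add: tr)
  \<comment> \<open>Elements of the group algebra over the residue field that act through \<open>\<sigma>\<close> as matrix
    units, with lifts of their coefficients to \<open>\<O>\<close>.\<close>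
  have "\<exists>t. S.ext t = mat_unit n k l" if "k < n" "l < n" for k l
    by (rule S.burnside_mat_unit[OF that]) (rule exI)
  hence "\<exists>t. k < n \<longrightarrow> l < n \<longrightarrow> S.ext t = mat_unit n k l" for k l by blast
  hence "\<exists>t. \<forall>k l. k < n \<longrightarrow> l < n \<longrightarrow> S.ext (t k l) = mat_unit n k l" by (intro choice allI)
  then obtain t where t: "\<And>k l. k < n \<Longrightarrow> l < n \<Longrightarrow> S.ext (t k l) = mat_unit n k l" by blast
  define sec where "sec = inv_into \<O> red"
  have sec: "sec c \<in> \<O>" "red (sec c) = c" for c
    using red_surj by (simp_all add: sec_def inv_into_into f_inv_into_f)
  define N where "N = n * n"
  define u where "u y = t (y div n) (y mod n)" for y
  define u' where "u' y = (\<lambda>g. sec (u y g))" for y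
  have yn: "y div n < n" "y mod n < n" if "y < N" for y
    using that dpos by (simp_all add: N_def less_mult_imp_div_less)
  have Su: "S.ext (u y) = mat_unit n (y div n) (y mod n)" if "y < N" for y
    using t[OF yn[OF that]] by (simp add: u_def)
  have Tu: "T.ext (u' y) \<in> red.mats n" "map_mat red (T.ext (u' y)) = R.ext (u y)" for y
    using integral_ext[OF int, of "u' y"] sec by (simp_all add: u'_def)
  define M where "M = mat N N (\<lambda>(x, y). T.ext (u' y) $$ (x div n, x mod n))"
  have M: "M \<in> red.mats N"
    unfolding M_def by (rule red.matsI) (use yn Tu(1) in \<open>auto intro: red.mats_entry\<close>)
  have Mc: "M \<in> carrier_mat N N" by (simp add: M_def)
  have "det (map_mat red M) \<noteq> 0"
  proof
    assume "det (map_mat red M) = 0"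
    then obtain c where c: "c \<in> carrier_vec N" "c \<noteq> 0\<^sub>v N" "map_mat red M *\<^sub>v c = 0\<^sub>v N"
      using det_0_iff_vec_prod_zero[of "map_mat red M" N] Mc by auto
    define s where "s = (\<lambda>g. \<Sum>y<N. c $ y * u y g)"
    have "R.ext s = 0\<^sub>m n n"
    proof (rule eq_matI)
      fix i j assume "i < dim_row (0\<^sub>m n n :: 'f mat)" "j < dim_col (0\<^sub>m n n :: 'f mat)"
      hence ij: "i < n" "j < n" by auto
      define x where "x = i * n + j"
      have x: "x < N" "x div n = i" "x mod n = j"
        using ij pair_index_less by (simp_all add: x_def N_def)
      have "R.ext s $$ (i, j) = (\<Sum>y<N. c $ y * R.ext (u y) $$ (i, j))"
        unfolding s_def by (rule R.ext_lincomb_index[OF ij])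
      also have "\<dots> = (\<Sum>y<N. map_mat red M $$ (x, y) * c $ y)"
        using x ij by (intro sum.cong refl) (simp add: M_def Tu(2)[symmetric])
      also have "\<dots> = (map_mat red M *\<^sub>v c) $ x"
        using x Mc c(1) by (simp add: scalar_prod_def atLeast0LessThan)
      also have "\<dots> = 0" using c(3) x by simp
      finally show "R.ext s $$ (i, j) = (0\<^sub>m n n) $$ (i, j)" using ij by simp
    qed auto
    have "mat_trace (S.ext s * mat_unit n k l) = 0" if kl: "k < n" "l < n" for k l
    proof -
      have "mat_trace (S.ext s * mat_unit n k l) = mat_trace (S.ext (s \<otimes>\<^bsub>group_algebra G UNIV\<^esub> t k l))"
        using t[OF kl] by (simp add: S.ext_mult)
      also have "\<dots> = mat_trace (R.ext s * R.ext (t k l))" unfolding tr_ext R.ext_mult ..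
      also have "R.ext s * R.ext (t k l) = 0\<^sub>m n n"
        unfolding \<open>R.ext s = 0\<^sub>m n n\<close> by (rule left_mult_zero_mat) simp
      finally show ?thesis by (simp add: mat_trace_def)
    qed
    hence "S.ext s = 0\<^sub>m n n" by (intro trace_form_nondegenerate) auto
    have "c $ y = 0" if y: "y < N" for y
    proof -
      have "S.ext s $$ (y div n, y mod n) = (\<Sum>z<N. c $ z * S.ext (u z) $$ (y div n, y mod n))"
        unfolding s_def by (rule S.ext_lincomb_index) (use yn[OF y] in auto)
      also have "\<dots> = (\<Sum>z<N. if z = y then c $ z else 0)"
      proof (rule sum.cong[OF refl])
        fix z assume "z \<in> {..<N}"
        moreover have "(y div n = z div n \<and> y mod n = z mod n) \<longleftrightarrow> z = y"
        proof
          assume "y div n = z div n \<and> y mod n = z mod n"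
          hence "y div n * n + y mod n = z div n * n + z mod n" by simp
          thus "z = y" unfolding div_mult_mod_eq ..
        qed simp
        ultimately show "c $ z * S.ext (u z) $$ (y div n, y mod n) = (if z = y then c $ z else 0)"
          using yn[OF y] by (auto simp: Su mat_unit_def)
      qed
      also have "\<dots> = c $ y" using y by (simp add: sum.delta)
      finally show ?thesis using \<open>S.ext s = 0\<^sub>m n n\<close> yn[OF y] by simp
    qed
    hence "c = 0\<^sub>v N" using c(1) by (intro eq_vecI) auto
    thus False using c(2) by simp
  qed
  hence "red (det M) \<noteq> 0" using red.hom_det[OF M] by simp
  then obtain B where B: "B \<in> red.mats N" "M * B = 1\<^sub>m N" by (rule mats_inverse[OF M])
  have Bc: "B \<in> carrier_mat N N" by (rule red.mats_carrier[OF B(1)])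
  show ?thesis
    unfolding spans_matrix_order_def
  proof (intro allI impI)
    fix k l assume kl: "k < n" "l < n"
    define z where "z = k * n + l"
    have z: "z < N" "z div n = k" "z mod n = l"
      using kl pair_index_less by (simp_all add: z_def N_def)
    define a where "a = (\<lambda>g. \<Sum>y<N. B $$ (y, z) * u' y g)"
    have "\<forall>g\<in>carrier G. a g \<in> \<O>"
      using z B(1) sec by (auto simp: a_def u'_def intro!: red.sum_mem red.mult_mem red.mats_entry)
    moreover have "T.ext a = mat_unit n k l"
    proof (rule eq_matI)
      fix i j assume "i < dim_row (mat_unit n k l :: 'k mat)" "j < dim_col (mat_unit n k l :: 'k mat)"
      hence ij: "i < n" "j < n" by (auto simp: mat_unit_def)
      define x where "x = i * n + j"
      have x: "x < N" "x div n = i" "x mod n = j"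
        using ij pair_index_less by (simp_all add: x_def N_def)
      have "T.ext a $$ (i, j) = (\<Sum>y<N. B $$ (y, z) * T.ext (u' y) $$ (i, j))"
        unfolding a_def by (rule T.ext_lincomb_index[OF ij])
      also have "\<dots> = (\<Sum>y<N. M $$ (x, y) * B $$ (y, z))"
        using x by (intro sum.cong refl) (simp add: M_def)
      also have "\<dots> = (M * B) $$ (x, z)"
        by (rule mult_mat_index[symmetric]) (use Mc Bc x z in auto)
      also have "\<dots> = (if x = z then 1 else 0)" using B(2) x z by simp
      also have "x = z \<longleftrightarrow> i = k \<and> j = l" using x z by (auto simp: x_def z_def)
      finally show "T.ext a $$ (i, j) = mat_unit n k l $$ (i, j)" using ij by (simp add: mat_unit_def)
    qed (auto simp: mat_unit_def)
    ultimately show "\<exists>a. (\<forall>g\<in>carrier G. a g \<in> \<O>) \<and> T.ext a = mat_unit n k l" by blast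
  qed
qed

end

section \<open>The algebra of a character as a matrix order\<close>

context abs_irr_rep
begin

lemma char_idempotent_eq: "char_idempotent G (character G \<rho>) = fourier_inverse (1\<^sub>m n)"
proof
  fix x
  show "char_idempotent G (character G \<rho>) x = fourier_inverse (1\<^sub>m n) x"
    by (auto simp: char_idempotent_def fourier_inverse_def character_def rep_one
        right_mult_one_mat[OF rep_carrier])
qed

lemma fourier_inverse_add:
  assumes "X \<in> carrier_mat n n" "Y \<in> carrier_mat n n"
  shows "fourier_inverse (X + Y) = (\<lambda>g. fourier_inverse X g + fourier_inverse Y g)"
proof
  fix g
  show "fourier_inverse (X + Y) g = fourier_inverse X g + fourier_inverse Y g"
    using assms
    by (simp add: fourier_inverse_def square_mult_add[where n=n]
        mat_trace_add[of _ n] distrib_left)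
qed

lemma fourier_inverse_smult:
  assumes "X \<in> carrier_mat n n"
  shows "fourier_inverse (c \<cdot>\<^sub>m X) = (\<lambda>g. c * fourier_inverse X g)"
proof
  fix g
  show "fourier_inverse (c \<cdot>\<^sub>m X) g = c * fourier_inverse X g"
    using assms
    by (simp add: fourier_inverse_def square_mult_smult[where n=n]
        mat_trace_smult[of _ n])
qed

lemma fourier_inverse_mult:
  assumes X: "X \<in> carrier_mat n n" and Y: "Y \<in> carrier_mat n n"
  shows "fourier_inverse X \<otimes>\<^bsub>group_algebra G R\<^esub> fourier_inverse Y = fourier_inverse (X * Y)"
proof
  fix g
  show "(fourier_inverse X \<otimes>\<^bsub>group_algebra G R\<^esub> fourier_inverse Y) g = fourier_inverse (X * Y) g"
  proof (cases "g \<in> carrier G")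
    case g: True
      have "(fourier_inverse X \<otimes>\<^bsub>group_algebra G R\<^esub> fourier_inverse Y) g
      = (\<Sum>h\<in>carrier G. fourier_inverse X h * fourier_inverse Y (inv h \<otimes> g))"
      using g by (simp add: group_algebra_def)
    also have "\<dots> = (\<Sum>h\<in>carrier G. of_nat n / of_nat (Coset.order G)
        * (fourier_inverse X h * mat_trace (\<rho> h * (Y * \<rho> (inv g)))))"
    proof (rule sum.cong[OF refl])
      fix h assume h: "h \<in> carrier G"
      have "mat_trace (\<rho> (inv (inv h \<otimes> g)) * Y) = mat_trace (\<rho> (inv g) * (\<rho> h * Y))"
        using g h Y by (simp add: inv_mult_group rep_mult square_assoc[where n=n])
      also have "\<dots> = mat_trace (\<rho> h * Y * \<rho> (inv g))"
        using g h Y by (intro mat_trace_comm[where n=n and m=n]) auto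
      also have "\<rho> h * Y * \<rho> (inv g) = \<rho> h * (Y * \<rho> (inv g))" using g h Y by (simp add: square_assoc[where n=n])
      finally show "fourier_inverse X h * fourier_inverse Y (inv h \<otimes> g) = of_nat n / of_nat (Coset.order G)
        * (fourier_inverse X h * mat_trace (\<rho> h * (Y * \<rho> (inv g))))"
        using g h by (simp add: fourier_inverse_def[of Y])
    qed
    also have "\<dots> = of_nat n / of_nat (Coset.order G) * mat_trace (ext (fourier_inverse X) * (Y * \<rho> (inv g)))"
      using g Y by (simp add: mat_trace_ext_mult sum_distrib_left)
    also have "ext (fourier_inverse X) = X" by (rule ext_fourier_inverse[OF X])
    also have "mat_trace (X * (Y * \<rho> (inv g))) = mat_trace (\<rho> (inv g) * (X * Y))"
      using X Y g mat_trace_comm[of "X * Y" n n "\<rho> (inv g)"] by (simp add: square_assoc[where n=n])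
    also have "of_nat n / of_nat (Coset.order G) * \<dots> = fourier_inverse (X * Y) g"
      using g by (simp add: fourier_inverse_def)
    finally show ?thesis .
  next
    case False
    thus ?thesis by (simp add: group_algebra_def fourier_inverse_def)
  qed
qed

end

text \<open>For an irreducible representation by integral matrices with character \<open>\<chi>\<close>, Fourier inversion
  identifies \<open>\<O>Ge(\<chi>)\<close> with the order \<open>\<Lambda>\<close> spanned by the matrices of the group elements. The lemmas below
  transport the algebra \<open>A = \<O>Ge(\<chi>)\<close> and its dual to \<open>\<Lambda>\<close>.\<close>

locale integral_irr_rep = p_modular_system p \<O> red + abs_irr_rep G n \<rho>
  for p :: nat and \<O> :: "'k::field_char_0 set" and red :: "'k \<Rightarrow> 'f::field"
    and G :: "('g, 'm) monoid_scheme" (structure) and n and \<rho> :: "'g \<Rightarrow> 'k mat" +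
  assumes integral: "g \<in> carrier G \<Longrightarrow> \<rho> g \<in> red.mats n"
begin

lemma integral_rep: "integral_rep G n \<rho>"
  using integral matrix_rep_axioms by (simp add: integral_rep_def)

definition \<Lambda> where "\<Lambda> = {ext a |a. \<forall>g\<in>carrier G. a g \<in> \<O>}"

abbreviation R where "R \<equiv> subring_of \<O>"

abbreviation A where "A \<equiv> group_algebra_factor G \<O> (char_idempotent G (character G \<rho>))"

lemma \<Lambda>_mats: "X \<in> \<Lambda> \<Longrightarrow> X \<in> red.mats n"
  using integral_ext(1)[OF integral_rep] by (auto simp: \<Lambda>_def)

lemma \<Lambda>_carrier: "X \<in> \<Lambda> \<Longrightarrow> X \<in> carrier_mat n n"
  using \<Lambda>_mats red.mats_carrier by blast

lemma rep_in_\<Lambda>: "g \<in> carrier G \<Longrightarrow> \<rho> g \<in> \<Lambda>"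
  unfolding \<Lambda>_def
  by (rule CollectI, rule exI[of _ "\<lambda>x. if x = g then 1 else 0"])
    (simp add: ext_single red.one_mem red.zero_mem)

lemma one_in_\<Lambda>: "1\<^sub>m n \<in> \<Lambda>"
  using rep_in_\<Lambda>[of \<one>] rep_one by simp

lemma ext_in_\<Lambda>: "(\<And>g. g \<in> carrier G \<Longrightarrow> a g \<in> \<O>) \<Longrightarrow> ext a \<in> \<Lambda>"
  by (auto simp: \<Lambda>_def)

lemma \<Lambda>E:
  assumes "X \<in> \<Lambda>" obtains a where "X = ext a" "\<And>g. g \<in> carrier G \<Longrightarrow> a g \<in> \<O>"
  using assms by (auto simp: \<Lambda>_def)

lemma add_in_\<Lambda>: "X \<in> \<Lambda> \<Longrightarrow> Y \<in> \<Lambda> \<Longrightarrow> X + Y \<in> \<Lambda>"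
  by (elim \<Lambda>E) (simp add: ext_add[symmetric] ext_in_\<Lambda> red.add_mem)

lemma smult_in_\<Lambda>: "c \<in> \<O> \<Longrightarrow> X \<in> \<Lambda> \<Longrightarrow> c \<cdot>\<^sub>m X \<in> \<Lambda>"
  by (elim \<Lambda>E) (simp add: ext_smult[symmetric] ext_in_\<Lambda> red.mult_mem)

lemma convolution_integral:
  assumes "\<And>g. g \<in> carrier G \<Longrightarrow> a g \<in> \<O>" "\<And>g. g \<in> carrier G \<Longrightarrow> b g \<in> \<O>"
  shows "(a \<otimes>\<^bsub>group_algebra G S\<^esub> b) g \<in> \<O>"
  using assms by (auto simp: group_algebra_def red.zero_mem intro!: red.sum_mem red.mult_mem)

lemma mult_in_\<Lambda>:
  assumes "X \<in> \<Lambda>" "Y \<in> \<Lambda>" shows "X * Y \<in> \<Lambda>"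
proof -
  obtain a b where ab: "X = ext a" "Y = ext b" "\<forall>g\<in>carrier G. a g \<in> \<O>" "\<forall>g\<in>carrier G. b g \<in> \<O>"
    using assms by (auto simp: \<Lambda>_def)
  have "X * Y = ext (a \<otimes>\<^bsub>group_algebra G \<O>\<^esub> b)" by (simp add: ab ext_mult)
  thus ?thesis using ab by (simp add: ext_in_\<Lambda> convolution_integral)
qed

lemma spans_matrix_order_iff: "spans_matrix_order G n \<rho> \<longleftrightarrow> (\<forall>k<n. \<forall>l<n. mat_unit n k l \<in> \<Lambda>)"
proof -
  have "(\<exists>a. (\<forall>g\<in>carrier G. a g \<in> \<O>) \<and> ext a = X) \<longleftrightarrow> X \<in> \<Lambda>" for X by (auto simp: \<Lambda>_def)
  thus ?thesis by (simp add: spans_matrix_order_def)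
qed

lemma carrier_A: "carrier A = fourier_inverse ` \<Lambda>"
proof -
  have "carrier A = (\<lambda>a. fourier_inverse (ext a)) ` carrier (group_algebra G \<O>)"
    by (simp add: group_algebra_factor_def mult_char_idempotent)
  also have "\<dots> = fourier_inverse ` \<Lambda>"
  proof
    show "(\<lambda>a. fourier_inverse (ext a)) ` carrier (group_algebra G \<O>) \<subseteq> fourier_inverse ` \<Lambda>"
      by (auto simp: \<Lambda>_def group_algebra_def)
    show "fourier_inverse ` \<Lambda> \<subseteq> (\<lambda>a. fourier_inverse (ext a)) ` carrier (group_algebra G \<O>)"
    proof
      fix x assume "x \<in> fourier_inverse ` \<Lambda>"
      then obtain a where a: "x = fourier_inverse (ext a)" "\<forall>g\<in>carrier G. a g \<in> \<O>" by (auto simp: \<Lambda>_def)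
      have "ext a = ext (\<lambda>g. if g \<in> carrier G then a g else 0)" by (rule ext_cong) simp
      moreover have "(\<lambda>g. if g \<in> carrier G then a g else 0) \<in> carrier (group_algebra G \<O>)"
        using a by (simp add: group_algebra_def)
      ultimately show "x \<in> (\<lambda>a. fourier_inverse (ext a)) ` carrier (group_algebra G \<O>)"
        using a(1) by auto
    qed
  qed
  finally show ?thesis .
qed

lemma mult_A:
  "X \<in> \<Lambda> \<Longrightarrow> Y \<in> \<Lambda> \<Longrightarrow> fourier_inverse X \<otimes>\<^bsub>A\<^esub> fourier_inverse Y = fourier_inverse (X * Y)"
  using fourier_inverse_mult[of X Y \<O>] \<Lambda>_carrier by (simp add: group_algebra_factor_def)

lemma add_A:
  "X \<in> \<Lambda> \<Longrightarrow> Y \<in> \<Lambda> \<Longrightarrow> fourier_inverse X \<oplus>\<^bsub>A\<^esub> fourier_inverse Y = fourier_inverse (X + Y)"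
  using fourier_inverse_add[of X Y] \<Lambda>_carrier by (simp add: group_algebra_factor_def group_algebra_def)

lemma smult_A:
  "X \<in> \<Lambda> \<Longrightarrow> c \<odot>\<^bsub>A\<^esub> fourier_inverse X = fourier_inverse (c \<cdot>\<^sub>m X)"
  using fourier_inverse_smult[of X c] \<Lambda>_carrier by (simp add: group_algebra_factor_def group_algebra_def)

lemma ext_fourier_\<Lambda>: "X \<in> \<Lambda> \<Longrightarrow> ext (fourier_inverse X) = X"
  using ext_fourier_inverse \<Lambda>_carrier by blast

lemma ring_R: "ring R"
proof -
  interpret principal_domain R by (rule principal_domain_O)
  show ?thesis by (rule ring_axioms)
qed

lemma regular_module_R [simp]:
  "carrier (regular_module R) = \<O>" "x \<oplus>\<^bsub>regular_module R\<^esub> y = x + y" "c \<odot>\<^bsub>regular_module R\<^esub> x = c * x"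
  by (simp_all add: regular_module_def)

lemma dual_carrier:
  "f \<in> carrier (dual_module R A) \<longleftrightarrow>
    f \<in> extensional (carrier A) \<and> (\<forall>X\<in>\<Lambda>. f (fourier_inverse X) \<in> \<O>) \<and>
    (\<forall>X\<in>\<Lambda>. \<forall>Y\<in>\<Lambda>. f (fourier_inverse (X + Y)) = f (fourier_inverse X) + f (fourier_inverse Y)) \<and>
    (\<forall>c\<in>\<O>. \<forall>X\<in>\<Lambda>. f (fourier_inverse (c \<cdot>\<^sub>m X)) = c * f (fourier_inverse X))"
proof -
  let ?F = fourier_inverse
  have "f \<in> carrier (dual_module R A) \<longleftrightarrow> f \<in> extensional (carrier A) \<and>
      (\<forall>x\<in>?F ` \<Lambda>. f x \<in> \<O>) \<and>
      (\<forall>x\<in>?F ` \<Lambda>. \<forall>y\<in>?F ` \<Lambda>. f (x \<oplus>\<^bsub>A\<^esub> y) = f x + f y) \<and>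
      (\<forall>c\<in>\<O>. \<forall>x\<in>?F ` \<Lambda>. f (c \<odot>\<^bsub>A\<^esub> x) = c * f x)"
    unfolding dual_module_def LinearCombinations.module_hom_def carrier_A
    by (auto simp: Pi_iff)
  thus ?thesis by (simp add: add_A smult_A cong: ball_cong)
qed

lemma dual_mem: "f \<in> carrier (dual_module R A) \<Longrightarrow> X \<in> \<Lambda> \<Longrightarrow> f (fourier_inverse X) \<in> \<O>"
  and dual_addD: "f \<in> carrier (dual_module R A) \<Longrightarrow> X \<in> \<Lambda> \<Longrightarrow> Y \<in> \<Lambda> \<Longrightarrow>
    f (fourier_inverse (X + Y)) = f (fourier_inverse X) + f (fourier_inverse Y)"
  and dual_smultD: "f \<in> carrier (dual_module R A) \<Longrightarrow> c \<in> \<O> \<Longrightarrow> X \<in> \<Lambda> \<Longrightarrow>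
    f (fourier_inverse (c \<cdot>\<^sub>m X)) = c * f (fourier_inverse X)"
  by (simp_all add: dual_carrier)

lemma dual_add: "f \<oplus>\<^bsub>dual_module R A\<^esub> g = (\<lambda>y\<in>carrier A. f y + g y)"
  and dual_smult: "c \<odot>\<^bsub>dual_module R A\<^esub> f = (\<lambda>y\<in>carrier A. c * f y)"
  by (simp_all add: dual_module_def ring.func_space_def[OF ring_R])

text \<open>This will be applied to the decomposition of a matrix into matrix units and to the images of
  elements of \<open>\<O>G\<close>, which are combinations of group elements.\<close>

lemma dual_mat_sum:
  assumes f: "f \<in> carrier (dual_module R A)" and "finite S"
    and "\<And>x. x \<in> S \<Longrightarrow> c x \<in> \<O>" "\<And>x. x \<in> S \<Longrightarrow> E x \<in> \<Lambda>"
  shows "mat_sum n (\<lambda>x. c x \<cdot>\<^sub>m E x) S \<in> \<Lambda> \<and>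
    f (fourier_inverse (mat_sum n (\<lambda>x. c x \<cdot>\<^sub>m E x) S)) = (\<Sum>x\<in>S. c x * f (fourier_inverse (E x)))"
  using assms(2-)
proof (induction S rule: finite_induct)
  case empty
  have z: "mat_sum n (\<lambda>x. c x \<cdot>\<^sub>m E x) {} = 0 \<cdot>\<^sub>m 1\<^sub>m n" by (intro eq_matI) (auto simp: mat_sum_def)
  have "f (fourier_inverse (0 \<cdot>\<^sub>m 1\<^sub>m n)) = 0 * f (fourier_inverse (1\<^sub>m n))"
    by (rule dual_smultD[OF f red.zero_mem one_in_\<Lambda>])
  thus ?case unfolding z using smult_in_\<Lambda>[OF red.zero_mem one_in_\<Lambda>] by simp
next
  case (insert x S)
  have Ex: "E x \<in> \<Lambda>" "c x \<in> \<O>" using insert by auto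
  have eq: "mat_sum n (\<lambda>x. c x \<cdot>\<^sub>m E x) (insert x S) = c x \<cdot>\<^sub>m E x + mat_sum n (\<lambda>x. c x \<cdot>\<^sub>m E x) S"
    using insert \<Lambda>_carrier[OF Ex(1)] by (intro eq_matI) (auto simp: mat_sum_def)
  have IH: "mat_sum n (\<lambda>x. c x \<cdot>\<^sub>m E x) S \<in> \<Lambda>"
    "f (fourier_inverse (mat_sum n (\<lambda>x. c x \<cdot>\<^sub>m E x) S)) = (\<Sum>x\<in>S. c x * f (fourier_inverse (E x)))"
    using insert by auto
  note s = smult_in_\<Lambda>[OF Ex(2,1)]
  have "f (fourier_inverse (c x \<cdot>\<^sub>m E x + mat_sum n (\<lambda>x. c x \<cdot>\<^sub>m E x) S))
      = f (fourier_inverse (c x \<cdot>\<^sub>m E x)) + f (fourier_inverse (mat_sum n (\<lambda>x. c x \<cdot>\<^sub>m E x) S))"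
    by (rule dual_addD[OF f s IH(1)])
  moreover have "f (fourier_inverse (c x \<cdot>\<^sub>m E x)) = c x * f (fourier_inverse (E x))"
    by (rule dual_smultD[OF f Ex(2,1)])
  ultimately show ?case unfolding eq using IH insert.hyps add_in_\<Lambda>[OF s IH(1)] by simp
qed

definition trace_functional :: "'k mat \<Rightarrow> ('g \<Rightarrow> 'k) \<Rightarrow> 'k" where
  "trace_functional X = (\<lambda>y\<in>carrier A. mat_trace (X * ext y))"

lemma trace_functional_apply:
  "Y \<in> \<Lambda> \<Longrightarrow> trace_functional X (fourier_inverse Y) = mat_trace (X * Y)"
  by (simp add: trace_functional_def carrier_A ext_fourier_\<Lambda>)

lemma trace_functional_dual:
  assumes "X \<in> red.mats n"
  shows "trace_functional X \<in> carrier (dual_module R A)"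
proof -
  have X: "X \<in> carrier_mat n n" using assms by (rule red.mats_carrier)
  have 1: "mat_trace (X * (Y + Z)) = mat_trace (X * Y) + mat_trace (X * Z)" if "Y \<in> \<Lambda>" "Z \<in> \<Lambda>" for Y Z
    using X \<Lambda>_carrier[OF that(1)] \<Lambda>_carrier[OF that(2)]
    by (simp add: square_mult_add[where n=n] mat_trace_add[of _ n])
  have 2: "mat_trace (X * (c \<cdot>\<^sub>m Y)) = c * mat_trace (X * Y)" if "Y \<in> \<Lambda>" for c Y
    using X \<Lambda>_carrier[OF that]
    by (simp add: square_mult_smult[where n=n] mat_trace_smult[of _ n])
  have 3: "mat_trace (X * Y) \<in> \<O>" if "Y \<in> \<Lambda>" for Y
    using assms \<Lambda>_mats[OF that] by (intro red.mats_trace red.mats_mult)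
  show ?thesis unfolding dual_carrier
    using 1 2 3 by (simp add: trace_functional_apply add_in_\<Lambda> smult_in_\<Lambda>) (simp add: trace_functional_def)
qed

text \<open>The trace form symmetrises the matrix algebra over \<open>\<O>\<close>: the transpose of the matrix of values of
  a linear form at the matrix units represents that form. The matrix units also form a basis.\<close>

theorem symmetric_if_spans_matrix_order:
  assumes spans: "spans_matrix_order G n \<rho>"
  shows "symmetric_algebra R A"
proof -
  have unit: "mat_unit n k l \<in> \<Lambda>" if "k < n" "l < n" for k l
    using spans that by (simp add: spans_matrix_order_iff)
  let ?S = "{..<n} \<times> {..<n}"
  have decomp: "X = mat_sum n (\<lambda>x. X $$ x \<cdot>\<^sub>m mat_unit n (fst x) (snd x)) ?S" if X: "X \<in> carrier_mat n n" for X :: "'k mat"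
  proof (rule eq_matI)
    fix i j assume "i < dim_row (mat_sum n (\<lambda>x. X $$ x \<cdot>\<^sub>m mat_unit n (fst x) (snd x)) ?S)"
      "j < dim_col (mat_sum n (\<lambda>x. X $$ x \<cdot>\<^sub>m mat_unit n (fst x) (snd x)) ?S)"
    hence ij: "i < n" "j < n" by (auto simp: mat_sum_def)
    have "mat_sum n (\<lambda>x. X $$ x \<cdot>\<^sub>m mat_unit n (fst x) (snd x)) ?S $$ (i, j)
      = (\<Sum>x\<in>?S. if x = (i, j) then X $$ x else 0)"
      unfolding mat_sum_index[OF ij] using ij by (intro sum.cong refl) (auto simp: mat_unit_def)
    also have "\<dots> = X $$ (i, j)" using ij by (simp add: sum.delta)
    finally show "X $$ (i, j) = mat_sum n (\<lambda>x. X $$ x \<cdot>\<^sub>m mat_unit n (fst x) (snd x)) ?S $$ (i, j)" ..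
  qed (use X in \<open>auto simp: mat_sum_def\<close>)
  have dual_eq: "X \<in> \<Lambda> \<and> f (fourier_inverse X) = (\<Sum>x\<in>?S. X $$ x * f (fourier_inverse (mat_unit n (fst x) (snd x))))"
    if X: "X \<in> red.mats n" and f: "f \<in> carrier (dual_module R A)" for X f
    using dual_mat_sum[OF f, of ?S "\<lambda>x. X $$ x" "\<lambda>x. mat_unit n (fst x) (snd x)"] unit
      decomp[OF red.mats_carrier[OF X]] red.mats_entry[OF X] by auto
  have \<Lambda>: "X \<in> \<Lambda> \<longleftrightarrow> X \<in> red.mats n" for X
    using dual_eq[OF _ trace_functional_dual[OF red.mats_one], of X] \<Lambda>_mats[of X] by auto
  have "fg_projective R A"
    unfolding fg_projective_def
  proof (intro exI conjI ballI)
    let ?\<iota> = "\<lambda>x. \<lambda>m\<in>{..<n * n}. ext x $$ (m div n, m mod n)"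
    let ?\<pi> = "\<lambda>f. fourier_inverse (mat n n (\<lambda>(i, j). f (i * n + j)))"
    have dm: "m div n < n" "m mod n < n" if "m < n * n" for m
      using that n_pos by (simp_all add: less_mult_imp_div_less)
    note lt = pair_index_less
    show "?\<iota> \<in> LinearCombinations.module_hom R A (ring.func_space R {..<n * n})"
      unfolding LinearCombinations.module_hom_def ring.func_space_def[OF ring_R]
    proof (intro CollectI conjI allI impI, goal_cases)
      case 1
      show ?case using dm by (auto simp: carrier_A ext_fourier_\<Lambda> intro!: red.mats_entry[OF \<Lambda>_mats] split: if_splits)
    next
      case (2 x y)
      then obtain X Y where XY: "X \<in> \<Lambda>" "Y \<in> \<Lambda>" "x = fourier_inverse X" "y = fourier_inverse Y"
        by (auto simp: carrier_A)
      show ?case using dm \<Lambda>_carrier[OF XY(1)] \<Lambda>_carrier[OF XY(2)]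
        by (auto simp: XY add_A ext_fourier_\<Lambda> add_in_\<Lambda> fun_eq_iff)
    next
      case (3 c x)
      then obtain X where X: "X \<in> \<Lambda>" "x = fourier_inverse X" "c \<in> \<O>" by (auto simp: carrier_A)
      show ?case using dm \<Lambda>_carrier[OF X(1)] X(3)
        by (auto simp: X(2) smult_A[OF X(1)] ext_fourier_\<Lambda>[OF X(1)] ext_fourier_\<Lambda>[OF smult_in_\<Lambda>[OF X(3,1)]] fun_eq_iff)
    qed
    have m: "mat n n (\<lambda>(i, j). f (i * n + j)) \<in> \<Lambda>" if "f \<in> {..<n * n} \<rightarrow>\<^sub>E \<O>" for f
      unfolding \<Lambda> using that lt by (intro red.matsI) (auto simp: PiE_iff)
    show "?\<pi> \<in> LinearCombinations.module_hom R (ring.func_space R {..<n * n}) A"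
      unfolding LinearCombinations.module_hom_def ring.func_space_def[OF ring_R] carrier_A
      using lt m by (auto simp: add_A[OF m m] smult_A[OF m] intro!: arg_cong[of _ _ fourier_inverse] eq_matI)
    fix x assume "x \<in> carrier A"
    then obtain X where X: "X \<in> \<Lambda>" "x = fourier_inverse X" by (auto simp: carrier_A)
    have "mat n n (\<lambda>(i, j). ?\<iota> x (i * n + j)) = X"
      using \<Lambda>_carrier[OF X(1)] lt by (intro eq_matI) (auto simp: X(2) ext_fourier_\<Lambda>[OF X(1)])
    thus "?\<pi> (?\<iota> x) = x" by (simp only: X(2))
  qed
  moreover have "\<exists>\<Phi>. \<Phi> \<in> LinearCombinations.module_hom R A (dual_module R A) \<and>
        bij_betw \<Phi> (carrier A) (carrier (dual_module R A)) \<and>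
        (\<forall>a\<in>carrier A. \<forall>x\<in>carrier A. \<forall>b\<in>carrier A.
           \<Phi> (a \<otimes>\<^bsub>A\<^esub> x \<otimes>\<^bsub>A\<^esub> b) = (\<lambda>y\<in>carrier A. \<Phi> x (b \<otimes>\<^bsub>A\<^esub> y \<otimes>\<^bsub>A\<^esub> a)))"
  proof (intro exI conjI ballI)
    let ?\<Phi> = "\<lambda>x. trace_functional (ext x)"
    show "?\<Phi> \<in> LinearCombinations.module_hom R A (dual_module R A)"
      unfolding LinearCombinations.module_hom_def dual_add dual_smult
    proof (intro CollectI conjI allI impI)
      show "?\<Phi> \<in> carrier A \<rightarrow> carrier (dual_module R A)"
        by (auto simp: carrier_A ext_fourier_\<Lambda> intro!: trace_functional_dual \<Lambda>_mats)
      fix x y assume "x \<in> carrier A \<and> y \<in> carrier A"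
      then obtain X Y where XY: "X \<in> \<Lambda>" "Y \<in> \<Lambda>" "x = fourier_inverse X" "y = fourier_inverse Y"
        by (auto simp: carrier_A)
      show "?\<Phi> (x \<oplus>\<^bsub>A\<^esub> y) = (\<lambda>z\<in>carrier A. ?\<Phi> x z + ?\<Phi> y z)"
      proof
        fix z
        show "?\<Phi> (x \<oplus>\<^bsub>A\<^esub> y) z = (\<lambda>z\<in>carrier A. ?\<Phi> x z + ?\<Phi> y z) z"
          using \<Lambda>_carrier[OF XY(1)] \<Lambda>_carrier[OF XY(2)]
          by (simp add: trace_functional_def XY add_A ext_fourier_\<Lambda> add_in_\<Lambda>
              square_add_mult[where n=n] mat_trace_add[of _ n])
      qed
    next
      fix c x assume "c \<in> carrier R \<and> x \<in> carrier A"
      then obtain X where X: "X \<in> \<Lambda>" "x = fourier_inverse X" "c \<in> \<O>" by (auto simp: carrier_A)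
      show "?\<Phi> (c \<odot>\<^bsub>A\<^esub> x) = (\<lambda>z\<in>carrier A. c * ?\<Phi> x z)"
      proof
        fix z
        show "?\<Phi> (c \<odot>\<^bsub>A\<^esub> x) z = (\<lambda>z\<in>carrier A. c * ?\<Phi> x z) z"
          using \<Lambda>_carrier[OF X(1)] X(3)
          by (simp add: trace_functional_def X smult_A ext_fourier_\<Lambda> smult_in_\<Lambda>
              square_smult_mult[where n=n] mat_trace_smult[of _ n])
      qed
    qed
    show "bij_betw ?\<Phi> (carrier A) (carrier (dual_module R A))"
    proof (rule bij_betw_imageI)
      show "inj_on ?\<Phi> (carrier A)"
      proof (rule inj_onI)
        fix x y assume "x \<in> carrier A" "y \<in> carrier A" and eq: "?\<Phi> x = ?\<Phi> y"
        then obtain X Y where XY: "X \<in> \<Lambda>" "Y \<in> \<Lambda>" "x = fourier_inverse X" "y = fourier_inverse Y"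
          by (auto simp: carrier_A)
        have "X = Y"
        proof (rule eq_matI)
          fix i j assume "i < dim_row Y" "j < dim_col Y"
          hence ij: "i < n" "j < n" using \<Lambda>_carrier[OF XY(2)] by auto
          have "mat_trace (X * mat_unit n j i) = mat_trace (Y * mat_unit n j i)"
            using fun_cong[OF eq, of "fourier_inverse (mat_unit n j i)"] unit[OF ij(2,1)] XY
            by (simp add: trace_functional_apply ext_fourier_\<Lambda>)
          thus "X $$ (i, j) = Y $$ (i, j)"
            using \<Lambda>_carrier[OF XY(1)] \<Lambda>_carrier[OF XY(2)] ij by (simp add: mat_trace_mult_unit)
        qed (use \<Lambda>_carrier[OF XY(1)] \<Lambda>_carrier[OF XY(2)] in auto)
        thus "x = y" using XY by simp
      qed
      show "?\<Phi> ` carrier A = carrier (dual_module R A)"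
      proof
        show "?\<Phi> ` carrier A \<subseteq> carrier (dual_module R A)"
          by (auto simp: carrier_A ext_fourier_\<Lambda> intro!: trace_functional_dual \<Lambda>_mats)
        show "carrier (dual_module R A) \<subseteq> ?\<Phi> ` carrier A"
        proof
          fix f assume f: "f \<in> carrier (dual_module R A)"
          define X where "X = mat n n (\<lambda>(i, j). f (fourier_inverse (mat_unit n j i)))"
          have X: "X \<in> \<Lambda>" unfolding \<Lambda> X_def
            using f unit by (intro red.matsI) (auto simp: dual_carrier)
          have "f = ?\<Phi> (fourier_inverse X)"
          proof (rule extensionalityI[of _ "carrier A"])
            show "f \<in> extensional (carrier A)" using f by (simp add: dual_carrier)
            show "?\<Phi> (fourier_inverse X) \<in> extensional (carrier A)" by (simp add: trace_functional_def)
            fix y assume "y \<in> carrier A"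
            then obtain Y where Y: "Y \<in> \<Lambda>" "y = fourier_inverse Y" by (auto simp: carrier_A)
            have "f y = (\<Sum>x\<in>?S. Y $$ x * f (fourier_inverse (mat_unit n (fst x) (snd x))))"
              using dual_eq[OF \<Lambda>_mats[OF Y(1)] f] Y(2) by simp
            also have "\<dots> = (\<Sum>i<n. \<Sum>j<n. Y $$ (i, j) * X $$ (j, i))"
              by (subst sum.cartesian_product) (auto simp: X_def intro!: sum.cong)
            also have "\<dots> = mat_trace (Y * X)"
              by (rule mat_trace_mult[symmetric]) (use X Y \<Lambda>_carrier in auto)
            also have "\<dots> = mat_trace (X * Y)"
              by (rule mat_trace_comm[where n=n and m=n]) (use X Y \<Lambda>_carrier in auto)
            finally show "f y = ?\<Phi> (fourier_inverse X) y"
              using X Y by (simp add: trace_functional_apply ext_fourier_\<Lambda>)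
          qed
          thus "f \<in> ?\<Phi> ` carrier A" using X by (auto simp: carrier_A)
        qed
      qed
    qed
    fix a x b assume "a \<in> carrier A" "x \<in> carrier A" "b \<in> carrier A"
    then obtain P X Q where PXQ: "P \<in> \<Lambda>" "X \<in> \<Lambda>" "Q \<in> \<Lambda>"
      "a = fourier_inverse P" "x = fourier_inverse X" "b = fourier_inverse Q" by (auto simp: carrier_A)
    show "?\<Phi> (a \<otimes>\<^bsub>A\<^esub> x \<otimes>\<^bsub>A\<^esub> b) = (\<lambda>y\<in>carrier A. ?\<Phi> x (b \<otimes>\<^bsub>A\<^esub> y \<otimes>\<^bsub>A\<^esub> a))"
    proof (rule extensionalityI[of _ "carrier A"])
      fix y assume y: "y \<in> carrier A"
      then obtain Y where Y: "Y \<in> \<Lambda>" "y = fourier_inverse Y" by (auto simp: carrier_A)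
      note car = PXQ(1-3)[THEN \<Lambda>_carrier] Y(1)[THEN \<Lambda>_carrier]
          have "mat_trace (P * X * Q * Y) = mat_trace (P * (X * (Q * Y)))" using car by (simp add: square_assoc[where n=n])
      also have "\<dots> = mat_trace (X * (Q * Y) * P)"
        using car by (intro mat_trace_comm[where n=n and m=n]) auto
      also have "\<dots> = mat_trace (X * (Q * Y * P))" using car by (simp add: square_assoc[where n=n])
      finally show "?\<Phi> (a \<otimes>\<^bsub>A\<^esub> x \<otimes>\<^bsub>A\<^esub> b) y = (\<lambda>y\<in>carrier A. ?\<Phi> x (b \<otimes>\<^bsub>A\<^esub> y \<otimes>\<^bsub>A\<^esub> a)) y"
        using y PXQ Y by (simp add: mult_A mult_in_\<Lambda> trace_functional_apply ext_fourier_\<Lambda>)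
    qed (auto simp: trace_functional_def)
  qed
  ultimately show ?thesis unfolding symmetric_algebra_def by blast
qed

text \<open>The image \<open>s\<close> of the unit element under an isomorphism of \<open>A\<close> with its dual is a symmetric linear
  form, and every linear form on \<open>\<Lambda>\<close> is \<open>Y \<mapsto> s(X Y)\<close> for some \<open>X\<close> in \<open>\<Lambda>\<close>. Symmetric forms are multiples
  \<open>\<mu> tr\<close> of the trace; the element \<open>c\<close> ensures that \<open>\<mu>\<close> is integral.\<close>

theorem spans_matrix_order_if_symmetric:
  assumes sym: "symmetric_algebra R A"
    and c: "\<forall>g\<in>carrier G. c g \<in> \<O>" "red (mat_trace (ext c)) \<noteq> 0"
  shows "spans_matrix_order G n \<rho>"
proof -
  let ?F = fourier_inverse
  obtain \<Phi> where bij: "bij_betw \<Phi> (carrier A) (carrier (dual_module R A))"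
    and bimod: "\<And>a x b. a \<in> carrier A \<Longrightarrow> x \<in> carrier A \<Longrightarrow> b \<in> carrier A \<Longrightarrow>
           \<Phi> (a \<otimes>\<^bsub>A\<^esub> x \<otimes>\<^bsub>A\<^esub> b) = (\<lambda>y\<in>carrier A. \<Phi> x (b \<otimes>\<^bsub>A\<^esub> y \<otimes>\<^bsub>A\<^esub> a))"
    using sym unfolding symmetric_algebra_def by blast
  define s where "s X = \<Phi> (?F (1\<^sub>m n)) (?F X)" for X
  have memA: "X \<in> \<Lambda> \<Longrightarrow> ?F X \<in> carrier A" for X by (simp add: carrier_A)
  have e: "?F (1\<^sub>m n) \<in> carrier A" by (rule memA[OF one_in_\<Lambda>])
  have f: "\<Phi> (?F (1\<^sub>m n)) \<in> carrier (dual_module R A)" using bij e by (rule bij_betwE[rule_format])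
  have sO: "s X \<in> \<O>" if "X \<in> \<Lambda>" for X unfolding s_def by (rule dual_mem[OF f that])
  have s1: "\<Phi> (?F X) (?F Y) = s (Y * X)" and s2: "\<Phi> (?F X) (?F Y) = s (X * Y)"
    if "X \<in> \<Lambda>" "Y \<in> \<Lambda>" for X Y
  proof -
    note car = \<Lambda>_carrier[OF that(1)] \<Lambda>_carrier[OF that(2)]
    have "?F X \<otimes>\<^bsub>A\<^esub> ?F (1\<^sub>m n) \<otimes>\<^bsub>A\<^esub> ?F (1\<^sub>m n) = ?F X" using that car by (simp add: mult_A one_in_\<Lambda>)
    hence "\<Phi> (?F X) = (\<lambda>y\<in>carrier A. \<Phi> (?F (1\<^sub>m n)) (?F (1\<^sub>m n) \<otimes>\<^bsub>A\<^esub> y \<otimes>\<^bsub>A\<^esub> ?F X))"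
      using bimod[OF memA[OF that(1)] e e] by (simp only:)
    thus "\<Phi> (?F X) (?F Y) = s (Y * X)" using that car by (simp add: memA mult_A one_in_\<Lambda> s_def)
    have "?F (1\<^sub>m n) \<otimes>\<^bsub>A\<^esub> ?F (1\<^sub>m n) \<otimes>\<^bsub>A\<^esub> ?F X = ?F X" using that car by (simp add: mult_A one_in_\<Lambda>)
    hence "\<Phi> (?F X) = (\<lambda>y\<in>carrier A. \<Phi> (?F (1\<^sub>m n)) (?F X \<otimes>\<^bsub>A\<^esub> y \<otimes>\<^bsub>A\<^esub> ?F (1\<^sub>m n)))"
      using bimod[OF e e memA[OF that(1)]] by (simp only:)
    thus "\<Phi> (?F X) (?F Y) = s (X * Y)" using that car by (simp add: memA mult_A mult_in_\<Lambda> one_in_\<Lambda> s_def)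
  qed
  have s_ext: "s (ext a) = (\<Sum>g\<in>carrier G. a g * s (\<rho> g))" if "\<And>g. g \<in> carrier G \<Longrightarrow> a g \<in> \<O>" for a
    using dual_mat_sum[OF f fin, of a \<rho>] that rep_in_\<Lambda> unfolding ext_eq_mat_sum s_def by auto
  \<comment> \<open>Fourier inversion expands \<open>X\<close> in the matrices of the group elements, so that \<open>s\<close> is the trace form of
    the following matrix. The coefficients of the expansion are integral only after multiplication
    by the group order.\<close>
  define C where "C = mat_sum n (\<lambda>x. (of_nat n / of_nat (Coset.order G) * s (\<rho> x)) \<cdot>\<^sub>m \<rho> (inv x)) (carrier G)"
  have C: "C \<in> carrier_mat n n" by (simp add: C_def)
  have sC: "s X = mat_trace (C * X)" if X: "X \<in> \<Lambda>" for X
  proof -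
    let ?N = "of_nat (Coset.order G) :: 'k"
    note Xc = \<Lambda>_carrier[OF X]
    have "?N * ?F X g \<in> \<O>" if "g \<in> carrier G" for g
    proof -
      have "?N * ?F X g = of_nat n * mat_trace (\<rho> (inv g) * X)"
        using that order_nonzero by (simp add: fourier_inverse_def)
      moreover have "mat_trace (\<rho> (inv g) * X) \<in> \<O>"
        using that X by (intro red.mats_trace[of _ n] red.mats_mult integral \<Lambda>_mats) auto
      ultimately show ?thesis using red.of_nat_mem red.mult_mem by simp
    qed
    hence "s (ext (\<lambda>g. ?N * ?F X g)) = (\<Sum>g\<in>carrier G. ?N * ?F X g * s (\<rho> g))" by (rule s_ext)
    also have "ext (\<lambda>g. ?N * ?F X g) = ?N \<cdot>\<^sub>m X" using ext_fourier_inverse[OF Xc] by (simp add: ext_smult)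
    also have "s (?N \<cdot>\<^sub>m X) = ?N * s X" unfolding s_def by (rule dual_smultD[OF f red.of_nat_mem X])
    finally have "?N * s X = ?N * (\<Sum>g\<in>carrier G. ?F X g * s (\<rho> g))" by (simp add: sum_distrib_left mult.assoc)
    hence "s X = (\<Sum>g\<in>carrier G. ?F X g * s (\<rho> g))" using order_nonzero by simp
    also have "\<dots> = (\<Sum>g\<in>carrier G. mat_trace ((of_nat n / of_nat (Coset.order G) * s (\<rho> g)) \<cdot>\<^sub>m \<rho> (inv g) * X))"
    proof (rule sum.cong[OF refl])
      fix g assume g: "g \<in> carrier G"
      have "mat_trace ((of_nat n / of_nat (Coset.order G) * s (\<rho> g)) \<cdot>\<^sub>m \<rho> (inv g) * X)
          = of_nat n / of_nat (Coset.order G) * s (\<rho> g) * mat_trace (\<rho> (inv g) * X)"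
        using g Xc by (simp add: square_smult_mult[where n=n] mat_trace_smult[of _ n])
      thus "?F X g * s (\<rho> g) = mat_trace ((of_nat n / of_nat (Coset.order G) * s (\<rho> g)) \<cdot>\<^sub>m \<rho> (inv g) * X)"
        using g by (simp add: fourier_inverse_def)
    qed
    also have "\<dots> = mat_trace (C * X)"
      unfolding C_def using Xc
      by (subst mat_sum_mult[where n=n]) (auto intro!: mat_trace_mat_sum[symmetric])
    finally show ?thesis .
  qed
  \<comment> \<open>Since \<open>s\<close> is a class function, \<open>C\<close> commutes with the group.\<close>
  have "C * \<rho> g = \<rho> g * C" if g: "g \<in> carrier G" for g
  proof -
    let ?c = "of_nat n / of_nat (Coset.order G) :: 'k"
    have "C * \<rho> g = mat_sum n (\<lambda>x. (?c * s (\<rho> x)) \<cdot>\<^sub>m \<rho> (inv x) * \<rho> g) (carrier G)"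
      unfolding C_def using g by (intro mat_sum_mult) auto
    also have "\<dots> = mat_sum n (\<lambda>x. (?c * s (\<rho> (g \<otimes> x))) \<cdot>\<^sub>m \<rho> (inv (g \<otimes> x)) * \<rho> g) (carrier G)"
      by (rule mat_sum_reindex[OF bij_mult_left[OF g], symmetric])
    also have "\<dots> = mat_sum n (\<lambda>x. \<rho> g * ((?c * s (\<rho> (x \<otimes> g))) \<cdot>\<^sub>m \<rho> (inv (x \<otimes> g)))) (carrier G)"
    proof (rule mat_sum_cong)
      fix x assume x: "x \<in> carrier G"
      have "s (\<rho> (g \<otimes> x)) = s (\<rho> (x \<otimes> g))"
        using s1[OF rep_in_\<Lambda>[OF g] rep_in_\<Lambda>[OF x]] s2[OF rep_in_\<Lambda>[OF g] rep_in_\<Lambda>[OF x]] g x by (simp add: rep_mult)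
      moreover have "\<rho> (inv (g \<otimes> x)) * \<rho> g = \<rho> (inv x)"
        using g x by (simp add: rep_mult[symmetric] inv_mult_group m_assoc)
      moreover have "\<rho> g * \<rho> (inv (x \<otimes> g)) = \<rho> (inv x)"
        using g x by (simp add: rep_mult[symmetric] inv_mult_group m_assoc[symmetric])
      ultimately show "(?c * s (\<rho> (g \<otimes> x))) \<cdot>\<^sub>m \<rho> (inv (g \<otimes> x)) * \<rho> g
          = \<rho> g * ((?c * s (\<rho> (x \<otimes> g))) \<cdot>\<^sub>m \<rho> (inv (x \<otimes> g)))"
        using g x by (simp add: square_smult_mult[where n=n] square_mult_smult[where n=n])
    qed
    also have "\<dots> = \<rho> g * mat_sum n (\<lambda>x. (?c * s (\<rho> (x \<otimes> g))) \<cdot>\<^sub>m \<rho> (inv (x \<otimes> g))) (carrier G)"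
      using g by (intro mult_mat_sum[symmetric]) auto
    also have "mat_sum n (\<lambda>x. (?c * s (\<rho> (x \<otimes> g))) \<cdot>\<^sub>m \<rho> (inv (x \<otimes> g))) (carrier G) = C"
      unfolding C_def by (rule mat_sum_reindex[OF bij_mult_right[OF g]])
    finally show ?thesis .
  qed
  then obtain \<mu> where \<mu>: "C = \<mu> \<cdot>\<^sub>m 1\<^sub>m n" using commutant_scalar[OF C] by blast
  have s\<mu>: "s X = \<mu> * mat_trace X" if X: "X \<in> \<Lambda>" for X
    unfolding sC[OF X] \<mu> using \<Lambda>_carrier[OF X]
    by (simp add: square_smult_mult[where n=n] mat_trace_smult[of _ n])
  have "ext c \<in> \<Lambda>" using c(1) by (auto simp: \<Lambda>_def)
  have \<mu>O: "\<mu> \<in> \<O>"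
  proof -
    have t: "mat_trace (ext c) \<in> \<O>" using \<open>ext c \<in> \<Lambda>\<close> by (intro red.mats_trace[of _ n] \<Lambda>_mats)
    have "mat_trace (ext c) \<noteq> 0" using c(2) red.hom_zero by auto
    hence "\<mu> = s (ext c) * inverse (mat_trace (ext c))" using s\<mu>[OF \<open>ext c \<in> \<Lambda>\<close>] by simp
    thus ?thesis using red.mult_mem[OF sO[OF \<open>ext c \<in> \<Lambda>\<close>] inverse_mem[OF t c(2)]] by simp
  qed
  show ?thesis
    unfolding spans_matrix_order_iff
  proof (intro allI impI)
    fix k l assume kl: "k < n" "l < n"
    let ?M = "mat_unit n k l :: 'k mat"
    have "trace_functional ?M \<in> \<Phi> ` carrier A"
      using trace_functional_dual[OF red.mats_unit] bij by (simp add: bij_betw_def)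
    then obtain X where X: "X \<in> \<Lambda>" "trace_functional ?M = \<Phi> (?F X)" by (auto simp: carrier_A)
    have Xc: "X \<in> carrier_mat n n" using \<Lambda>_carrier[OF X(1)] .
    have eq: "mat_trace (?M * \<rho> g) = \<mu> * mat_trace (X * \<rho> g)" if g: "g \<in> carrier G" for g
    proof -
      have "mat_trace (?M * \<rho> g) = \<Phi> (?F X) (?F (\<rho> g))"
        using trace_functional_apply[OF rep_in_\<Lambda>[OF g], of ?M] X(2) by simp
      also have "\<dots> = s (X * \<rho> g)" by (rule s2[OF X(1) rep_in_\<Lambda>[OF g]])
      also have "\<dots> = \<mu> * mat_trace (X * \<rho> g)" by (rule s\<mu>[OF mult_in_\<Lambda>[OF X(1) rep_in_\<Lambda>[OF g]]])
      finally show ?thesis .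
    qed
    have "?M + (- \<mu>) \<cdot>\<^sub>m X = 0\<^sub>m n n"
    proof (rule fourier_inverse_nondegenerate)
      fix g assume g: "g \<in> carrier G"
      have "mat_trace (\<rho> g * (?M + (- \<mu>) \<cdot>\<^sub>m X)) = mat_trace (\<rho> g * ?M) - \<mu> * mat_trace (\<rho> g * X)"
        using g Xc by (simp add: square_mult_add[where n=n]
            square_mult_smult[where n=n] mat_trace_add[of _ n] mat_trace_smult[of _ n])
      also have "\<dots> = 0"
        using eq[OF g] g Xc mat_trace_comm[of "\<rho> g" n n ?M] mat_trace_comm[of "\<rho> g" n n X] by simp
      finally show "mat_trace (\<rho> g * (?M + (- \<mu>) \<cdot>\<^sub>m X)) = 0" .
    qed (use Xc in simp)
    hence "?M = \<mu> \<cdot>\<^sub>m X"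
    proof (intro eq_matI)
      fix i j assume "i < dim_row (\<mu> \<cdot>\<^sub>m X)" "j < dim_col (\<mu> \<cdot>\<^sub>m X)"
      hence ij: "i < n" "j < n" using Xc by auto
      have "(?M + (- \<mu>) \<cdot>\<^sub>m X) $$ (i, j) = 0" using \<open>?M + (- \<mu>) \<cdot>\<^sub>m X = 0\<^sub>m n n\<close> ij by simp
      thus "?M $$ (i, j) = (\<mu> \<cdot>\<^sub>m X) $$ (i, j)" using ij Xc by (simp add: mat_unit_def)
    qed (use Xc in \<open>auto simp: mat_unit_def\<close>)
    thus "?M \<in> \<Lambda>" using smult_in_\<Lambda>[OF \<mu>O X(1)] by simp
  qed
qed

lemma mat_trace_conjugate_by:
  assumes x: "x \<in> carrier G"
  shows "mat_trace (ext (conjugate_by G x a)) = mat_trace (ext a)"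
proof -
  have bij: "bij_betw (\<lambda>g. x \<otimes> g \<otimes> inv x) (carrier G) (carrier G)"
    using bij_betw_trans[OF bij_mult_left[OF x] bij_mult_right[OF inv_closed[OF x]]] by (simp add: comp_def)
  have "mat_trace (ext (conjugate_by G x a))
      = (\<Sum>g\<in>carrier G. conjugate_by G x a g * mat_trace (\<rho> g))" by (rule mat_trace_ext)
  also have "\<dots> = (\<Sum>g\<in>carrier G. conjugate_by G x a (x \<otimes> g \<otimes> inv x) * mat_trace (\<rho> (x \<otimes> g \<otimes> inv x)))"
    by (rule sum.reindex_bij_betw[OF bij, symmetric])
  also have "\<dots> = (\<Sum>g\<in>carrier G. a g * mat_trace (\<rho> g))"
  proof (rule sum.cong[OF refl])
    fix g assume g: "g \<in> carrier G"
    have "inv x \<otimes> (x \<otimes> g \<otimes> inv x) \<otimes> x = inv x \<otimes> x \<otimes> g \<otimes> (inv x \<otimes> x)"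
      using x g by (simp only: m_assoc m_closed inv_closed)
    also have "\<dots> = g" using x g by simp
    finally have "inv x \<otimes> (x \<otimes> g \<otimes> inv x) \<otimes> x = g" .
    moreover have "mat_trace (\<rho> (x \<otimes> g \<otimes> inv x)) = mat_trace (\<rho> g)"
      using x g rep_inv[OF x] mat_trace_conjugate[of "\<rho> (inv x)" n "\<rho> x" "\<rho> g"] by (simp add: rep_mult)
    ultimately show "conjugate_by G x a (x \<otimes> g \<otimes> inv x) * mat_trace (\<rho> (x \<otimes> g \<otimes> inv x)) = a g * mat_trace (\<rho> g)"
      using x g by (simp add: conjugate_by_def)
  qed
  also have "\<dots> = mat_trace (ext a)" by (rule mat_trace_ext[symmetric])
  finally show ?thesis .
qed

lemma mat_trace_relative_trace:
  assumes P: "subgroup P G"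
  shows "mat_trace (ext (relative_trace G P a)) = of_nat (card (lcosets P)) * mat_trace (ext a)"
proof -
  have "mat_trace (ext (relative_trace G P a))
      = (\<Sum>g\<in>carrier G. \<Sum>C\<in>lcosets P. conjugate_by G (SOME x. x \<in> C) a g * mat_trace (\<rho> g))"
    by (simp add: mat_trace_ext relative_trace_def sum_distrib_right)
  also have "\<dots> = (\<Sum>C\<in>lcosets P. \<Sum>g\<in>carrier G. conjugate_by G (SOME x. x \<in> C) a g * mat_trace (\<rho> g))"
    by (rule sum.swap)
  also have "\<dots> = (\<Sum>C\<in>lcosets P. mat_trace (ext a))"
  proof (rule sum.cong[OF refl])
    fix C assume "C \<in> lcosets P"
    then obtain y where y: "y \<in> carrier G" "C = y <# P" by (auto simp: LCOSETS_def)
    have "y \<in> C" using y P by (auto simp: l_coset_def intro!: bexI[of _ \<one>] subgroup.one_closed)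
    moreover have "C \<subseteq> carrier G" using y l_coset_subset_G[OF subgroup.subset[OF P]] by simp
    ultimately have "(SOME x. x \<in> C) \<in> carrier G" using someI[of "\<lambda>x. x \<in> C" y] by auto
    thus "(\<Sum>g\<in>carrier G. conjugate_by G (SOME x. x \<in> C) a g * mat_trace (\<rho> g)) = mat_trace (ext a)"
      using mat_trace_conjugate_by by (simp add: mat_trace_ext)
  qed
  finally show ?thesis by simp
qed

text \<open>The unit of the block is a relative trace \<open>Tr_P^G(c)\<close> of an integral element \<open>c\<close>, so that
  \<open>\<chi>(1) = |G:P| \<chi>(c)\<close>; height zero means precisely that \<open>\<chi>(c)\<close> is a unit.\<close>

lemma height_zero_unit_trace:
  assumes B: "B \<in> block_algebras G \<O>" and one: "ext \<one>\<^bsub>B\<^esub> = 1\<^sub>m n"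
    and hz: "height_zero p G B (character G \<rho>)"
  obtains c where "\<forall>g\<in>carrier G. c g \<in> \<O>" "red (mat_trace (ext c)) \<noteq> 0"
proof -
  obtain b where b1: "B = group_algebra_factor G \<O> b" and prim:
    "primitive_idempotent ((group_algebra G \<O>)\<lparr>carrier := ring_center (group_algebra G \<O>)\<rparr>) b"
    using B unfolding block_algebras_def by blast
  have "b \<in> ring_center (group_algebra G \<O>)"
    using prim[unfolded primitive_idempotent_def, THEN conjunct1] by (simp add: idempotents_def)
  hence b2: "b \<in> carrier (group_algebra G \<O>)" unfolding ring_center_def by blast
  note b = b1 b2
  obtain P d where P: "defect_group G B P" "character G \<rho> \<one> = of_nat d"
    "p_part p d = p_part p (card (lcosets P))"
    using hz unfolding height_zero_def by blast
  have "d = n" using P(2) by (simp add: character_def rep_one)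
  have PG: "subgroup P G" using P(1) by (simp add: defect_group_def)
  obtain c where c: "c \<in> carrier B" "\<one>\<^bsub>B\<^esub> = relative_trace G P c"
    using P(1) unfolding defect_group_def fixed_points_def by blast
  obtain a where a: "a \<in> carrier (group_algebra G \<O>)" "c = a \<otimes>\<^bsub>group_algebra G \<O>\<^esub> b"
    using c(1) unfolding b(1) group_algebra_factor_def by auto
  have cO: "\<forall>g\<in>carrier G. c g \<in> \<O>"
    unfolding a(2)
    by (intro ballI convolution_integral) (use a(1) b(2) in \<open>auto simp: group_algebra_def\<close>)
  define t where "t = mat_trace (ext c)"
  define m where "m = card (lcosets P)"
  have tO: "t \<in> \<O>" unfolding t_def
    using cO by (intro red.mats_trace[of _ n] integral_ext(1)[OF integral_rep]) auto
  have nm: "of_nat n = of_nat m * t"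
    using mat_trace_relative_trace[OF PG, of c] c(2) one by (simp add: m_def t_def)
  have "m \<noteq> 0"
  proof
    assume "m = 0"
    hence "(of_nat n :: 'k) = 0" using nm by simp
    thus False using n_pos by simp
  qed
  have pd: "p ^ multiplicity p n = p ^ multiplicity p m" using P(3) \<open>d = n\<close> by (simp add: p_part_def m_def)
  define q where "q = p ^ multiplicity p n"
  have "q \<noteq> 0" using prime_p by (auto simp: q_def)
  have n0: "n \<noteq> 0" using n_pos by simp
  have nu: "\<not> is_unit p" using prime_p not_prime_unit[of p] by auto
  obtain n' where n': "n = q * n'" "\<not> p dvd n'"
    unfolding q_def by (rule multiplicity_decompose'[OF n0 nu])
  obtain m' where m': "m = q * m'" "\<not> p dvd m'"
    unfolding q_def pd by (rule multiplicity_decompose'[OF \<open>m \<noteq> 0\<close> nu])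
  have "(of_nat q :: 'k) * of_nat n' = of_nat n" by (subst n'(1)) simp
  also have "\<dots> = of_nat q * (of_nat m' * t)" unfolding nm by (subst m'(1)) (simp add: mult.assoc)
  finally have "of_nat q * of_nat n' = of_nat q * (of_nat m' * t)" .
  hence "of_nat n' = of_nat m' * t" using \<open>q \<noteq> 0\<close> by simp
  hence "red (of_nat n') = red (of_nat m') * red t" using tO by (simp add: red.hom_mult red.of_nat_mem)
  moreover have "red (of_nat n') \<noteq> 0" using n'(2) red_of_nat_eq_0_iff[of n'] by simp
  ultimately have "red t \<noteq> 0" by auto
  thus ?thesis unfolding t_def by (rule that[OF cO])
qed

end

text \<open>Both sides are equivalent to \<open>\<Lambda> = M_n(\<O>)\<close> for an integral form \<open>\<tau>\<close> of a representation that affords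
  \<open>\<chi>\<close>; height zero supplies the element whose trace is a unit.\<close>

theorem corollary1p5:
  fixes G :: "('g, 'm) monoid_scheme"
    and p :: nat
    and \<O> :: "'k::field_char_0 set"
    and red :: "'k \<Rightarrow> 'f::field"
    and B :: "('k, 'g \<Rightarrow> 'k) module"
    and \<chi> :: "'g \<Rightarrow> 'k"
  assumes "p_modular_system p \<O> red"
    and "group G" and "finite (carrier G)"
    and "\<And>H. subgroup H G \<Longrightarrow> splitting_field TYPE('k) (G\<lparr>carrier := H\<rparr>)"
    and "\<And>H. subgroup H G \<Longrightarrow> splitting_field TYPE('f) (G\<lparr>carrier := H\<rparr>)"
    and "B \<in> block_algebras G \<O>"
    and "\<chi> \<in> Irr_block G B"
    and "height_zero p G B \<chi>"
  shows "symmetric_algebra (subring_of \<O>) (group_algebra_factor G \<O> (char_idempotent G \<chi>))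
           \<longleftrightarrow> (\<exists>\<phi> \<in> IBr p \<O> red G. lifts_brauer p G \<chi> \<phi>)"
proof -
  interpret M: p_modular_system p \<O> red by fact
  interpret G: group G by fact
  obtain n \<rho> where \<rho>: "irreducible_rep G n \<rho>" "\<chi> = character G \<rho>" "rep_extend G n \<rho> \<one>\<^bsub>B\<^esub> = 1\<^sub>m n"
    using assms(7) by (auto simp: Irr_block_def)
  have "abs_irr_rep G n \<rho>"
  proof -
    have "\<rho> \<in> hom G (GL TYPE('k) n)" "0 < n" using \<rho>(1) by (simp_all add: irreducible_rep_def)
    then interpret matrix_rep G n \<rho> using matrix_rep_iff_hom[OF assms(2,3)] by blast
    have "splitting_field TYPE('k) G" using assms(4)[OF G.subgroup_self] by simp
    hence scalar: "\<exists>c. M = c \<cdot>\<^sub>m 1\<^sub>m n"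
      if "M \<in> carrier_mat n n" "\<And>g. g \<in> carrier G \<Longrightarrow> M * \<rho> g = \<rho> g * M" for M
      using \<rho>(1) that unfolding splitting_field_def by blast
    show ?thesis
      by unfold_locales (rule \<open>0 < n\<close>, rule scalar)
  qed
  then obtain \<tau> where \<tau>: "abs_irr_rep G n \<tau>" "character G \<tau> = character G \<rho>"
    "\<And>g. g \<in> carrier G \<Longrightarrow> \<tau> g \<in> M.red.mats n"
    "\<And>a. rep_extend G n \<rho> a = 1\<^sub>m n \<Longrightarrow> rep_extend G n \<tau> a = 1\<^sub>m n"
    by (rule M.exists_integral_form) (rule that)
  interpret T: abs_irr_rep G n \<tau> by (rule \<tau>(1))
  interpret T: integral_irr_rep p \<O> red G n \<tau> by unfold_locales (rule \<tau>(3))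
  have \<chi>: "\<chi> = character G \<tau>" using \<rho>(2) \<tau>(2) by simp
  have "symmetric_algebra (subring_of \<O>) (group_algebra_factor G \<O> (char_idempotent G \<chi>))
      \<longleftrightarrow> M.spans_matrix_order G n \<tau>"
  proof
    assume sym: "symmetric_algebra (subring_of \<O>) (group_algebra_factor G \<O> (char_idempotent G \<chi>))"
    obtain c where "\<forall>g\<in>carrier G. c g \<in> \<O>" "red (mat_trace (rep_extend G n \<tau> c)) \<noteq> 0"
      by (rule T.height_zero_unit_trace[OF assms(6) \<tau>(4)[OF \<rho>(3)] assms(8)[unfolded \<chi>]])
    thus "M.spans_matrix_order G n \<tau>"
      by (rule T.spans_matrix_order_if_symmetric[OF sym[unfolded \<chi>]])
  next
    assume "M.spans_matrix_order G n \<tau>"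
    thus "symmetric_algebra (subring_of \<O>) (group_algebra_factor G \<O> (char_idempotent G \<chi>))"
      unfolding \<chi> by (rule T.symmetric_if_spans_matrix_order)
  qed
  also have "\<dots> \<longleftrightarrow> (\<exists>\<phi> \<in> IBr p \<O> red G. lifts_brauer p G \<chi> \<phi>)"
  proof
    assume "M.spans_matrix_order G n \<tau>"
    thus "\<exists>\<phi> \<in> IBr p \<O> red G. lifts_brauer p G \<chi> \<phi>"
      unfolding \<chi> using T.n_pos by (intro M.lifts_if_spans_matrix_order[OF T.integral_rep] assms(4))
  next
    assume "\<exists>\<phi> \<in> IBr p \<O> red G. lifts_brauer p G \<chi> \<phi>"
    then obtain d \<sigma> where \<sigma>: "irreducible_rep G d \<sigma>"
      "restrict (character G \<tau>) (p_regular p G) = brauer_character p \<O> red G \<sigma>"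
      by (auto simp: IBr_def lifts_brauer_def \<chi>)
    show "M.spans_matrix_order G n \<tau>"
      by (intro M.spans_matrix_order_if_lifts[OF T.integral_rep _ _ \<sigma>]) (rule assms(4,5), assumption)+
  qed
  finally show ?thesis .
qed

end
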